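(* Consider the nonlinear dynamic program and the AOTD algorithm described in the context, generating an infinite sequence of iterates. Suppose the reduced-Hessian lower bound, uniform controllability, uniform boundedness, and compactness/smoothness assumptions (all spelled out in the context) hold with $\mu\ge\bar\mu:=32\,\Upsilon_{\rm Upper}^{4t_C+1}/\gamma_C$. Then there exists a finite threshold $\bar\tau\ge0$ such that, for all $\tau\ge\bar\tau$ and every $i\in\{0,\dots,M-1\}$, the adaptive parameters of AOTD freeze, $$(\eta_1^\tau,\eta_2^\tau,\epsilon^\tau,\epsilon_i^\tau,b_i^\tau)=(\eta_1^{\bar\tau},\eta_2^{\bar\tau},\epsilon^{\bar\tau},\epsilon_i^{\bar\tau},b_i^{\bar\tau}),$$ the descent condition $(\nabla\mathcal L^\tau_{\bm\eta^\tau})^T(\Delta\tilde{\bm z}^\tau;\Delta\tilde{\bm\lambda}^\tau)\le-\eta_2^\tau\|\nabla\mathcal L^\tau\|^2/2$ holds, and $$\epsilon^{\bar\tau}\in(0,1),\qquad \epsilon_i^{\bar\tau}>0.$$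
   Context: **Notation.** $\|\cdot\|$ is the Euclidean norm of vectors and spectral norm of matrices; $\sigma_{\min}$ is the smallest singular value; $\mathbb I$ the identity; $(\bm x;\bm y)$ vertical concatenation. Stages are indexed by subscripts, iterations by superscripts $\tau$. **Problem.** Integers $N,n_x,n_u\ge1$, $\bar{\bm x}_0\in\mathbb R^{n_x}$, functions $g_k:\mathbb R^{n_x}\times\mathbb R^{n_u}\to\mathbb R$, $f_k:\mathbb R^{n_x}\times\mathbb R^{n_u}\to\mathbb R^{n_x}$ ($0\le k\le N-1$), $g_N:\mathbb R^{n_x}\to\mathbb R$. The problem is to minimize $\sum_{k=0}^{N-1}g_k(\bm x_k,\bm u_k)+g_N(\bm x_N)$ subject to $\bm x_0=\bar{\bm x}_0$, $\bm x_{k+1}=f_k(\bm x_k,\bm u_k)$. Put $\bm z_k=(\bm x_k;\bm u_k)$ for $k<N$, $\bm z_N=\bm x_N$, $\bm z=(\bm z_0;\dots;\bm z_N)$; $g(\bm z)$ is the total cost, $f(\bm z)=(\bm x_0-\bar{\bm x}_0;\ \bm x_1-f_0(\bm x_0,\bm u_0);\dots;\bm x_N-f_{N-1}(\bm x_{N-1},\bm u_{N-1}))$, $\bm\lambda=(\bm\lambda_0;\dots;\bm\lambda_N)$ with $\bm\lambda_k\in\mathbb R^{n_x}$, $\mathcal L(\bm z,\bm\lambda)=g(\bm z)+\bm\lambda^Tf(\bm z)$, $\nabla\mathcal L=(\nabla_{\bm z}\mathcal L;\nabla_{\bm\lambda}\mathcal L)$. A superscript $\tau$ denotes evaluation at $(\bm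 z^\tau,\bm\lambda^\tau)$. $A_k,B_k$ are the Jacobians of $f_k$ in $\bm x_k,\bm u_k$; $G$ is the Jacobian of $f$; $H=\nabla^2_{\bm z}\mathcal L=\mathrm{diag}(H_0,\dots,H_N)$, where $H_k$ depends on $(\bm z_k,\bm\lambda_{k+1})$ for $k<N$ and $H_N$ on $\bm z_N$. $\hat H^\tau=\mathrm{diag}(\hat H_0^\tau,\dots,\hat H_N^\tau)$ is a symmetric modification of $H^\tau$ with the same block structure, $\hat H_k^\tau=\begin{pmatrix}\hat Q_k&\hat S_k^T\\ \hat S_k&\hat R_k\end{pmatrix}$ ($k<N$), $\hat H_N^\tau=\hat Q_N$, with $\hat H^\tau=H^\tau$ whenever $H^\tau$ itself satisfies the reduced-Hessian lower bound below. $\Gamma^\tau=\begin{pmatrix}\hat H^\tau&(G^\tau)^T\\ G^\tau&\bm0\end{pmatrix}$. The exact Newton direction $(\Delta\bm z^\tau,\Delta\bm\lambda^\tau)$ solves $\Gamma^\tau(\Delta\bm z^\tau;\Delta\bm\lambda^\tau)=-\nabla\mathcal L^\tau$. **Merit function.** For $\bm\eta=(\eta_1,\eta_2)$ positive, $\mathcal L_{\bm\eta}=\mathcal L+\frac{\eta_1}2\|\nabla_{\bm\lambda}\mathcal L\|^2+\frac{\eta_2}2\|\nabla_{\bm z}\mathcal L\|^2$; $\mathcal L^\tau_{\bm\eta}=\mathcal L_{\bm\eta}(\bm z^\tau,\bm\lambda^\tau)$. **Decomposition.** $M\in\{1,\dots,N\}$, knots $0=n_0<\dots<n_M=N$, cores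 $\mathcal K_i=\{n_i,\dots,n_{i+1}-1\}$ for $i<M-1$ and $\mathcal K_{M-1}=\{n_{M-1},\dots,N\}$. Given nominal overlap $b_i\in\mathbb Z_{\ge1}$, subproblem $i\in\{0,\dots,M-1\}$ has window $[m_1,m_2]$, $m_1=m_1^i=\max\{n_i-b_i,0\}$, $m_2=m_2^i=\min\{n_{i+1}+b_i,N\}$. With a fixed $\mu>0$, the local quadratic program at iteration $\tau$, in $\bm p_k\in\mathbb R^{n_x}$ ($m_1\le k\le m_2$), $\bm q_k\in\mathbb R^{n_u}$ ($m_1\le k<m_2$), minimizes $$\sum_{k=m_1}^{m_2-1}\Big\{\tfrac12\begin{pmatrix}\bm p_k\\\bm q_k\end{pmatrix}^T\hat H_k^\tau\begin{pmatrix}\bm p_k\\\bm q_k\end{pmatrix}+(\nabla_{\bm x_k}\mathcal L^\tau)^T\bm p_k+(\nabla_{\bm u_k}\mathcal L^\tau)^T\bm q_k\Big\}+\tfrac12\bm p_{m_2}^T\hat H_{\rm T}\bm p_{m_2}+(\nabla_{\bm x_{m_2}}\mathcal L^\tau)^T\bm p_{m_2},$$ $\hat H_{\rm T}=\hat Q_{m_2}+\mu\mathbb I$ if $m_2<N$ and $\hat Q_N$ if $m_2=N$, subject to $\bm p_{m_1}=\bm d_1$ and $\bm p_{k+1}=A_k^\tau\bm p_k+B_k^\tau\bm q_k-\nabla_{\bm\lambda_{k+1}}\mathcal L^\tau$ for $m_1\le k<m_2$, where $\bm d_1=\bar{\bm x}_0-\bm x_0^\tau$ if $m_1=0$ and $\bm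 d_1=\bm0$ otherwise. Let $\tilde{\bm\omega}$ stack the $\bm p_k,\bm q_k$ and $\tilde{\bm\zeta}=(\bm\zeta_{m_1};\dots;\bm\zeta_{m_2})$ stack the multipliers (Lagrangian = objective $+\bm\zeta_{m_1}^T(\bm p_{m_1}-\bm d_1)+\sum_k\bm\zeta_{k+1}^T(\bm p_{k+1}-A_k^\tau\bm p_k-B_k^\tau\bm q_k+\nabla_{\bm\lambda_{k+1}}\mathcal L^\tau)$). The KKT system is $\Gamma_i^\tau(\tilde{\bm\omega};\tilde{\bm\zeta})=-\nabla\mathcal L^{(i),\tau}_{\rm QP}$, where $\nabla\mathcal L^{(i),\tau}_{\rm QP}$ is the gradient of this Lagrangian at $(\bm0,\bm0)$ and $\Gamma_i^\tau$ its Hessian. A local solve with tolerance $\epsilon_i^\tau>0$ returns any $(\Delta\tilde{\bm\omega}_i,\Delta\tilde{\bm\zeta}_i)$ with $$\big\|\Gamma_i^\tau(\Delta\tilde{\bm\omega}_i;\Delta\tilde{\bm\zeta}_i)+\nabla\mathcal L^{(i),\tau}_{\rm QP}\big\|\le\epsilon_i^\tau\|\nabla\mathcal L^{(i),\tau}_{\rm QP}\|\quad\text{(local residual condition)};$$ local solvers are assumed to achieve this for any $\epsilon_i^\tau>0$ in finitely many iterations (almost surely if randomized). The composed direction $(\Delta\tilde{\bm z},\Delta\tilde{\bm\lambda})$ takes its stage-$k$ primal and dual components from local solution $i$ whenever $k\in\mathcal K_i$ (dual increments being the $\bm\zeta_k$). **Tests.** $\bm r=\Gamma^\tau(\Delta\tilde{\bm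 z};\Delta\tilde{\bm\lambda})+\nabla\mathcal L^\tau$, and $\bm r_i$ its restriction to $\mathcal K_i$. Accuracy condition: $\|\bm r\|\le\epsilon^\tau\|\nabla\mathcal L^\tau\|/(\|\Gamma^\tau\|\Psi^\tau)$ with $\Psi^\tau=\dfrac{20\max(\|\hat H^\tau\|^2,1)}{\min\{\gamma_{\rm RH},1\}\min\{\sigma_{\min}(G^\tau)^2,1\}}$. Descent condition: $(\nabla\mathcal L^\tau_{\bm\eta^\tau})^T(\Delta\tilde{\bm z};\Delta\tilde{\bm\lambda})\le-\eta_2^\tau\|\nabla\mathcal L^\tau\|^2/2$. Cap: $\epsilon^\tau_{\max}=\dfrac{(0.5-\beta)\eta_2^\tau}{(1+\eta_1^\tau+\eta_2^\tau)(\Psi^\tau\Upsilon^\tau)^2}$, $\Upsilon^\tau=\max\{\|G^\tau\|,\|\hat H^\tau\|,1\}$. **AOTD algorithm.** Inputs: $(\bm z^0,\bm\lambda^0)$, $\eta_1^0,\eta_2^0,\epsilon^0,\epsilon_i^0>0$, $b_i^0\in\mathbb Z_{\ge1}$, $\beta\in(0,0.5)$, $\delta\in(0,1)$, $\varrho_b,\varrho_\epsilon>0$, $\nu>1$, $\mu>0$, $\mathrm{tol}_{\rm KKT}\ge0$. For $\tau=0,1,2,\dots$: (i) if $\|\nabla\mathcal L^\tau\|\le\mathrm{tol}_{\rm KKT}$, return. (ii) If $\epsilon^\tau>\epsilon^\tau_{\max}$, set $\epsilon^\tau\gets\epsilon^\tau_{\max}/\nu$. Set the direction to $\bm0$. (iii)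 While the accuracy or the descent condition fails: [accuracy loop] while accuracy fails, perform all local solves with current $b_i^\tau,\epsilon_i^\tau$, compose, and, if accuracy still fails, update for all $i$ $$\epsilon_i^\tau\gets\epsilon_i^\tau\exp\!\Big(-\varrho_\epsilon\Big[\tfrac{\|\bm r_i\|}{\|\bm r\|}+\tfrac1{\sqrt M}\Big]\Big),\qquad b_i^\tau\gets b_i^\tau+\max\Big\{1,\Big\lceil\varrho_b\tfrac{\|\bm r_i\|}{\|\bm r\|}\Big\rceil\Big\};$$ then, if descent fails, set $\eta_1^\tau\gets\nu^2\eta_1^\tau$, $\eta_2^\tau\gets\eta_2^\tau/\nu$, recompute $\epsilon^\tau_{\max}$, and set $\epsilon^\tau\gets\min\{\epsilon^\tau_{\max},\epsilon^\tau/\nu^4\}$. (iv) Accept the direction as $(\Delta\tilde{\bm z}^\tau,\Delta\tilde{\bm\lambda}^\tau)$; backtrack $\alpha^\tau=1,\delta,\delta^2,\dots$ until the Armijo condition $\mathcal L_{\bm\eta^\tau}((\bm z^\tau;\bm\lambda^\tau)+\alpha^\tau(\Delta\tilde{\bm z}^\tau;\Delta\tilde{\bm\lambda}^\tau))\le\mathcal L^\tau_{\bm\eta^\tau}+\alpha^\tau\beta(\nabla\mathcal L^\tau_{\bm\eta^\tau})^T(\Delta\tilde{\bm z}^\tau;\Delta\tilde{\bm\lambda}^\tau)$ holds; set $(\bm z^{\tau+1};\bm\lambda^{\tau+1})=(\bm z^\tau;\bm\lambda^\tau)+\alpha^\tau(\Delta\tilde{\bm z}^\tau;\Delta\tilde{\bm\lambda}^\tau)$;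 carry $\eta_1^\tau,\eta_2^\tau,\epsilon^\tau,\epsilon_i^\tau,b_i^\tau$ to iteration $\tau+1$. Superscript-$\tau$ parameters in the claim are those in force when the step of iteration $\tau$ is accepted. **Assumptions** (constants independent of $\tau$). *Reduced-Hessian lower bound:* there is $\gamma_{\rm RH}>0$ (the constant used in $\Psi^\tau$) with $(Z^\tau)^T\hat H^\tau Z^\tau\succeq\gamma_{\rm RH}\mathbb I$ for all $\tau\ge0$, where the columns of $Z^\tau$ form an orthonormal basis of $\ker G^\tau$. *Uniform controllability:* there are $\gamma_C\in(0,1]$ and $t_C\in\{1,\dots,N\}$ such that for all $\tau\ge0$ and $0\le k\le N-t_C$ there is an integer $t=t_k^\tau\in[1,t_C]$ with $\Xi\Xi^T\succeq\gamma_C\mathbb I$, $\Xi=[B_{k+t-1},\ A_{k+t-1}B_{k+t-2},\ \dots,\ A_{k+t-1}\cdots A_{k+1}B_k]$ evaluated at $\bm z^\tau$. *Uniform boundedness:* there is $\Upsilon_{\rm Upper}\ge2$ with $\|\hat H_k^\tau\|,\|A_k^\tau\|,\|B_k^\tau\|\le\Upsilon_{\rm Upper}$ for $0\le k\le N-1$ and $\|\hat H_N^\tau\|\le\Upsilon_{\rm Upper}$, all $\tau\ge0$. *Compactness/smoothness:* there is a compact set $\mathcal Z\times\Lambda$, $\mathcal Z=\mathcal Z_0\times\dots\times\mathcal Z_N$, $\Lambda=\Lambda_0\times\dots\times\Lambda_N$, containing $(\bm z^\tau+\alpha\Delta\tilde{\bm z}^\tau,\bm\lambda^\tau+\alpha\Delta\tilde{\bm\lambda}^\tau)$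 for all $\tau\ge0$, $\alpha\in[0,1]$; $g_k,g_N,f_k$ are three times continuously differentiable; and for $0\le k\le N-1$, $\sup_{\mathcal Z_k\times\Lambda_{k+1}}\|H_k\|$, $\sup_{\mathcal Z_k}\|A_k\|$, $\sup_{\mathcal Z_k}\|B_k\|$, and $\sup_{\mathcal Z_N}\|H_N\|$ are all $\le\Upsilon_{\rm Upper}$ (same constant). *)

theory Defs
  imports "HOL-Analysis.Analysis"
begin

section \<open>Stacked vectors\<close>

text \<open>
  A stacked vector is a function from stages to a Euclidean space, supported on a window
  \<open>{a..b}\<close> of stages.  Primal vectors have blocks \<open>(x_k, u_k)\<close>; the last stage of a window has
  no control, so its control slot is kept at \<open>0\<close>.  Primal-dual vectors have blocks
  \<open>((x_k, u_k), \<lambda>_k)\<close>, i.e. they are the stagewise permutation of the concatenation of all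
  primal blocks with all dual blocks; Euclidean norms and inner products are unaffected.
  Matrices are linear maps, so that the spectral norm of a single block is \<^const>\<open>onorm\<close> and its
  transpose is \<^const>\<open>adjoint\<close>.
\<close>

type_synonym ('x, 'u) primal = "nat \<Rightarrow> 'x \<times> 'u"
type_synonym ('x, 'u) pd = "nat \<Rightarrow> ('x \<times> 'u) \<times> 'x"

definition primal_space :: "nat \<Rightarrow> nat \<Rightarrow> ('x::zero, 'u::zero) primal set" where
  "primal_space a b = {z. (\<forall>k. k \<notin> {a..b} \<longrightarrow> z k = (0, 0)) \<and> snd (z b) = 0}"

definition dual_space :: "nat \<Rightarrow> nat \<Rightarrow> (nat \<Rightarrow> 'x::zero) set" where
  "dual_space a b = {y. \<forall>k. k \<notin> {a..b} \<longrightarrow> y k = 0}"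

definition pd_space :: "nat \<Rightarrow> nat \<Rightarrow> ('x::zero, 'u::zero) pd set" where
  "pd_space a b = {w. fst \<circ> w \<in> primal_space a b \<and> snd \<circ> w \<in> dual_space a b}"

definition bnorm :: "nat set \<Rightarrow> (nat \<Rightarrow> 'a::real_normed_vector) \<Rightarrow> real" where
  "bnorm K v = L2_set (\<lambda>k. norm (v k)) K"

definition binner :: "nat set \<Rightarrow> (nat \<Rightarrow> 'a::real_inner) \<Rightarrow> (nat \<Rightarrow> 'a) \<Rightarrow> real" where
  "binner K v w = (\<Sum>k\<in>K. v k \<bullet> w k)"

text \<open>Spectral norm of a linear map on stacked vectors over the stages \<open>0, \<dots>, N\<close>; the analogue of
  \<^const>\<open>onorm\<close> with domain \<open>V\<close>.\<close>

definition spec_norm ::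
  "nat \<Rightarrow> (nat \<Rightarrow> 'a::real_normed_vector) set \<Rightarrow> ((nat \<Rightarrow> 'a) \<Rightarrow> (nat \<Rightarrow> 'b::real_normed_vector)) \<Rightarrow> real"
  where "spec_norm N V T = (SUP v\<in>V. bnorm {..N} (T v) / bnorm {..N} v)"


section \<open>Derivatives with respect to stacked vectors\<close>

definition grad :: "('a::real_inner \<Rightarrow> real) \<Rightarrow> 'a \<Rightarrow> 'a" where
  "grad F p = (THE D. GDERIV F p :> D)"

definition bgrad :: "((nat \<Rightarrow> 'a::real_inner) \<Rightarrow> real) \<Rightarrow> (nat \<Rightarrow> 'a) \<Rightarrow> (nat \<Rightarrow> 'a)" where
  "bgrad \<phi> w k = grad (\<lambda>v. \<phi> (w(k := v))) (w k)"

text \<open>Block \<open>(k, j)\<close> of the Jacobian, the Jacobian, and its transpose.\<close>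

definition jblock ::
  "((nat \<Rightarrow> 'a::real_normed_vector) \<Rightarrow> (nat \<Rightarrow> 'b::real_normed_vector)) \<Rightarrow> (nat \<Rightarrow> 'a) \<Rightarrow> nat \<Rightarrow> nat \<Rightarrow> 'a \<Rightarrow> 'b"
  where "jblock F w k j = frechet_derivative (\<lambda>v. F (w(j := v)) k) (at (w j))"

definition jac ::
  "nat \<Rightarrow> ((nat \<Rightarrow> 'a::real_normed_vector) \<Rightarrow> (nat \<Rightarrow> 'b::real_normed_vector)) \<Rightarrow> (nat \<Rightarrow> 'a) \<Rightarrow> (nat \<Rightarrow> 'a) \<Rightarrow> (nat \<Rightarrow> 'b)"
  where "jac N F w v k = (if k \<le> N then \<Sum>j\<le>N. jblock F w k j (v j) else 0)"

definition jacT ::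
  "nat \<Rightarrow> ((nat \<Rightarrow> 'a::euclidean_space) \<Rightarrow> (nat \<Rightarrow> 'b::euclidean_space)) \<Rightarrow> (nat \<Rightarrow> 'a) \<Rightarrow> (nat \<Rightarrow> 'b) \<Rightarrow> (nat \<Rightarrow> 'a)"
  where "jacT N F w y j = (if j \<le> N then \<Sum>k\<le>N. adjoint (jblock F w k j) (y k) else 0)"

text \<open>\<open>C_diff n\<close>: \<open>n\<close> times continuously differentiable on the whole (finite-dimensional) space.\<close>

primrec C_diff :: "nat \<Rightarrow> ('a::euclidean_space \<Rightarrow> 'b::euclidean_space) \<Rightarrow> bool" where
  "C_diff 0 F = continuous_on UNIV F"
| "C_diff (Suc n) F = ((\<forall>p. F differentiable (at p)) \<and> (\<forall>v. C_diff n (\<lambda>p. frechet_derivative F (at p) v)))"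


section \<open>The nonlinear dynamic program\<close>

record ('x, 'u) ndp =
  hor :: nat
  scost :: "nat \<Rightarrow> 'x \<times> 'u \<Rightarrow> real"
  tcost :: "'x \<Rightarrow> real"
  dyn :: "nat \<Rightarrow> 'x \<times> 'u \<Rightarrow> 'x"
  xinit :: 'x

definition cost :: "('x, 'u) ndp \<Rightarrow> ('x, 'u) primal \<Rightarrow> real" where
  "cost P z = (\<Sum>k<hor P. scost P k (z k)) + tcost P (fst (z (hor P)))"

definition constr :: "('x::euclidean_space, 'u) ndp \<Rightarrow> ('x, 'u) primal \<Rightarrow> nat \<Rightarrow> 'x" where
  "constr P z k =
     (if k = 0 then fst (z 0) - xinit P
      else if k \<le> hor P then fst (z k) - dyn P (k - 1) (z (k - 1)) else 0)"

definition lagr :: "('x::euclidean_space, 'u) ndp \<Rightarrow> ('x, 'u) pd \<Rightarrow> real" where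
  "lagr P w = cost P (fst \<circ> w) + binner {..hor P} (snd \<circ> w) (constr P (fst \<circ> w))"

abbreviation gradL :: "('x::euclidean_space, 'u::euclidean_space) ndp \<Rightarrow> ('x, 'u) pd \<Rightarrow> ('x, 'u) pd" where
  "gradL P w \<equiv> bgrad (lagr P) w"

abbreviation normL :: "('x::euclidean_space, 'u::euclidean_space) ndp \<Rightarrow> ('x, 'u) pd \<Rightarrow> real" where
  "normL P w \<equiv> bnorm {..hor P} (gradL P w)"

definition merit :: "('x::euclidean_space, 'u::euclidean_space) ndp \<Rightarrow> real \<Rightarrow> real \<Rightarrow> ('x, 'u) pd \<Rightarrow> real" where
  "merit P \<eta>1 \<eta>2 w = lagr P w
     + \<eta>1 / 2 * (bnorm {..hor P} (snd \<circ> gradL P w))\<^sup>2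
     + \<eta>2 / 2 * (bnorm {..hor P} (fst \<circ> gradL P w))\<^sup>2"

definition jacA :: "('x::euclidean_space, 'u::euclidean_space) ndp \<Rightarrow> nat \<Rightarrow> 'x \<times> 'u \<Rightarrow> 'x \<Rightarrow> 'x" where
  "jacA P k zk = (\<lambda>p. frechet_derivative (dyn P k) (at zk) (p, 0))"

definition jacB :: "('x::euclidean_space, 'u::euclidean_space) ndp \<Rightarrow> nat \<Rightarrow> 'x \<times> 'u \<Rightarrow> 'u \<Rightarrow> 'x" where
  "jacB P k zk = (\<lambda>q. frechet_derivative (dyn P k) (at zk) (0, q))"

definition jacG :: "('x::euclidean_space, 'u::euclidean_space) ndp \<Rightarrow> ('x, 'u) pd
    \<Rightarrow> ('x, 'u) primal \<Rightarrow> nat \<Rightarrow> 'x" where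
  "jacG P w = jac (hor P) (constr P) (fst \<circ> w)"

definition jacGT :: "('x::euclidean_space, 'u::euclidean_space) ndp \<Rightarrow> ('x, 'u) pd
    \<Rightarrow> (nat \<Rightarrow> 'x) \<Rightarrow> ('x, 'u) primal" where
  "jacGT P w = jacT (hor P) (constr P) (fst \<circ> w)"

text \<open>\<open>hessL\<close> is the primal Hessian of the Lagrangian and \<open>hessL_blk P w k\<close> is its diagonal block \<open>H_k\<close>.\<close>

definition gradzL :: "('x::euclidean_space, 'u::euclidean_space) ndp \<Rightarrow> (nat \<Rightarrow> 'x)
    \<Rightarrow> ('x, 'u) primal \<Rightarrow> ('x, 'u) primal" where
  "gradzL P y z = fst \<circ> gradL P (\<lambda>k. (z k, y k))"

definition hessL :: "('x::euclidean_space, 'u::euclidean_space) ndp \<Rightarrow> ('x, 'u) pd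
    \<Rightarrow> ('x, 'u) primal \<Rightarrow> ('x, 'u) primal" where
  "hessL P w = jac (hor P) (gradzL P (snd \<circ> w)) (fst \<circ> w)"

definition hessL_blk :: "('x::euclidean_space, 'u::euclidean_space) ndp \<Rightarrow> ('x, 'u) pd
    \<Rightarrow> nat \<Rightarrow> 'x \<times> 'u \<Rightarrow> 'x \<times> 'u" where
  "hessL_blk P w k = jblock (gradzL P (snd \<circ> w)) (fst \<circ> w) k k"


section \<open>Modified Hessian and KKT matrix\<close>

definition blkdiag :: "nat \<Rightarrow> (nat \<Rightarrow> 'a \<Rightarrow> 'a::zero) \<Rightarrow> (nat \<Rightarrow> 'a) \<Rightarrow> (nat \<Rightarrow> 'a)" where
  "blkdiag N Hh v k = (if k \<le> N then Hh k (v k) else 0)"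

definition kerG :: "('x::euclidean_space, 'u::euclidean_space) ndp \<Rightarrow> ('x, 'u) pd \<Rightarrow> ('x, 'u) primal set" where
  "kerG P w = {v \<in> primal_space 0 (hor P). jacG P w v = (\<lambda>_. 0)}"

definition orthonormal_basis :: "nat \<Rightarrow> (nat \<Rightarrow> 'a::real_inner) set \<Rightarrow> nat \<Rightarrow> (nat \<Rightarrow> nat \<Rightarrow> 'a) \<Rightarrow> bool" where
  "orthonormal_basis N V d Z \<longleftrightarrow>
     (\<forall>i<d. Z i \<in> V) \<and>
     (\<forall>i<d. \<forall>j<d. binner {..N} (Z i) (Z j) = (if i = j then 1 else 0)) \<and>
     (\<forall>v\<in>V. \<exists>c. v = (\<lambda>k. \<Sum>i<d. c i *\<^sub>R Z i k))"

text \<open>\<open>Z\<^sup>T T Z\<close> dominates \<open>\<gamma>\<close> times the identity, the columns \<open>Z 0, \<dots>, Z (d - 1)\<close> of \<open>Z\<close> being an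
  orthonormal basis of the kernel of the constraint Jacobian.\<close>

definition red_hess_bound :: "('x::euclidean_space, 'u::euclidean_space) ndp \<Rightarrow> ('x, 'u) pd
    \<Rightarrow> real \<Rightarrow> (('x, 'u) primal \<Rightarrow> ('x, 'u) primal) \<Rightarrow> bool" where
  "red_hess_bound P w \<gamma> T \<longleftrightarrow>
     (\<exists>d Z. orthonormal_basis (hor P) (kerG P w) d Z \<and>
       (\<forall>c. (\<Sum>i<d. \<Sum>j<d. c i * binner {..hor P} (Z i) (T (Z j)) * c j) \<ge> \<gamma> * (\<Sum>i<d. (c i)\<^sup>2)))"

text \<open>Admissible modified Hessians.  The last block acts on the state only: its control rows vanish,
  hence by symmetry so do its control columns.\<close>

definition hess_modification :: "('x::euclidean_space, 'u::euclidean_space) ndp \<Rightarrow> real \<Rightarrow> ('x, 'u) pd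
    \<Rightarrow> (nat \<Rightarrow> 'x \<times> 'u \<Rightarrow> 'x \<times> 'u) \<Rightarrow> bool" where
  "hess_modification P \<gamma> w Hh \<longleftrightarrow>
     (\<forall>k\<le>hor P. linear (Hh k) \<and> (\<forall>a b. Hh k a \<bullet> b = a \<bullet> Hh k b)) \<and>
     (\<forall>a. snd (Hh (hor P) a) = 0) \<and>
     (red_hess_bound P w \<gamma> (hessL P w) \<longrightarrow>
       (\<forall>v\<in>primal_space 0 (hor P). blkdiag (hor P) Hh v = hessL P w v))"

definition kkt :: "('x::euclidean_space, 'u::euclidean_space) ndp \<Rightarrow> ('x, 'u) pd
    \<Rightarrow> (nat \<Rightarrow> 'x \<times> 'u \<Rightarrow> 'x \<times> 'u) \<Rightarrow> ('x, 'u) pd \<Rightarrow> ('x, 'u) pd" where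
  "kkt P w Hh v k =
     (blkdiag (hor P) Hh (fst \<circ> v) k + jacGT P w (snd \<circ> v) k, jacG P w (fst \<circ> v) k)"

definition normG :: "('x::euclidean_space, 'u::euclidean_space) ndp \<Rightarrow> ('x, 'u) pd \<Rightarrow> real" where
  "normG P w = spec_norm (hor P) (primal_space 0 (hor P)) (jacG P w)"

definition normH :: "('x::euclidean_space, 'u::euclidean_space) ndp
    \<Rightarrow> (nat \<Rightarrow> 'x \<times> 'u \<Rightarrow> 'x \<times> 'u) \<Rightarrow> real" where
  "normH P Hh = spec_norm (hor P) (primal_space 0 (hor P)) (blkdiag (hor P) Hh)"

definition normKKT :: "('x::euclidean_space, 'u::euclidean_space) ndp \<Rightarrow> ('x, 'u) pd
    \<Rightarrow> (nat \<Rightarrow> 'x \<times> 'u \<Rightarrow> 'x \<times> 'u) \<Rightarrow> real" where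
  "normKKT P w Hh = spec_norm (hor P) (pd_space 0 (hor P)) (kkt P w Hh)"

text \<open>\<open>G\<close> has at most as many rows as columns, so its singular values are the square roots of the
  eigenvalues of \<open>G G\<^sup>T\<close>; this set is finite and nonempty, so \<^const>\<open>Inf\<close> is its minimum.\<close>

definition sing_valsG :: "('x::euclidean_space, 'u::euclidean_space) ndp \<Rightarrow> ('x, 'u) pd \<Rightarrow> real set" where
  "sing_valsG P w = {s. s \<ge> 0 \<and> (\<exists>y\<in>dual_space 0 (hor P). y \<noteq> (\<lambda>_. 0) \<and>
      jacG P w (jacGT P w y) = (\<lambda>k. s\<^sup>2 *\<^sub>R y k))}"

definition sigma_minG :: "('x::euclidean_space, 'u::euclidean_space) ndp \<Rightarrow> ('x, 'u) pd \<Rightarrow> real" where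
  "sigma_minG P w = Inf (sing_valsG P w)"


section \<open>Decomposition and local quadratic programs\<close>



record aotd_inputs =
  nsub :: nat
  knot :: "nat \<Rightarrow> nat"
  beta :: real
  delta :: real
  rho_b :: real
  rho_eps :: real
  nu :: real
  mu :: real
  tol_kkt :: real

definition valid_decomposition :: "nat \<Rightarrow> nat \<Rightarrow> (nat \<Rightarrow> nat) \<Rightarrow> bool" where
  "valid_decomposition N M n \<longleftrightarrow>
     1 \<le> M \<and> M \<le> N \<and> n 0 = 0 \<and> n M = N \<and> (\<forall>i<M. n i < n (Suc i))"

definition core :: "nat \<Rightarrow> aotd_inputs \<Rightarrow> nat \<Rightarrow> nat set" where
  "core N c i = (if i = nsub c - 1 then {knot c i..N} else {knot c i..<knot c (Suc i)})"

text \<open>Truncated subtraction on \<^typ>\<open>nat\<close> is the maximum with \<open>0\<close>.\<close>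

definition win_lo :: "aotd_inputs \<Rightarrow> nat \<Rightarrow> nat \<Rightarrow> nat" where
  "win_lo c b i = knot c i - b"

definition win_hi :: "nat \<Rightarrow> aotd_inputs \<Rightarrow> nat \<Rightarrow> nat \<Rightarrow> nat" where
  "win_hi N c b i = min (knot c (Suc i) + b) N"

definition term_hess :: "nat \<Rightarrow> real \<Rightarrow> (nat \<Rightarrow> 'x::real_vector \<times> 'u::zero \<Rightarrow> 'x \<times> 'u) \<Rightarrow> nat \<Rightarrow> 'x \<Rightarrow> 'x" where
  "term_hess N \<mu> Hh m p = fst (Hh m (p, 0)) + (if m < N then \<mu> *\<^sub>R p else 0)"

text \<open>Lagrangian of the quadratic program on the window \<open>{m1..m2}\<close>; \<open>v k = ((p_k, q_k), \<zeta>_k)\<close>.\<close>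

definition qp_lagr :: "('x::euclidean_space, 'u::euclidean_space) ndp \<Rightarrow> real \<Rightarrow> ('x, 'u) pd
    \<Rightarrow> (nat \<Rightarrow> 'x \<times> 'u \<Rightarrow> 'x \<times> 'u) \<Rightarrow> nat \<Rightarrow> nat \<Rightarrow> ('x, 'u) pd \<Rightarrow> real" where
  "qp_lagr P \<mu> w Hh m1 m2 v =
    (let p = (\<lambda>k. fst (fst (v k))); q = (\<lambda>k. snd (fst (v k))); \<zeta> = (\<lambda>k. snd (v k));
         d1 = (if m1 = 0 then xinit P - fst (fst (w 0)) else 0)
     in (\<Sum>k=m1..<m2. 1 / 2 * ((p k, q k) \<bullet> Hh k (p k, q k))
            + fst (fst (gradL P w k)) \<bullet> p k + snd (fst (gradL P w k)) \<bullet> q k)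
        + 1 / 2 * (p m2 \<bullet> term_hess (hor P) \<mu> Hh m2 (p m2)) + fst (fst (gradL P w m2)) \<bullet> p m2
        + \<zeta> m1 \<bullet> (p m1 - d1)
        + (\<Sum>k=m1..<m2. \<zeta> (Suc k) \<bullet>
             (p (Suc k) - jacA P k (fst (w k)) (p k) - jacB P k (fst (w k)) (q k) + snd (gradL P w (Suc k)))))"

text \<open>Gradient at the origin and (constant) Hessian of that Lagrangian.\<close>

definition qp_grad :: "('x::euclidean_space, 'u::euclidean_space) ndp \<Rightarrow> real \<Rightarrow> ('x, 'u) pd
    \<Rightarrow> (nat \<Rightarrow> 'x \<times> 'u \<Rightarrow> 'x \<times> 'u) \<Rightarrow> nat \<Rightarrow> nat \<Rightarrow> ('x, 'u) pd" where
  "qp_grad P \<mu> w Hh m1 m2 = bgrad (qp_lagr P \<mu> w Hh m1 m2) (\<lambda>_. 0)"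

definition qp_kkt :: "('x::euclidean_space, 'u::euclidean_space) ndp \<Rightarrow> real \<Rightarrow> ('x, 'u) pd
    \<Rightarrow> (nat \<Rightarrow> 'x \<times> 'u \<Rightarrow> 'x \<times> 'u) \<Rightarrow> nat \<Rightarrow> nat \<Rightarrow> ('x, 'u) pd \<Rightarrow> ('x, 'u) pd" where
  "qp_kkt P \<mu> w Hh m1 m2 = jac (hor P) (bgrad (qp_lagr P \<mu> w Hh m1 m2)) (\<lambda>_. 0)"

definition local_solution :: "('x::euclidean_space, 'u::euclidean_space) ndp \<Rightarrow> real \<Rightarrow> ('x, 'u) pd
    \<Rightarrow> (nat \<Rightarrow> 'x \<times> 'u \<Rightarrow> 'x \<times> 'u) \<Rightarrow> nat \<Rightarrow> nat \<Rightarrow> real \<Rightarrow> ('x, 'u) pd \<Rightarrow> bool" where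
  "local_solution P \<mu> w Hh m1 m2 \<epsilon> v \<longleftrightarrow>
     v \<in> pd_space m1 m2 \<and>
     bnorm {m1..m2} (\<lambda>k. qp_kkt P \<mu> w Hh m1 m2 v k + qp_grad P \<mu> w Hh m1 m2 k)
       \<le> \<epsilon> * bnorm {m1..m2} (qp_grad P \<mu> w Hh m1 m2)"

text \<open>\<open>d\<close> is a composition of local solutions obtained with tolerances \<open>\<epsilon> i\<close> and overlaps \<open>b i\<close>.\<close>

definition composed_direction :: "('x::euclidean_space, 'u::euclidean_space) ndp \<Rightarrow> aotd_inputs \<Rightarrow> ('x, 'u) pd
    \<Rightarrow> (nat \<Rightarrow> 'x \<times> 'u \<Rightarrow> 'x \<times> 'u) \<Rightarrow> (nat \<Rightarrow> real) \<Rightarrow> (nat \<Rightarrow> nat) \<Rightarrow> ('x, 'u) pd \<Rightarrow> bool" where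
  "composed_direction P c w Hh \<epsilon> b d \<longleftrightarrow>
     d \<in> pd_space 0 (hor P) \<and>
     (\<exists>v. \<forall>i<nsub c.
        local_solution P (mu c) w Hh (win_lo c (b i) i) (win_hi (hor P) c (b i) i) (\<epsilon> i) (v i) \<and>
        (\<forall>k\<in>core (hor P) c i. d k = v i k))"


section \<open>The algorithm\<close>

text \<open>Adaptive parameters: penalties \<open>\<eta>\<^sub>1, \<eta>\<^sub>2\<close>, global tolerance \<open>\<epsilon>\<close>, local tolerances \<open>\<epsilon>_i\<close> and
  overlaps \<open>b_i\<close>.\<close>

record aotd_params =
  eta1 :: real
  eta2 :: real
  eps :: real
  leps :: "nat \<Rightarrow> real"
  ovl :: "nat \<Rightarrow> nat"

definition resid :: "('x::euclidean_space, 'u::euclidean_space) ndp \<Rightarrow> ('x, 'u) pd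
    \<Rightarrow> (nat \<Rightarrow> 'x \<times> 'u \<Rightarrow> 'x \<times> 'u) \<Rightarrow> ('x, 'u) pd \<Rightarrow> ('x, 'u) pd" where
  "resid P w Hh d k = kkt P w Hh d k + gradL P w k"

definition Psi :: "('x::euclidean_space, 'u::euclidean_space) ndp \<Rightarrow> real \<Rightarrow> ('x, 'u) pd
    \<Rightarrow> (nat \<Rightarrow> 'x \<times> 'u \<Rightarrow> 'x \<times> 'u) \<Rightarrow> real" where
  "Psi P \<gamma> w Hh = 20 * max ((normH P Hh)\<^sup>2) 1 / (min \<gamma> 1 * min ((sigma_minG P w)\<^sup>2) 1)"

definition Upsilon :: "('x::euclidean_space, 'u::euclidean_space) ndp \<Rightarrow> ('x, 'u) pd
    \<Rightarrow> (nat \<Rightarrow> 'x \<times> 'u \<Rightarrow> 'x \<times> 'u) \<Rightarrow> real" where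
  "Upsilon P w Hh = max (normG P w) (max (normH P Hh) 1)"

definition eps_max :: "('x::euclidean_space, 'u::euclidean_space) ndp \<Rightarrow> aotd_inputs \<Rightarrow> real \<Rightarrow> ('x, 'u) pd
    \<Rightarrow> (nat \<Rightarrow> 'x \<times> 'u \<Rightarrow> 'x \<times> 'u) \<Rightarrow> real \<Rightarrow> real \<Rightarrow> real" where
  "eps_max P c \<gamma> w Hh \<eta>1 \<eta>2 =
     (1 / 2 - beta c) * \<eta>2 / ((1 + \<eta>1 + \<eta>2) * (Psi P \<gamma> w Hh * Upsilon P w Hh)\<^sup>2)"

definition accurate :: "('x::euclidean_space, 'u::euclidean_space) ndp \<Rightarrow> real \<Rightarrow> ('x, 'u) pd
    \<Rightarrow> (nat \<Rightarrow> 'x \<times> 'u \<Rightarrow> 'x \<times> 'u) \<Rightarrow> real \<Rightarrow> ('x, 'u) pd \<Rightarrow> bool" where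
  "accurate P \<gamma> w Hh \<epsilon> d \<longleftrightarrow>
     bnorm {..hor P} (resid P w Hh d) \<le> \<epsilon> * normL P w / (normKKT P w Hh * Psi P \<gamma> w Hh)"

definition merit_slope :: "('x::euclidean_space, 'u::euclidean_space) ndp \<Rightarrow> real \<Rightarrow> real
    \<Rightarrow> ('x, 'u) pd \<Rightarrow> ('x, 'u) pd \<Rightarrow> real" where
  "merit_slope P \<eta>1 \<eta>2 w d = binner {..hor P} (bgrad (merit P \<eta>1 \<eta>2) w) d"

definition descent :: "('x::euclidean_space, 'u::euclidean_space) ndp \<Rightarrow> real \<Rightarrow> real
    \<Rightarrow> ('x, 'u) pd \<Rightarrow> ('x, 'u) pd \<Rightarrow> bool" where
  "descent P \<eta>1 \<eta>2 w d \<longleftrightarrow> merit_slope P \<eta>1 \<eta>2 w d \<le> - \<eta>2 * (normL P w)\<^sup>2 / 2"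

definition resid_ratio :: "('x::euclidean_space, 'u::euclidean_space) ndp \<Rightarrow> aotd_inputs \<Rightarrow> ('x, 'u) pd
    \<Rightarrow> (nat \<Rightarrow> 'x \<times> 'u \<Rightarrow> 'x \<times> 'u) \<Rightarrow> ('x, 'u) pd \<Rightarrow> nat \<Rightarrow> real" where
  "resid_ratio P c w Hh d i =
     bnorm (core (hor P) c i) (resid P w Hh d) / bnorm {..hor P} (resid P w Hh d)"

definition shrink_leps :: "('x::euclidean_space, 'u::euclidean_space) ndp \<Rightarrow> aotd_inputs \<Rightarrow> ('x, 'u) pd
    \<Rightarrow> (nat \<Rightarrow> 'x \<times> 'u \<Rightarrow> 'x \<times> 'u) \<Rightarrow> ('x, 'u) pd \<Rightarrow> (nat \<Rightarrow> real) \<Rightarrow> nat \<Rightarrow> real" where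
  "shrink_leps P c w Hh d \<epsilon> i =
     \<epsilon> i * exp (- rho_eps c * (resid_ratio P c w Hh d i + 1 / sqrt (real (nsub c))))"

definition enlarge_ovl :: "('x::euclidean_space, 'u::euclidean_space) ndp \<Rightarrow> aotd_inputs \<Rightarrow> ('x, 'u) pd
    \<Rightarrow> (nat \<Rightarrow> 'x \<times> 'u \<Rightarrow> 'x \<times> 'u) \<Rightarrow> ('x, 'u) pd \<Rightarrow> (nat \<Rightarrow> nat) \<Rightarrow> nat \<Rightarrow> nat" where
  "enlarge_ovl P c w Hh d b i = b i + max 1 (nat \<lceil>rho_b c * resid_ratio P c w Hh d i\<rceil>)"

text \<open>\<open>acc_loop P c \<gamma> w Hh d p d' p'\<close>: started with direction \<open>d\<close> and parameters \<open>p\<close>, the accuracy loop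
  can terminate with \<open>d'\<close> and \<open>p'\<close>.  Local solves are nondeterministic.\<close>

inductive acc_loop :: "('x::euclidean_space, 'u::euclidean_space) ndp \<Rightarrow> aotd_inputs \<Rightarrow> real \<Rightarrow> ('x, 'u) pd
    \<Rightarrow> (nat \<Rightarrow> 'x \<times> 'u \<Rightarrow> 'x \<times> 'u) \<Rightarrow> ('x, 'u) pd \<Rightarrow> aotd_params \<Rightarrow> ('x, 'u) pd \<Rightarrow> aotd_params \<Rightarrow> bool"
  for P c \<gamma> w Hh where
  acc_exit: "accurate P \<gamma> w Hh (eps p) d \<Longrightarrow> acc_loop P c \<gamma> w Hh d p d p"
| acc_iter: "\<lbrakk> \<not> accurate P \<gamma> w Hh (eps p) d;
      composed_direction P c w Hh (leps p) (ovl p) d1;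
      p1 = (if accurate P \<gamma> w Hh (eps p) d1 then p
            else p\<lparr>leps := shrink_leps P c w Hh d1 (leps p), ovl := enlarge_ovl P c w Hh d1 (ovl p)\<rparr>);
      acc_loop P c \<gamma> w Hh d1 p1 d' p' \<rbrakk>
    \<Longrightarrow> acc_loop P c \<gamma> w Hh d p d' p'"

definition penalty_update :: "('x::euclidean_space, 'u::euclidean_space) ndp \<Rightarrow> aotd_inputs \<Rightarrow> real \<Rightarrow> ('x, 'u) pd
    \<Rightarrow> (nat \<Rightarrow> 'x \<times> 'u \<Rightarrow> 'x \<times> 'u) \<Rightarrow> aotd_params \<Rightarrow> aotd_params" where
  "penalty_update P c \<gamma> w Hh p =
     (let \<eta>1 = (nu c)\<^sup>2 * eta1 p; \<eta>2 = eta2 p / nu c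
      in p\<lparr>eta1 := \<eta>1, eta2 := \<eta>2, eps := min (eps_max P c \<gamma> w Hh \<eta>1 \<eta>2) (eps p / nu c ^ 4)\<rparr>)"

inductive dir_loop :: "('x::euclidean_space, 'u::euclidean_space) ndp \<Rightarrow> aotd_inputs \<Rightarrow> real \<Rightarrow> ('x, 'u) pd
    \<Rightarrow> (nat \<Rightarrow> 'x \<times> 'u \<Rightarrow> 'x \<times> 'u) \<Rightarrow> ('x, 'u) pd \<Rightarrow> aotd_params \<Rightarrow> ('x, 'u) pd \<Rightarrow> aotd_params \<Rightarrow> bool"
  for P c \<gamma> w Hh where
  dir_exit: "\<lbrakk> accurate P \<gamma> w Hh (eps p) d; descent P (eta1 p) (eta2 p) w d \<rbrakk>
    \<Longrightarrow> dir_loop P c \<gamma> w Hh d p d p"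
| dir_iter: "\<lbrakk> \<not> (accurate P \<gamma> w Hh (eps p) d \<and> descent P (eta1 p) (eta2 p) w d);
      acc_loop P c \<gamma> w Hh d p d1 p1;
      p2 = (if descent P (eta1 p1) (eta2 p1) w d1 then p1 else penalty_update P c \<gamma> w Hh p1);
      dir_loop P c \<gamma> w Hh d1 p2 d' p' \<rbrakk>
    \<Longrightarrow> dir_loop P c \<gamma> w Hh d p d' p'"

definition eps_safeguard :: "('x::euclidean_space, 'u::euclidean_space) ndp \<Rightarrow> aotd_inputs \<Rightarrow> real \<Rightarrow> ('x, 'u) pd
    \<Rightarrow> (nat \<Rightarrow> 'x \<times> 'u \<Rightarrow> 'x \<times> 'u) \<Rightarrow> aotd_params \<Rightarrow> aotd_params" where
  "eps_safeguard P c \<gamma> w Hh p =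
     (if eps p > eps_max P c \<gamma> w Hh (eta1 p) (eta2 p)
      then p\<lparr>eps := eps_max P c \<gamma> w Hh (eta1 p) (eta2 p) / nu c\<rparr> else p)"

definition move :: "('x::real_vector, 'u::real_vector) pd \<Rightarrow> real \<Rightarrow> ('x, 'u) pd \<Rightarrow> ('x, 'u) pd" where
  "move w \<alpha> d = (\<lambda>k. w k + \<alpha> *\<^sub>R d k)"

definition armijo :: "('x::euclidean_space, 'u::euclidean_space) ndp \<Rightarrow> aotd_inputs \<Rightarrow> aotd_params
    \<Rightarrow> ('x, 'u) pd \<Rightarrow> ('x, 'u) pd \<Rightarrow> real \<Rightarrow> bool" where
  "armijo P c p w d \<alpha> \<longleftrightarrow>
     merit P (eta1 p) (eta2 p) (move w \<alpha> d)
       \<le> merit P (eta1 p) (eta2 p) w + \<alpha> * beta c * merit_slope P (eta1 p) (eta2 p) w d"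

text \<open>One iteration that does not return: from iterate \<open>w\<close> and carried parameters \<open>p\<close>, accept
  direction \<open>d\<close> with parameters \<open>p'\<close> and move to \<open>w'\<close> by backtracking.\<close>

definition aotd_step :: "('x::euclidean_space, 'u::euclidean_space) ndp \<Rightarrow> aotd_inputs \<Rightarrow> real
    \<Rightarrow> (nat \<Rightarrow> 'x \<times> 'u \<Rightarrow> 'x \<times> 'u) \<Rightarrow> ('x, 'u) pd \<Rightarrow> aotd_params \<Rightarrow> ('x, 'u) pd \<Rightarrow> aotd_params \<Rightarrow> ('x, 'u) pd \<Rightarrow> bool" where
  "aotd_step P c \<gamma> Hh w p d p' w' \<longleftrightarrow>
     \<not> normL P w \<le> tol_kkt c \<and>
     dir_loop P c \<gamma> w Hh (\<lambda>_. 0) (eps_safeguard P c \<gamma> w Hh p) d p' \<and>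
     (\<exists>j. armijo P c p' w d (delta c ^ j) \<and> (\<forall>l<j. \<not> armijo P c p' w d (delta c ^ l)) \<and>
          w' = move w (delta c ^ j) d)"

text \<open>An infinite run: \<open>w \<tau>\<close> are the iterates, \<open>Hh \<tau>\<close> the modified Hessians, \<open>d \<tau>\<close> the accepted
  directions, \<open>p \<tau>\<close> the parameters in force at acceptance, and \<open>p0\<close> the initial parameters.\<close>

definition aotd_run :: "('x::euclidean_space, 'u::euclidean_space) ndp \<Rightarrow> aotd_inputs \<Rightarrow> real \<Rightarrow> aotd_params
    \<Rightarrow> (nat \<Rightarrow> nat \<Rightarrow> 'x \<times> 'u \<Rightarrow> 'x \<times> 'u) \<Rightarrow> (nat \<Rightarrow> ('x, 'u) pd) \<Rightarrow> (nat \<Rightarrow> ('x, 'u) pd) \<Rightarrow> (nat \<Rightarrow> aotd_params) \<Rightarrow> bool" where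
  "aotd_run P c \<gamma> p0 Hh w d p \<longleftrightarrow>
     w 0 \<in> pd_space 0 (hor P) \<and>
     (\<forall>\<tau>. hess_modification P \<gamma> (w \<tau>) (Hh \<tau>) \<and>
          aotd_step P c \<gamma> (Hh \<tau>) (w \<tau>) (case \<tau> of 0 \<Rightarrow> p0 | Suc \<sigma> \<Rightarrow> p \<sigma>) (d \<tau>) (p \<tau>) (w (Suc \<tau>)))"

definition valid_inputs :: "nat \<Rightarrow> aotd_inputs \<Rightarrow> aotd_params \<Rightarrow> bool" where
  "valid_inputs N c p0 \<longleftrightarrow>
     valid_decomposition N (nsub c) (knot c) \<and>
     0 < beta c \<and> beta c < 1 / 2 \<and> 0 < delta c \<and> delta c < 1 \<and> 0 < rho_b c \<and> 0 < rho_eps c \<and>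
     1 < nu c \<and> 0 < mu c \<and> 0 \<le> tol_kkt c \<and>
     0 < eta1 p0 \<and> 0 < eta2 p0 \<and> 0 < eps p0 \<and> (\<forall>i<nsub c. 0 < leps p0 i \<and> 1 \<le> ovl p0 i)"


section \<open>Assumptions\<close>

text \<open>\<open>transit A a n\<close> is the product of \<open>A (a + n - 1), \<dots>, A a\<close>.\<close>

primrec transit :: "(nat \<Rightarrow> 'x \<Rightarrow> 'x) \<Rightarrow> nat \<Rightarrow> nat \<Rightarrow> 'x \<Rightarrow> 'x" where
  "transit A a 0 = id"
| "transit A a (Suc n) = A (a + n) \<circ> transit A a n"

text \<open>Column block of the controllability matrix belonging to the control at stage \<open>k + j\<close>, for
  \<open>j < t\<close>.\<close>

definition ctrl_blk :: "('x::euclidean_space, 'u::euclidean_space) ndp \<Rightarrow> ('x, 'u) pd \<Rightarrow> nat \<Rightarrow> nat \<Rightarrow> nat \<Rightarrow> 'u \<Rightarrow> 'x" where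
  "ctrl_blk P w k t j =
     transit (\<lambda>l. jacA P l (fst (w l))) (k + j + 1) (t - 1 - j) \<circ> jacB P (k + j) (fst (w (k + j)))"

definition ctrl_gram :: "('x::euclidean_space, 'u::euclidean_space) ndp \<Rightarrow> ('x, 'u) pd \<Rightarrow> nat \<Rightarrow> nat \<Rightarrow> 'x \<Rightarrow> 'x" where
  "ctrl_gram P w k t y = (\<Sum>j<t. ctrl_blk P w k t j (adjoint (ctrl_blk P w k t j) y))"

definition uniform_controllability ::
  "('x::euclidean_space, 'u::euclidean_space) ndp \<Rightarrow> (nat \<Rightarrow> ('x, 'u) pd) \<Rightarrow> real \<Rightarrow> nat \<Rightarrow> bool" where
  "uniform_controllability P w \<gamma>C tC \<longleftrightarrow>
     0 < \<gamma>C \<and> \<gamma>C \<le> 1 \<and> 1 \<le> tC \<and> tC \<le> hor P \<and>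
     (\<forall>\<tau>. \<forall>k\<le>hor P - tC. \<exists>t\<in>{1..tC}. \<forall>y. y \<bullet> ctrl_gram P (w \<tau>) k t y \<ge> \<gamma>C * (y \<bullet> y))"

definition uniform_boundedness :: "('x::euclidean_space, 'u::euclidean_space) ndp
    \<Rightarrow> (nat \<Rightarrow> nat \<Rightarrow> 'x \<times> 'u \<Rightarrow> 'x \<times> 'u) \<Rightarrow> (nat \<Rightarrow> ('x, 'u) pd) \<Rightarrow> real \<Rightarrow> bool" where
  "uniform_boundedness P Hh w U \<longleftrightarrow>
     2 \<le> U \<and>
     (\<forall>\<tau>. (\<forall>k<hor P. onorm (Hh \<tau> k) \<le> U \<and> onorm (jacA P k (fst (w \<tau> k))) \<le> U \<and>
                        onorm (jacB P k (fst (w \<tau> k))) \<le> U) \<and>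
          onorm (Hh \<tau> (hor P)) \<le> U)"

text \<open>\<open>H_k\<close> depends on \<open>w\<close> only through \<open>(z_k, \<lambda>_(k+1))\<close>, and \<open>H_N\<close> only through \<open>x_N\<close>; so the suprema
  range over all \<open>w\<close> whose relevant components lie in the given sets.\<close>

definition compact_smooth :: "('x::euclidean_space, 'u::euclidean_space) ndp
    \<Rightarrow> (nat \<Rightarrow> ('x, 'u) pd) \<Rightarrow> (nat \<Rightarrow> ('x, 'u) pd) \<Rightarrow> real
    \<Rightarrow> (nat \<Rightarrow> ('x \<times> 'u) set) \<Rightarrow> 'x set \<Rightarrow> (nat \<Rightarrow> 'x set) \<Rightarrow> bool" where
  "compact_smooth P w d U \<Z> \<Z>N \<Lambda> \<longleftrightarrow>
     (\<forall>k<hor P. compact (\<Z> k)) \<and> compact \<Z>N \<and> (\<forall>k\<le>hor P. compact (\<Lambda> k)) \<and>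
     (\<forall>\<tau>. \<forall>\<alpha>\<in>{0..1}.
        (\<forall>k<hor P. fst (move (w \<tau>) \<alpha> (d \<tau>) k) \<in> \<Z> k) \<and>
        fst (fst (move (w \<tau>) \<alpha> (d \<tau>) (hor P))) \<in> \<Z>N \<and>
        (\<forall>k\<le>hor P. snd (move (w \<tau>) \<alpha> (d \<tau>) k) \<in> \<Lambda> k)) \<and>
     (\<forall>k<hor P. C_diff 3 (scost P k) \<and> C_diff 3 (dyn P k)) \<and> C_diff 3 (tcost P) \<and>
     (\<forall>k<hor P. \<forall>v. fst (v k) \<in> \<Z> k \<and> snd (v (Suc k)) \<in> \<Lambda> (Suc k) \<longrightarrow> onorm (hessL_blk P v k) \<le> U) \<and>
     (\<forall>k<hor P. \<forall>zk\<in>\<Z> k. onorm (jacA P k zk) \<le> U \<and> onorm (jacB P k zk) \<le> U) \<and>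
     (\<forall>v. fst (fst (v (hor P))) \<in> \<Z>N \<longrightarrow> onorm (hessL_blk P v (hor P)) \<le> U)"

end

theory Submission
  imports Defs
begin

text \<open>
  Let \<open>G\<close> be the constraint Jacobian.  Solving the linearized dynamics forward with zero controls
  gives a right inverse of \<open>G\<close> whose norm is bounded in terms of the horizon and \<open>U\<close> alone.  Together
  with the reduced-Hessian bound this bounds the inverse of the KKT matrix, the smallest singular
  value of \<open>G\<close>, and every other matrix quantity of the algorithm, uniformly along the run.

  Penalty updates keep \<open>eta1 * eta2\<^sup>2\<close> fixed and do not increase \<open>eps / eta2 ^ 4\<close>.  Hence once \<open>eta2\<close> is
  below a uniform threshold, \<open>eta1 * eta2\<close> is large and the relative residual of an accurate direction
  is small compared with \<open>eta2 / (1 + eta1 + eta2)\<close>, and such a direction satisfies the descent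
  condition; so the penalties change finitely often.  With frozen penalties the cap on \<open>eps\<close> is bounded
  below, so \<open>eps\<close> freezes too.  Every local update enlarges all overlaps and shrinks all local
  tolerances; once all windows are the whole horizon, all local solutions approximate the one solution
  of the full KKT system, so the composed direction is accurate and local updates stop.
\<close>

section \<open>Stacked vectors\<close>

text \<open>Let \<open>a\<close>, \<open>b\<close> be the primal and dual parts of an accurate
  direction. Testing the Newton equations turns the merit slope into minus \<open>a . Hh a\<close>,
  plus twice \<open>b\<close> against the constraint violation, minus \<open>eta1\<close> and
  \<open>eta2\<close> times squared gradient norms, plus residual terms. Two terms have the wrong
  sign. The merit function is differentiated with the true Hessian, while the direction solves a
  system with the modified one; the discrepancy carries a factor \<open>eta2\<close> and is absorbed
  by the curvature only when \<open>eta2\<close> is small. Young's inequality on the multiplier term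
  leaves a constant over \<open>eta2\<close> times the squared violation, which \<open>eta1\<close>
  must dominate; hence the demand on \<open>eta1 * eta2\<close>. Curvature is available only on the
  kernel of \<open>G\<close>, so \<open>a\<close> is split by the right inverse and its second part
  is charged to \<open>eta1\<close> too.

  All freezing arguments have one shape: a positive quantity changes only while it exceeds a fixed
  threshold, and then drops by a fixed factor. For tolerances and overlaps jointly it is the sum of
  \<open>leps p i + r ^ ovl p i\<close>. The loops are inductive relations, so only their
  terminating executions are considered.\<close>

lemma bnorm_nonneg [simp]: "0 \<le> bnorm K v"
  by (simp add: bnorm_def L2_set_nonneg)

lemma bnorm_sq: "(bnorm K v)\<^sup>2 = binner K v v"
  by (simp add: bnorm_def binner_def L2_set_def sum_nonneg power2_norm_eq_inner)

lemma bnorm_sq_sum: "(bnorm K v)\<^sup>2 = (\<Sum>k\<in>K. (norm (v k))\<^sup>2)"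
  by (simp add: bnorm_def L2_set_def sum_nonneg)

lemma bnorm_cong: "(\<And>k. k \<in> K \<Longrightarrow> v k = w k) \<Longrightarrow> bnorm K v = bnorm K w"
  by (simp add: bnorm_def L2_set_def)

lemma bnorm_triangle: "bnorm K (\<lambda>k. v k + w k) \<le> bnorm K v + bnorm K w"
proof -
  have "bnorm K (\<lambda>k. v k + w k) \<le> L2_set (\<lambda>k. norm (v k) + norm (w k)) K"
    unfolding bnorm_def by (rule L2_set_mono) (auto simp: norm_triangle_ineq)
  also have "\<dots> \<le> bnorm K v + bnorm K w"
    unfolding bnorm_def by (rule L2_set_triangle_ineq)
  finally show ?thesis .
qed

lemma bnorm_minus: "bnorm K (\<lambda>k. - v k) = bnorm K v"
  by (simp add: bnorm_def)

lemma bnorm_triangle_diff: "bnorm K (\<lambda>k. v k - w k) \<le> bnorm K v + bnorm K w"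
  using bnorm_triangle[of K v "\<lambda>k. - w k"] by (simp add: bnorm_minus)

lemma norm_le_bnorm: "finite K \<Longrightarrow> k \<in> K \<Longrightarrow> norm (v k) \<le> bnorm K v"
  unfolding bnorm_def by (rule member_le_L2_set) auto

text \<open>The Euclidean norm is at most the sum of the block norms. The crude factor
  \<open>card K\<close>, instead of its root, is the origin of every factor
  \<open>1 + real N\<close> in the later constants.\<close>

lemma bnorm_le_card:
  fixes B :: real
  assumes "\<And>k. k \<in> K \<Longrightarrow> norm (v k) \<le> B"
  shows "bnorm K v \<le> card K * B"
proof -
  have "bnorm K v \<le> (\<Sum>k\<in>K. norm (v k))"
    unfolding bnorm_def by (rule L2_set_le_sum) auto
  also have "\<dots> \<le> card K * B"
    using sum_mono[of K "\<lambda>k. norm (v k)" "\<lambda>_. B"] assms by simp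
  finally show ?thesis .
qed

lemma binner_le_bnorm: "\<bar>binner K v w\<bar> \<le> bnorm K v * bnorm K w"
proof -
  have "\<bar>binner K v w\<bar> \<le> (\<Sum>k\<in>K. \<bar>norm (v k)\<bar> * \<bar>norm (w k)\<bar>)"
    unfolding binner_def by (rule order_trans[OF sum_abs sum_mono]) (simp add: Cauchy_Schwarz_ineq2)
  also have "\<dots> \<le> bnorm K v * bnorm K w"
    unfolding bnorm_def by (rule L2_set_mult_ineq)
  finally show ?thesis .
qed

lemma binner_commute: "binner K v w = binner K w v"
  by (simp add: binner_def inner_commute)

lemma binner_cong: "(\<And>k. k \<in> K \<Longrightarrow> v k = v' k) \<Longrightarrow> (\<And>k. k \<in> K \<Longrightarrow> w k = w' k) \<Longrightarrow> binner K v w = binner K v' w'"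
  by (simp add: binner_def)

lemma binner_add_left: "binner K (\<lambda>k. u k + v k) w = binner K u w + binner K v w"
  and binner_add_right: "binner K w (\<lambda>k. u k + v k) = binner K w u + binner K w v"
  and binner_diff_left: "binner K (\<lambda>k. u k - v k) w = binner K u w - binner K v w"
  and binner_diff_right: "binner K w (\<lambda>k. u k - v k) = binner K w u - binner K w v"
  and binner_minus_left: "binner K (\<lambda>k. - u k) w = - binner K u w"
  and binner_minus_right: "binner K w (\<lambda>k. - u k) = - binner K w u"
  and binner_scaleR_left: "binner K (\<lambda>k. c *\<^sub>R u k) w = c * binner K u w"
  and binner_scaleR_right: "binner K w (\<lambda>k. c *\<^sub>R u k) = c * binner K w u"
  by (simp_all add: binner_def inner_simps sum.distrib sum_subtractf sum_negf sum_distrib_left)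

lemmas binner_simps = binner_add_left binner_add_right binner_diff_left binner_diff_right
  binner_minus_left binner_minus_right binner_scaleR_left binner_scaleR_right

lemma binner_Pair: "binner K v w = binner K (fst \<circ> v) (fst \<circ> w) + binner K (snd \<circ> v) (snd \<circ> w)"
  by (simp add: binner_def inner_prod_def sum.distrib)

lemma bnorm_Pair_sq: "(bnorm K v)\<^sup>2 = (bnorm K (fst \<circ> v))\<^sup>2 + (bnorm K (snd \<circ> v))\<^sup>2"
  by (simp add: bnorm_sq_sum norm_prod_def real_sqrt_pow2 sum.distrib)

lemma bnorm_fst_le: "bnorm K (fst \<circ> v) \<le> bnorm K v"
  and bnorm_snd_le: "bnorm K (snd \<circ> v) \<le> bnorm K v"
  by (rule power2_le_imp_le; simp add: bnorm_Pair_sq)+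

lemma bnorm_Pair_le: "bnorm K v \<le> bnorm K (fst \<circ> v) + bnorm K (snd \<circ> v)"
  by (rule power2_le_imp_le) (simp_all add: bnorm_Pair_sq power2_sum)

lemma bnorm_eq_0_iff: "finite K \<Longrightarrow> bnorm K v = 0 \<longleftrightarrow> (\<forall>k\<in>K. v k = 0)"
  by (simp add: bnorm_def L2_set_eq_0_iff)

text \<open>Vectors with a single block are the probes by which gradients and transposes are
  identified block by block.\<close>

lemma binner_single: "binner {..N::nat} E ((\<lambda>_. 0)(j := h)) = (if j \<le> N then E j \<bullet> h else 0)"
proof -
  have "binner {..N} E ((\<lambda>_. 0)(j := h)) = (\<Sum>k\<le>N. if k = j then E j \<bullet> h else 0)"
    unfolding binner_def by (rule sum.cong) auto
  then show ?thesis by simp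
qed

section \<open>Blockwise derivatives\<close>

text \<open>Block derivatives are evaluations of one linear map at stacked vectors with a single block.\<close>

definition has_sderiv ::
  "((nat \<Rightarrow> 'a::real_normed_vector) \<Rightarrow> 'b::real_normed_vector) \<Rightarrow> ((nat \<Rightarrow> 'a) \<Rightarrow> 'b) \<Rightarrow> (nat \<Rightarrow> 'a) \<Rightarrow> bool"
  where "has_sderiv F F' w \<longleftrightarrow>
    (\<forall>j. ((\<lambda>v. F (w(j := v))) has_derivative (\<lambda>h. F' ((\<lambda>_. 0)(j := h)))) (at (w j)))"

lemma sderiv_const [intro]: "has_sderiv (\<lambda>w. a) (\<lambda>d. 0) w"
  by (simp add: has_sderiv_def)

lemma sderiv_coord [intro]: "has_sderiv (\<lambda>w. w k) (\<lambda>d. d k) w"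
proof -
  have "((\<lambda>v. (w(j := v)) k) has_derivative (\<lambda>h. ((\<lambda>_. 0)(j := h)) k)) (at (w j))" for j
    by (cases "k = j") simp_all
  then show ?thesis by (simp add: has_sderiv_def)
qed

lemma sderiv_compose:
  assumes "has_sderiv F F' w" "(f has_derivative f') (at (F w))"
  shows "has_sderiv (\<lambda>w. f (F w)) (\<lambda>d. f' (F' d)) w"
  unfolding has_sderiv_def
proof
  fix j
  show "((\<lambda>v. f (F (w(j := v)))) has_derivative (\<lambda>h. f' (F' ((\<lambda>_. 0)(j := h))))) (at (w j))"
    using has_derivative_compose[of "\<lambda>v. F (w(j := v))" "\<lambda>h. F' ((\<lambda>_. 0)(j := h))" "w j" UNIV f f'] assms
    by (simp add: has_sderiv_def)
qed

lemma sderiv_bounded_linear: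
  "bounded_linear L \<Longrightarrow> has_sderiv F F' w \<Longrightarrow> has_sderiv (\<lambda>w. L (F w)) (\<lambda>d. L (F' d)) w"
  by (rule sderiv_compose) (auto intro: bounded_linear_imp_has_derivative)

lemma sderiv_fst: "has_sderiv F F' w \<Longrightarrow> has_sderiv (\<lambda>w. fst (F w)) (\<lambda>d. fst (F' d)) w"
  and sderiv_snd: "has_sderiv F F' w \<Longrightarrow> has_sderiv (\<lambda>w. snd (F w)) (\<lambda>d. snd (F' d)) w"
  by (auto intro: sderiv_bounded_linear bounded_linear_fst bounded_linear_snd)

lemma sderiv_add: "has_sderiv F F' w \<Longrightarrow> has_sderiv G G' w \<Longrightarrow> has_sderiv (\<lambda>w. F w + G w) (\<lambda>d. F' d + G' d) w"
  and sderiv_diff: "has_sderiv F F' w \<Longrightarrow> has_sderiv G G' w \<Longrightarrow> has_sderiv (\<lambda>w. F w - G w) (\<lambda>d. F' d - G' d) w"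
  by (auto simp: has_sderiv_def intro: has_derivative_add has_derivative_diff)

lemma sderiv_Pair:
  "has_sderiv F F' w \<Longrightarrow> has_sderiv G G' w \<Longrightarrow> has_sderiv (\<lambda>w. (F w, G w)) (\<lambda>d. (F' d, G' d)) w"
  by (auto simp: has_sderiv_def intro: has_derivative_Pair)

lemma sderiv_sum:
  assumes "\<And>i. i \<in> I \<Longrightarrow> has_sderiv (F i) (F' i) w"
  shows "has_sderiv (\<lambda>w. \<Sum>i\<in>I. F i w) (\<lambda>d. \<Sum>i\<in>I. F' i d) w"
  using assms by (auto simp: has_sderiv_def intro!: has_derivative_sum)

lemma sderiv_inner:
  assumes "has_sderiv F F' w" "has_sderiv G G' w"
  shows "has_sderiv (\<lambda>w. F w \<bullet> G w) (\<lambda>d. F w \<bullet> G' d + F' d \<bullet> G w) w"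
  unfolding has_sderiv_def
proof
  fix j
  show "((\<lambda>v. F (w(j := v)) \<bullet> G (w(j := v))) has_derivative
      (\<lambda>h. F w \<bullet> G' ((\<lambda>_. 0)(j := h)) + F' ((\<lambda>_. 0)(j := h)) \<bullet> G w)) (at (w j))"
    using has_derivative_inner[OF assms[unfolded has_sderiv_def, rule_format, of j]] by simp
qed

lemma sderiv_cmult: "has_sderiv F F' w \<Longrightarrow> has_sderiv (\<lambda>w. c * F w :: real) (\<lambda>d. c * F' d) w"
  by (auto simp: has_sderiv_def intro: has_derivative_mult_right)

lemma grad_eqI: "(F has_derivative (\<lambda>h. h \<bullet> D)) (at p) \<Longrightarrow> grad F p = D"
proof -
  assume F: "(F has_derivative (\<lambda>h. h \<bullet> D)) (at p)"
  show ?thesis unfolding grad_def gderiv_def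
  proof (rule the_equality[where P="\<lambda>D. (F has_derivative (\<lambda>h. h \<bullet> D)) (at p)", OF F])
    fix D' assume "(F has_derivative (\<lambda>h. h \<bullet> D')) (at p)"
    from has_derivative_unique[OF this F] have "\<And>h. h \<bullet> D' = h \<bullet> D" by meson
    then show "D' = D" by (metis inner_commute vector_eq_rdot)
  qed
qed

lemma bgrad_eqI:
  assumes "has_sderiv F (binner {..N} E) w"
  shows "bgrad F w = (\<lambda>j. if j \<le> N then E j else 0)"
proof
  fix j
  have "((\<lambda>v. F (w(j := v))) has_derivative (\<lambda>h. h \<bullet> (if j \<le> N then E j else 0))) (at (w j))"
    using assms unfolding has_sderiv_def binner_single
    by (auto simp: inner_commute elim!: allE[where x=j] cong: if_cong)
  then show "bgrad F w j = (if j \<le> N then E j else 0)"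
    unfolding bgrad_def by (rule grad_eqI)
qed

lemma jblock_eqI:
  "has_sderiv (\<lambda>w. F w k) F' w \<Longrightarrow> jblock F w k j = (\<lambda>h. F' ((\<lambda>_. 0)(j := h)))"
  by (auto simp: jblock_def has_sderiv_def frechet_derivative_at[symmetric])

lemma sderiv_linear:
  "has_sderiv F F' w \<Longrightarrow> linear (\<lambda>h. F' ((\<lambda>_. 0)(j := h)))"
  unfolding has_sderiv_def using has_derivative_linear by blast

section \<open>Bidiagonal operators\<close>

text \<open>\<open>gop N D\<close> is the constraint Jacobian with stage Jacobians \<open>D k\<close>; \<open>gopT N D\<close> is its transpose.\<close>

definition gop :: "nat \<Rightarrow> (nat \<Rightarrow> 'x \<times> 'u \<Rightarrow> 'x::real_vector) \<Rightarrow> (nat \<Rightarrow> 'x \<times> 'u) \<Rightarrow> nat \<Rightarrow> 'x" where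
  "gop N D v k = (if k \<le> N then fst (v k) - (if k = 0 then 0 else D (k - 1) (v (k - 1))) else 0)"

definition gopT :: "nat \<Rightarrow> (nat \<Rightarrow> 'x \<times> 'u \<Rightarrow> 'x::euclidean_space) \<Rightarrow> (nat \<Rightarrow> 'x) \<Rightarrow> nat \<Rightarrow> 'x \<times> 'u::euclidean_space" where
  "gopT N D y k = (if k \<le> N then (y k, 0) - (if k < N then adjoint (D k) (y (Suc k)) else 0) else 0)"

lemma sum_atMost_pred: "(\<Sum>k\<le>N::nat. if k = 0 then 0 else f (k - 1)) = (\<Sum>k<N. f k :: 'a::comm_monoid_add)"
  by (simp add: lessThan_Suc_atMost[symmetric] sum.lessThan_Suc_shift del: sum.lessThan_Suc)

lemma sum_atMost_lt: "(\<Sum>k\<le>N::nat. if k < N then f k else 0) = (\<Sum>k<N. f k :: 'a::comm_monoid_add)"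
  by (simp add: lessThan_Suc_atMost[symmetric] cong: sum.cong_simp)

text \<open>Summation by parts: the coupling term pairs \<open>y k\<close> with block
  \<open>k - 1\<close> of \<open>v\<close>; shifting the index moves the transpose of
  \<open>D k\<close> onto \<open>y (Suc k)\<close>.\<close>

lemma gop_adjoint:
  fixes D :: "nat \<Rightarrow> 'x::euclidean_space \<times> 'u::euclidean_space \<Rightarrow> 'x"
  assumes "\<And>k. k < N \<Longrightarrow> linear (D k)"
  shows "binner {..N} y (gop N D v) = binner {..N} (gopT N D y) v"
proof -
  \<comment> \<open>Writing \<open>y k\<close> as \<open>y (Suc (k - 1))\<close> makes the second
    summand a function of \<open>k - 1\<close> alone, the shape in which
    \<open>sum_atMost_pred\<close> shifts the index.\<close>
  have "binner {..N} y (gop N D v) = (\<Sum>k\<le>N. y k \<bullet> fst (v k)) - (\<Sum>k\<le>N. if k = 0 then 0 else y (Suc (k - 1)) \<bullet> D (k - 1) (v (k - 1)))"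
    unfolding binner_def sum_subtractf[symmetric] by (rule sum.cong) (auto simp: gop_def inner_simps)
  also have "\<dots> = (\<Sum>k\<le>N. y k \<bullet> fst (v k)) - (\<Sum>k<N. y (Suc k) \<bullet> D k (v k))"
    by (simp only: sum_atMost_pred[where f="\<lambda>k. y (Suc k) \<bullet> D k (v k)"])
  also have "(\<Sum>k<N. y (Suc k) \<bullet> D k (v k)) = (\<Sum>k\<le>N. if k < N then y (Suc k) \<bullet> D k (v k) else 0)"
    by (simp only: sum_atMost_lt)
  also have "(\<Sum>k\<le>N. y k \<bullet> fst (v k)) - \<dots> = binner {..N} (gopT N D y) v"
    unfolding binner_def sum_subtractf[symmetric]
    by (rule sum.cong) (auto simp: gopT_def inner_diff_left inner_prod_def[of "(_, _)"] adjoint_clauses(2)[OF assms])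
  finally show ?thesis .
qed

lemma gopT_eqI:
  fixes D :: "nat \<Rightarrow> 'x::euclidean_space \<times> 'u::euclidean_space \<Rightarrow> 'x"
  assumes "\<And>k. k < N \<Longrightarrow> linear (D k)" "j \<le> N"
    and "\<And>h::'x \<times> 'u. e \<bullet> h = binner {..N} y (gop N D ((\<lambda>_. 0)(j := h)))"
  shows "e = gopT N D y j"
proof -
  have "e \<bullet> h = gopT N D y j \<bullet> h" for h
    using assms(3)[of h] assms(2) by (simp add: gop_adjoint[OF assms(1)] binner_single)
  then show ?thesis by (metis inner_commute vector_eq_rdot)
qed

lemma gop_add:
  assumes "\<And>k. k < N \<Longrightarrow> linear (D k)"
  shows "gop N D (\<lambda>k. v k + w k) = (\<lambda>k. gop N D v k + gop N D w k)"
  using assms by (auto simp: gop_def linear_add)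

lemma gop_scaleR:
  assumes "\<And>k. k < N \<Longrightarrow> linear (D k)"
  shows "gop N D (\<lambda>k. c *\<^sub>R v k) = (\<lambda>k. c *\<^sub>R gop N D v k)"
  using assms by (auto simp: gop_def linear_scale algebra_simps)

lemma gopT_add:
  fixes D :: "nat \<Rightarrow> 'x::euclidean_space \<times> 'u::euclidean_space \<Rightarrow> 'x"
  assumes "\<And>k. k < N \<Longrightarrow> linear (D k)"
  shows "gopT N D (\<lambda>k. v k + w k) = (\<lambda>k. gopT N D v k + gopT N D w k)"
  using linear_add[OF adjoint_linear[OF assms]] by (auto simp: gopT_def)

lemma gopT_scaleR:
  fixes D :: "nat \<Rightarrow> 'x::euclidean_space \<times> 'u::euclidean_space \<Rightarrow> 'x"
  assumes "\<And>k. k < N \<Longrightarrow> linear (D k)"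
  shows "gopT N D (\<lambda>k. c *\<^sub>R v k) = (\<lambda>k. c *\<^sub>R gopT N D v k)"
  using linear_scale[OF adjoint_linear[OF assms]] by (auto simp: gopT_def algebra_simps)

text \<open>Blockwise derivatives only give values at single-block vectors. For an additive map that
  sees no block beyond \<open>N\<close> they add up to the value at the whole vector, by adding one
  block at a time.\<close>

lemma sum_single_blocks:
  assumes add: "\<And>u v. F (\<lambda>k. u k + v k) = F u + (F v :: 'b::real_vector)"
    and cong: "\<And>u v. (\<And>k. k \<le> N \<Longrightarrow> u k = v k) \<Longrightarrow> F u = F v"
  shows "(\<Sum>j\<le>N. F ((\<lambda>_. 0)(j := v j))) = F (v :: nat \<Rightarrow> 'a::real_vector)"
proof -
  have "(\<Sum>j<n. F ((\<lambda>_. 0)(j := v j))) = F (\<lambda>k. if k < n then v k else 0)" for n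
  proof (induction n)
    case 0
    show ?case using add[of "\<lambda>_. 0" "\<lambda>_. 0"] by simp
  next
    case (Suc n)
    have "F (\<lambda>k. if k < Suc n then v k else 0)
        = F (\<lambda>k. (if k < n then v k else 0) + ((\<lambda>_. 0)(n := v n)) k)"
      by (rule arg_cong[where f=F]) (auto simp: less_Suc_eq)
    also have "\<dots> = F (\<lambda>k. if k < n then v k else 0) + F ((\<lambda>_. 0)(n := v n))"
      by (rule add)
    finally show ?case using Suc by (simp del: fun_upd_apply)
  qed
  from this[of "Suc N"] show ?thesis
    using cong[of "\<lambda>k. if k < Suc N then v k else 0" v] by (simp add: lessThan_Suc_atMost)
qed

lemma linear_functional_inner:
  fixes f :: "'a::euclidean_space \<Rightarrow> real"
  assumes "linear f"
  shows "f h = h \<bullet> (\<Sum>b\<in>Basis. f b *\<^sub>R b)"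
proof -
  have "f h = f (\<Sum>b\<in>Basis. (h \<bullet> b) *\<^sub>R b)" by (simp add: euclidean_representation)
  also have "\<dots> = (\<Sum>b\<in>Basis. (h \<bullet> b) * f b)"
    using assms by (simp add: linear_sum linear_scale)
  finally show ?thesis by (simp add: inner_sum_right mult.commute)
qed

text \<open>Variant of \<open>bgrad_eqI\<close> for a derivative not yet written as an inner
  product: its restriction to one block is linear, and \<open>linear_functional_inner\<close>
  supplies the representing vector.\<close>

lemma bgrad_inner:
  fixes w :: "nat \<Rightarrow> 'a::euclidean_space"
  assumes "has_sderiv F F' w"
  shows "bgrad F w j \<bullet> h = F' ((\<lambda>_. 0)(j := h))"
proof -
  let ?f = "\<lambda>h. F' ((\<lambda>_. 0)(j := h))"
  have d: "((\<lambda>v. F (w(j := v))) has_derivative ?f) (at (w j))"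
    using assms by (simp add: has_sderiv_def)
  have *: "?f h = h \<bullet> (\<Sum>b\<in>Basis. ?f b *\<^sub>R b)" for h
    by (rule linear_functional_inner) (rule sderiv_linear[OF assms])
  have "bgrad F w j = (\<Sum>b\<in>Basis. ?f b *\<^sub>R b)"
    unfolding bgrad_def by (rule grad_eqI) (subst *[symmetric], rule d)
  then show ?thesis using *[of h] by (simp add: inner_commute)
qed

text \<open>In coordinates the adjoint depends on \<open>f\<close> only through the values
  \<open>f b\<close>, so the adjoint of a Jacobian can be differentiated in its base point.\<close>

lemma adjoint_eq_sum:
  fixes f :: "'a::euclidean_space \<Rightarrow> 'b::euclidean_space"
  assumes "linear f"
  shows "adjoint f y = (\<Sum>b\<in>Basis. (f b \<bullet> y) *\<^sub>R b)"
  using euclidean_representation[of "adjoint f y"] by (simp add: adjoint_clauses(2)[OF assms] inner_commute[of y])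

section \<open>Derivatives of the Lagrangian and of the merit function\<close>

text \<open>The form in which smoothness is used: the derivative in each fixed direction is again
  differentiable in the base point.\<close>

definition twice_diff :: "('a::euclidean_space \<Rightarrow> 'b::euclidean_space) \<Rightarrow> bool" where
  "twice_diff F \<longleftrightarrow> (\<forall>p. F differentiable (at p)) \<and>
     (\<forall>v p. (\<lambda>p. frechet_derivative F (at p) v) differentiable (at p))"

lemma C_diff_3_imp_twice_diff: "C_diff 3 F \<Longrightarrow> twice_diff F"
  by (simp add: twice_diff_def numeral_3_eq_3)

lemma twice_diff_deriv:
  "twice_diff F \<Longrightarrow> (F has_derivative frechet_derivative F (at p)) (at p)"
  by (simp add: twice_diff_def flip: frechet_derivative_works)

lemma twice_diff_linear: "twice_diff F \<Longrightarrow> linear (frechet_derivative F (at p))"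
  using twice_diff_deriv has_derivative_linear by blast

lemma grad_twice_diff:
  fixes F :: "'a::euclidean_space \<Rightarrow> real"
  assumes "twice_diff F"
  shows "grad F p = (\<Sum>b\<in>Basis. frechet_derivative F (at p) b *\<^sub>R b)"
    and "(F has_derivative (\<lambda>h. h \<bullet> grad F p)) (at p)"
    and "grad F differentiable (at p)"
proof -
  have *: "frechet_derivative F (at p) h = h \<bullet> (\<Sum>b\<in>Basis. frechet_derivative F (at p) b *\<^sub>R b)" for p h
    by (rule linear_functional_inner) (rule twice_diff_linear[OF assms])
  have d: "(F has_derivative (\<lambda>h. h \<bullet> (\<Sum>b\<in>Basis. frechet_derivative F (at p) b *\<^sub>R b))) (at p)" for p
    unfolding *[symmetric] by (rule twice_diff_deriv[OF assms])
  show 1: "grad F p = (\<Sum>b\<in>Basis. frechet_derivative F (at p) b *\<^sub>R b)" for p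
    by (rule grad_eqI[OF d])
  show "(F has_derivative (\<lambda>h. h \<bullet> grad F p)) (at p)"
    unfolding 1 by (rule d)
  have "(\<lambda>p. \<Sum>b\<in>Basis. frechet_derivative F (at p) b *\<^sub>R b) differentiable (at p)"
    using assms by (intro differentiable_sum ballI differentiable_scaleR differentiable_const) (simp_all only: twice_diff_def finite_Basis)
  then show "grad F differentiable (at p)" using 1 by presburger
qed

lemma twice_diff_fst:
  fixes F :: "'x::euclidean_space \<Rightarrow> real"
  assumes "twice_diff F"
  shows "twice_diff (\<lambda>z :: 'x \<times> 'u::euclidean_space. F (fst z))"
proof -
  have d: "((\<lambda>z :: 'x \<times> 'u. G (fst z)) has_derivative (\<lambda>h. frechet_derivative G (at (fst z)) (fst h))) (at z)"
    if "\<And>p. G differentiable (at p)" for z and G :: "'x \<Rightarrow> real"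
    using that by (intro has_derivative_compose[where f=fst and g=G] has_derivative_fst[of "\<lambda>x. x" "\<lambda>x. x", simplified])
      (auto simp: has_derivative_ident simp flip: frechet_derivative_works)
  have e: "frechet_derivative (\<lambda>z :: 'x \<times> 'u. F (fst z)) (at z) = (\<lambda>h. frechet_derivative F (at (fst z)) (fst h))" for z
    by (rule frechet_derivative_at[symmetric, OF d]) (use assms in \<open>simp add: twice_diff_def\<close>)
  show ?thesis
    unfolding twice_diff_def e
    using assms d[of F] d[of "\<lambda>p. frechet_derivative F (at p) v" for v]
    by (auto simp: twice_diff_def differentiable_def) blast+
qed

definition smooth_ndp :: "('x::euclidean_space, 'u::euclidean_space) ndp \<Rightarrow> bool" where
  "smooth_ndp P \<longleftrightarrow> (\<forall>k<hor P. twice_diff (scost P k) \<and> twice_diff (dyn P k)) \<and> twice_diff (tcost P)"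

text \<open>Reading the terminal cost as a cost of the last state-control pair removes the special
  case at the final stage from all sums.\<close>

definition stage_cost :: "('x::euclidean_space, 'u::euclidean_space) ndp \<Rightarrow> nat \<Rightarrow> 'x \<times> 'u \<Rightarrow> real" where
  "stage_cost P k z = (if k < hor P then scost P k z else tcost P (fst z))"

definition dynD :: "('x::euclidean_space, 'u::euclidean_space) ndp \<Rightarrow> ('x, 'u) primal \<Rightarrow> nat \<Rightarrow> 'x \<times> 'u \<Rightarrow> 'x" where
  "dynD P z k = frechet_derivative (dyn P k) (at (z k))"

text \<open>This is block \<open>k\<close> of the primal gradient of the Lagrangian without the
  summand \<open>(\<lambda>_k, 0)\<close>; the argument \<open>y\<close> stands for the multiplier
  of stage \<open>k + 1\<close>. Without that summand it depends on exactly the data on which the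
  Hessian block depends.\<close>

definition stage_grad :: "('x::euclidean_space, 'u::euclidean_space) ndp \<Rightarrow> 'x \<Rightarrow> nat \<Rightarrow> 'x \<times> 'u \<Rightarrow> 'x \<times> 'u" where
  "stage_grad P y k zk = grad (stage_cost P k) zk
     - (if k < hor P then adjoint (frechet_derivative (dyn P k) (at zk)) y else 0)"

lemma twice_diff_stage_cost: "smooth_ndp P \<Longrightarrow> twice_diff (stage_cost P k)"
  by (cases "k < hor P") (simp_all add: smooth_ndp_def stage_cost_def[abs_def] twice_diff_fst)

lemma linear_dynD: "smooth_ndp P \<Longrightarrow> k < hor P \<Longrightarrow> linear (dynD P z k)"
  by (simp add: smooth_ndp_def dynD_def twice_diff_linear)

lemma sderiv_constr:
  assumes "smooth_ndp P"
  shows "has_sderiv (\<lambda>z. constr P z k) (\<lambda>d. gop (hor P) (dynD P z) d k) z"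
proof -
  have x: "has_sderiv (\<lambda>z. fst (z k)) (\<lambda>d. fst (d k)) z" by (intro sderiv_fst sderiv_coord)
  consider "k = 0" | "k \<noteq> 0" "k \<le> hor P" | "k > hor P" by linarith
  then show ?thesis
  proof cases
    case 1
    then show ?thesis using sderiv_diff[OF x sderiv_const[of "xinit P"]]
      by (simp add: constr_def gop_def)
  next
    case 2
    have "has_sderiv (\<lambda>z. dyn P (k - 1) (z (k - 1))) (\<lambda>d. dynD P z (k - 1) (d (k - 1))) z"
      unfolding dynD_def using assms 2
      by (intro sderiv_compose[OF sderiv_coord]) (auto simp: smooth_ndp_def intro!: twice_diff_deriv)
    from sderiv_diff[OF x this] 2 show ?thesis by (simp add: constr_def gop_def)
  next
    case 3
    then show ?thesis by (auto simp: constr_def gop_def)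
  qed
qed

lemma gop_cong: "(\<And>k. k \<le> N \<Longrightarrow> u k = v k) \<Longrightarrow> gop N D u = gop N D v"
  by (auto simp: gop_def)

lemma jacG_eq:
  assumes "smooth_ndp P"
  shows "jacG P w = gop (hor P) (dynD P (fst \<circ> w))"
proof (intro ext)
  fix v k
  note jb = jblock_eqI[OF sderiv_constr[OF assms, where z="fst \<circ> w"]]
  have "(\<Sum>j\<le>hor P. gop (hor P) (dynD P (fst \<circ> w)) ((\<lambda>_. 0)(j := v j)) k) = gop (hor P) (dynD P (fst \<circ> w)) v k"
    by (rule sum_single_blocks)
      (auto simp: gop_add linear_dynD[OF assms] intro: fun_cong[OF gop_cong])
  then show "jacG P w v k = gop (hor P) (dynD P (fst \<circ> w)) v k"
    by (cases "k \<le> hor P")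
      (simp_all add: jacG_def jac_def jb gop_def[of _ _ v] del: fun_upd_apply)
qed

lemma jacGT_eq:
  assumes "smooth_ndp P"
  shows "jacGT P w = gopT (hor P) (dynD P (fst \<circ> w))"
proof (intro ext)
  fix y j
  let ?z = "fst \<circ> w"
  note jb = jblock_eqI[OF sderiv_constr[OF assms, where z="?z"]]
  have lin: "linear (\<lambda>h. gop (hor P) (dynD P ?z) ((\<lambda>_. 0)(j := h)) k)" for k
    by (rule sderiv_linear[OF sderiv_constr[OF assms]])
  show "jacGT P w y j = gopT (hor P) (dynD P ?z) y j"
  proof (cases "j \<le> hor P")
    case True
    have "jacGT P w y j \<bullet> h = binner {..hor P} y (gop (hor P) (dynD P ?z) ((\<lambda>_. 0)(j := h)))" for h
      using True
      by (simp add: jacGT_def jacT_def inner_sum_left adjoint_clauses(2)[OF lin] binner_def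
          jb del: fun_upd_apply)
    with True show ?thesis by (intro gopT_eqI linear_dynD[OF assms])
  qed (simp add: jacGT_def jacT_def gopT_def)
qed

lemma sum_lessThan_atMost_split: "(\<Sum>k\<le>N. f k) = (\<Sum>k<N::nat. f k) + (f N :: 'a::comm_monoid_add)"
  by (simp add: lessThan_Suc_atMost[symmetric])

lemma lagr_eq:
  "lagr P w = (\<Sum>k\<le>hor P. stage_cost P k (fst (w k))) + (\<Sum>k\<le>hor P. snd (w k) \<bullet> constr P (fst \<circ> w) k)"
  by (simp add: lagr_def cost_def binner_def sum_lessThan_atMost_split stage_cost_def)

lemma sderiv_comp_fst:
  fixes w :: "nat \<Rightarrow> 'a::real_normed_vector \<times> 'b::real_normed_vector"
  assumes "has_sderiv F F' (fst \<circ> w)"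
  shows "has_sderiv (\<lambda>w. F (fst \<circ> w)) (\<lambda>d. F' (fst \<circ> d)) w"
  unfolding has_sderiv_def
proof
  fix j
  have e: "fst \<circ> (u(j := v)) = (fst \<circ> u)(j := fst v)" for u :: "nat \<Rightarrow> 'a \<times> 'b" and v by auto
  have e0: "fst \<circ> ((\<lambda>_. 0)(j := v)) = (\<lambda>_. 0)(j := fst v)" for v :: "'a \<times> 'b" by auto
  have "((\<lambda>v. F ((fst \<circ> w)(j := v))) has_derivative (\<lambda>h. F' ((\<lambda>_. 0)(j := h)))) (at (fst (w j)))"
    using assms by (simp add: has_sderiv_def)
  from has_derivative_compose[OF has_derivative_fst[OF has_derivative_ident] this]
  show "((\<lambda>v. F (fst \<circ> w(j := v))) has_derivative (\<lambda>h. F' (fst \<circ> (\<lambda>_. 0)(j := h)))) (at (w j))"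
    unfolding e0 unfolding e .
qed

text \<open>The product rule for the multiplier term yields the multiplier tested against
  \<open>G\<close> applied to the primal variation; transposing \<open>G\<close> there turns the
  whole derivative into an inner product and reveals the gradient.\<close>

lemma sderiv_lagr:
  fixes P :: "('x::euclidean_space, 'u::euclidean_space) ndp"
  assumes "smooth_ndp P"
  defines "E \<equiv> \<lambda>w k. (grad (stage_cost P k) (fst (w k)) + gopT (hor P) (dynD P (fst \<circ> w)) (snd \<circ> w) k,
      constr P (fst \<circ> w) k)"
  shows "has_sderiv (lagr P) (binner {..hor P} (E w)) w"
proof -
  let ?N = "hor P" and ?z = "fst \<circ> w" and ?y = "snd \<circ> w"
  let ?G = "gop ?N (dynD P ?z)"
  let ?F' = "\<lambda>d. (\<Sum>k\<le>?N. fst (d k) \<bullet> grad (stage_cost P k) (fst (w k)))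
     + (\<Sum>k\<le>?N. snd (w k) \<bullet> ?G (fst \<circ> d) k + snd (d k) \<bullet> constr P ?z k)"
  have "has_sderiv (lagr P) ?F' w"
    unfolding lagr_eq[abs_def]
    by (intro sderiv_add sderiv_sum sderiv_compose[OF sderiv_fst[OF sderiv_coord]]
        grad_twice_diff(2)[OF twice_diff_stage_cost[OF assms(1)]] sderiv_inner sderiv_snd sderiv_coord
        sderiv_comp_fst sderiv_constr[OF assms(1)])
  moreover have "?F' = binner {..?N} (E w)"
  proof
    fix d :: "('x, 'u) pd"
    have "(\<Sum>k\<le>?N. snd (w k) \<bullet> ?G (fst \<circ> d) k) = binner {..?N} (gopT ?N (dynD P ?z) ?y) (fst \<circ> d)"
      using gop_adjoint[where y="?y" and v="fst \<circ> d" and D="dynD P ?z" and N="?N"] linear_dynD[OF assms(1)]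
      by (simp add: binner_def)
    then show "?F' d = binner {..?N} (E w) d"
      by (simp add: binner_def E_def inner_prod_def inner_add_left inner_add_right sum.distrib inner_commute)
  qed
  ultimately show ?thesis by simp
qed

lemma gradL_eq:
  assumes "smooth_ndp P"
  shows "gradL P w = (\<lambda>k. if k \<le> hor P
    then (stage_grad P (snd (w (Suc k))) k (fst (w k)) + (snd (w k), 0), constr P (fst \<circ> w) k) else 0)"
  by (rule ext) (auto simp: bgrad_eqI[OF sderiv_lagr[OF assms]] gopT_def stage_grad_def dynD_def)

text \<open>The terminal cost sees the state only. Hence the linear term of the quadratic program at
  the last stage, which has no control part, may be written with the full block.\<close>

lemma snd_gradL_last:
  assumes "smooth_ndp P"
  shows "snd (fst (gradL P w (hor P))) = 0"
proof -
  have s: "twice_diff (tcost P)" using assms by (simp add: smooth_ndp_def)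
  have "grad (\<lambda>z::'a \<times> 'b. tcost P (fst z)) p = (grad (tcost P) (fst p), 0)" for p
    by (rule grad_eqI)
      (use has_derivative_compose[OF has_derivative_fst[OF has_derivative_ident] grad_twice_diff(2)[OF s], of p]
        in \<open>simp add: inner_prod_def\<close>)
  then show ?thesis by (simp add: gradL_eq[OF assms] stage_grad_def stage_cost_def[abs_def])
qed

lemma differentiable_stage_grad:
  assumes "smooth_ndp P"
  shows "stage_grad P y k differentiable (at zk)"
proof -
  have "(\<lambda>zk. if k < hor P then adjoint (frechet_derivative (dyn P k) (at zk)) y else 0) differentiable (at zk)"
  proof (cases "k < hor P")
    case True
    then have s: "twice_diff (dyn P k)" using assms by (simp add: smooth_ndp_def)
    then have "(\<lambda>zk. \<Sum>b\<in>Basis. (frechet_derivative (dyn P k) (at zk) b \<bullet> y) *\<^sub>R b) differentiable (at zk)"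
      by (intro differentiable_sum ballI differentiable_scaleR differentiable_inner differentiable_const)
        (simp_all only: twice_diff_def finite_Basis)
    then show ?thesis using True by (simp add: adjoint_eq_sum[OF twice_diff_linear[OF s]])
  qed simp
  then show ?thesis
    unfolding stage_grad_def[abs_def]
    by (intro differentiable_diff grad_twice_diff(3) twice_diff_stage_cost assms)
qed

lemma hessL_blk_eq:
  assumes "smooth_ndp P" "k \<le> hor P"
  shows "hessL_blk P w k = frechet_derivative (stage_grad P (snd (w (Suc k))) k) (at (fst (w k)))"
proof -
  have e: "(\<lambda>v. gradzL P (snd \<circ> w) ((fst \<circ> w)(k := v)) k)
      = (\<lambda>v. stage_grad P (snd (w (Suc k))) k v + (snd (w k), 0))"
    using assms(2) by (simp add: gradzL_def gradL_eq[OF assms(1)])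
  have "((\<lambda>v. stage_grad P (snd (w (Suc k))) k v + (snd (w k), 0)) has_derivative
      (\<lambda>h. frechet_derivative (stage_grad P (snd (w (Suc k))) k) (at (fst (w k))) h + 0)) (at (fst (w k)))"
    by (intro has_derivative_add has_derivative_const)
      (use differentiable_stage_grad[OF assms(1)] in \<open>simp add: frechet_derivative_works\<close>)
  from frechet_derivative_at[OF this] show ?thesis
    unfolding hessL_blk_def jblock_def e by simp
qed

lemma linear_hessL_blk: "smooth_ndp P \<Longrightarrow> k \<le> hor P \<Longrightarrow> linear (hessL_blk P w k)"
  unfolding hessL_blk_eq by (intro linear_frechet_derivative differentiable_stage_grad)

text \<open>The stage gradient is linear in the multiplier, so the product rule splits its derivative into
  the Hessian block and the transposed Jacobian of the dynamics.\<close>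

lemma sderiv_stage_grad:
  fixes P :: "('x::euclidean_space, 'u::euclidean_space) ndp"
  assumes P: "smooth_ndp P" and k: "k \<le> hor P"
  shows "has_sderiv (\<lambda>w. stage_grad P (snd (w (Suc k))) k (fst (w k)))
    (\<lambda>d. hessL_blk P w k (fst (d k))
       - (if k < hor P then adjoint (dynD P (fst \<circ> w) k) (snd (d (Suc k))) else 0)) w"
proof -
  let ?zk = "fst (w k)" and ?y = "snd (w (Suc k))"
  let ?f = "frechet_derivative (dyn P k)"
  have z: "has_sderiv (\<lambda>w. fst (w k)) (\<lambda>d. fst (d k)) w" by (intro sderiv_fst sderiv_coord)
  have c0: "has_sderiv (\<lambda>w. stage_grad P a k (fst (w k))) (\<lambda>d. frechet_derivative (stage_grad P a k) (at ?zk) (fst (d k))) w" for a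
    by (rule sderiv_compose[OF z]) (use differentiable_stage_grad[OF P] in \<open>simp add: frechet_derivative_works\<close>)
  show ?thesis
  proof (cases "k < hor P")
    case False
    have "has_sderiv (\<lambda>w. stage_grad P ?y k (fst (w k))) (\<lambda>d. hessL_blk P w k (fst (d k))) w"
      using c0[of ?y] by (simp add: hessL_blk_eq[OF P k])
    then show ?thesis using False by (simp add: stage_grad_def)
  next
    case True
    then have s: "twice_diff (dyn P k)" using P by (simp add: smooth_ndp_def)
    note lin = twice_diff_linear[OF s]
    \<comment> \<open>The multiplier is expanded around its base value \<open>?y\<close>. The factor
      \<open>y - ?y\<close> vanishes at the base point, so in the derivative of the last term the
      second derivatives of the dynamics drop out; they are all contained in the Hessian
      block.\<close>
    have split: "stage_grad P y k z = stage_grad P ?y k z - adjoint (?f (at z)) (y - ?y)" for y z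
      using True linear_diff[OF adjoint_linear[OF lin]] by (simp add: stage_grad_def)
    have "has_sderiv (\<lambda>w. ?f (at (fst (w k))) b) (\<lambda>d. frechet_derivative (\<lambda>z. ?f (at z) b) (at ?zk) (fst (d k))) w" for b
      by (rule sderiv_compose[OF z]) (use s in \<open>simp only: twice_diff_def frechet_derivative_works[symmetric]\<close>)
    note * = sderiv_inner[OF this sderiv_diff[OF sderiv_snd[OF sderiv_coord[where k="Suc k"]] sderiv_const[of ?y]]]
    have "has_sderiv (\<lambda>w. \<Sum>b\<in>Basis. (?f (at (fst (w k))) b \<bullet> (snd (w (Suc k)) - ?y)) *\<^sub>R b)
        (\<lambda>d. \<Sum>b\<in>Basis. (?f (at ?zk) b \<bullet> snd (d (Suc k))) *\<^sub>R b) w"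
      using sderiv_sum[of Basis, OF sderiv_bounded_linear[OF bounded_linear_scaleR_left *]] by simp
    then have "has_sderiv (\<lambda>w. adjoint (?f (at (fst (w k)))) (snd (w (Suc k)) - ?y))
        (\<lambda>d. adjoint (?f (at ?zk)) (snd (d (Suc k)))) w"
      by (simp add: adjoint_eq_sum[OF lin])
    from sderiv_diff[OF c0[of ?y] this] show ?thesis
      unfolding split[symmetric] using True by (simp add: hessL_blk_eq[OF P k] dynD_def)
  qed
qed

lemma blkdiag_add:
  "(\<And>k. k \<le> N \<Longrightarrow> linear (Hh k)) \<Longrightarrow> blkdiag N Hh (\<lambda>k. u k + v k) = (\<lambda>k. blkdiag N Hh u k + blkdiag N Hh v k)"
  by (rule ext) (simp add: blkdiag_def linear_add)

text \<open>The true Hessian of the Lagrangian. It governs the derivative of \<open>gradL\<close>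
  and hence the merit function, whereas \<open>kkt\<close> is built from the modified blocks
  \<open>Hh\<close>.\<close>

definition bhess :: "('x::euclidean_space, 'u::euclidean_space) ndp \<Rightarrow> ('x, 'u) pd \<Rightarrow> ('x, 'u) primal \<Rightarrow> ('x, 'u) primal" where
  "bhess P w = blkdiag (hor P) (hessL_blk P w)"

lemma sderiv_gradL:
  fixes P :: "('x::euclidean_space, 'u::euclidean_space) ndp"
  assumes P: "smooth_ndp P" and k: "k \<le> hor P"
  shows "has_sderiv (\<lambda>w. gradL P w k) (\<lambda>d.
     (bhess P w (fst \<circ> d) k + jacGT P w (snd \<circ> d) k, jacG P w (fst \<circ> d) k)) w"
proof -
  have y: "has_sderiv (\<lambda>w :: ('x, 'u) pd. (snd (w k), 0::'u)) (\<lambda>d. (snd (d k), 0)) w"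
    by (intro sderiv_Pair sderiv_snd sderiv_coord sderiv_const)
  show ?thesis
    using sderiv_Pair[OF sderiv_add[OF sderiv_stage_grad[OF P k, of w] y] sderiv_comp_fst[OF sderiv_constr[OF P, of k]]] k
    by (simp add: gradL_eq[OF P] jacG_eq[OF P] jacGT_eq[OF P] gopT_def bhess_def blkdiag_def add_diff_eq diff_add_eq cong: if_cong)
qed

lemma
  assumes "smooth_ndp P"
  shows gop_dynD_add: "gop (hor P) (dynD P z) (\<lambda>k. v k + v' k) = (\<lambda>k. gop (hor P) (dynD P z) v k + gop (hor P) (dynD P z) v' k)"
    and gopT_dynD_add: "gopT (hor P) (dynD P z) (\<lambda>k. y k + y' k) = (\<lambda>k. gopT (hor P) (dynD P z) y k + gopT (hor P) (dynD P z) y' k)"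
    and gop_dynD_scaleR: "gop (hor P) (dynD P z) (\<lambda>k. a *\<^sub>R v k) = (\<lambda>k. a *\<^sub>R gop (hor P) (dynD P z) v k)"
    and gopT_dynD_scaleR: "gopT (hor P) (dynD P z) (\<lambda>k. a *\<^sub>R y k) = (\<lambda>k. a *\<^sub>R gopT (hor P) (dynD P z) y k)"
  by (rule gop_add gopT_add gop_scaleR gopT_scaleR, erule linear_dynD[OF assms])+

text \<open>The chain rule for the two squared norms tests the gradient of the Lagrangian against
  its own derivative along \<open>d\<close>, that is, against the KKT operator with the true
  Hessian.\<close>

lemma merit_slope_eq:
  fixes P :: "('x::euclidean_space, 'u::euclidean_space) ndp"
  assumes P: "smooth_ndp P"
  shows "merit_slope P \<eta>1 \<eta>2 w d = binner {..hor P} (gradL P w) d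
    + \<eta>1 * binner {..hor P} (snd \<circ> gradL P w) (jacG P w (fst \<circ> d))
    + \<eta>2 * binner {..hor P} (fst \<circ> gradL P w) (\<lambda>k. bhess P w (fst \<circ> d) k + jacGT P w (snd \<circ> d) k)"
proof -
  let ?N = "hor P"
  let ?g = "gradL P w"
  let ?A = "\<lambda>d k. bhess P w (fst \<circ> d) k + jacGT P w (snd \<circ> d) k" and ?B = "\<lambda>d. jacG P w (fst \<circ> d)"
  let ?M = "\<lambda>d. binner {..?N} ?g d + \<eta>1 * binner {..?N} (snd \<circ> ?g) (?B d) + \<eta>2 * binner {..?N} (fst \<circ> ?g) (?A d)"
  have g: "has_sderiv (\<lambda>w. gradL P w k) (\<lambda>d. (?A d k, ?B d k)) w" if "k \<in> {..?N}" for k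
    using sderiv_gradL[OF P, of k] that by simp
  have if_bin: "binner {..?N} (\<lambda>j. if j \<le> ?N then E j else 0) = binner {..?N} E" for E :: "('x, 'u) pd"
    by (auto simp: binner_def intro!: ext sum.cong)
  have "has_sderiv (lagr P) (binner {..?N} ?g) w"
    using sderiv_lagr[OF P, of w] unfolding bgrad_eqI[OF sderiv_lagr[OF P]] if_bin
    .
  then have "has_sderiv (\<lambda>w. lagr P w + \<eta>1 / 2 * (\<Sum>k\<le>?N. snd (gradL P w k) \<bullet> snd (gradL P w k))
      + \<eta>2 / 2 * (\<Sum>k\<le>?N. fst (gradL P w k) \<bullet> fst (gradL P w k)))
     (\<lambda>d. binner {..?N} ?g d + \<eta>1 / 2 * (\<Sum>k\<le>?N. snd (?g k) \<bullet> snd (?A d k, ?B d k) + snd (?A d k, ?B d k) \<bullet> snd (?g k))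
      + \<eta>2 / 2 * (\<Sum>k\<le>?N. fst (?g k) \<bullet> fst (?A d k, ?B d k) + fst (?A d k, ?B d k) \<bullet> fst (?g k))) w"
    by (intro sderiv_add sderiv_cmult sderiv_sum sderiv_inner sderiv_fst sderiv_snd g)
  then have s: "has_sderiv (merit P \<eta>1 \<eta>2) ?M w"
    unfolding binner_def merit_def[abs_def] bnorm_sq
    by (simp add: inner_commute sum.distrib flip: sum_distrib_left)
  have blk: "bhess P w (\<lambda>k. u k + v k) = (\<lambda>k. bhess P w u k + bhess P w v k)" for u v
    unfolding bhess_def by (rule blkdiag_add[OF linear_hessL_blk[OF P]])
  have comp: "fst \<circ> (\<lambda>k. u k + v k) = (\<lambda>k. (fst \<circ> u) k + (fst \<circ> v) k)"
    "snd \<circ> (\<lambda>k. u k + v k) = (\<lambda>k. (snd \<circ> u) k + (snd \<circ> v) k)" for u v :: "('x, 'u) pd" by auto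
  have A: "?A (\<lambda>k. u k + v k) = (\<lambda>k. ?A u k + ?A v k)" and B: "?B (\<lambda>k. u k + v k) = (\<lambda>k. ?B u k + ?B v k)" for u v
    unfolding comp blk jacG_eq[OF P] jacGT_eq[OF P] gop_dynD_add[OF P] gopT_dynD_add[OF P]
    by (simp_all only: add_ac)
  \<comment> \<open>The slope is by definition a sum over blocks of the gradient, each known only
    through a single-block variation; additivity of \<open>?M\<close> reassembles them.\<close>
  have "(\<Sum>j\<le>?N. ?M ((\<lambda>_. 0)(j := d j))) = ?M d"
  proof (rule sum_single_blocks)
    fix u v :: "('x, 'u) pd"
    show "?M (\<lambda>k. u k + v k) = ?M u + ?M v" unfolding A B binner_simps by (simp add: algebra_simps)
  next
    fix u v :: "('x, 'u) pd" assume uv: "\<And>k. k \<le> ?N \<Longrightarrow> u k = v k"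
    have "?A u = ?A v" "?B u = ?B v" "binner {..?N} ?g u = binner {..?N} ?g v"
      unfolding jacG_eq[OF P] jacGT_eq[OF P] using uv
      by (auto simp: bhess_def blkdiag_def binner_def gop_def gopT_def fun_eq_iff)
    then show "?M u = ?M v" by simp
  qed
  then show ?thesis
    by (simp add: merit_slope_def binner_def[of _ "bgrad _ _"] bgrad_inner[OF s] del: fun_upd_apply)
qed

section \<open>The quadratic program on the full window\<close>

definition block_symmetric :: "nat \<Rightarrow> (nat \<Rightarrow> 'x::euclidean_space \<times> 'u::euclidean_space \<Rightarrow> 'x \<times> 'u) \<Rightarrow> bool" where
  "block_symmetric N Hh \<longleftrightarrow> (\<forall>k\<le>N. linear (Hh k) \<and> (\<forall>a b. Hh k a \<bullet> b = a \<bullet> Hh k b)) \<and> (\<forall>a. snd (Hh N a) = 0)"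

lemma block_symmetricD:
  assumes "block_symmetric N Hh"
  shows "k \<le> N \<Longrightarrow> linear (Hh k)" "k \<le> N \<Longrightarrow> Hh k a \<bullet> b = a \<bullet> Hh k b" "snd (Hh N a) = 0"
  using assms unfolding block_symmetric_def by blast+

lemma block_symmetric_scaleR:
  "block_symmetric N Hh \<Longrightarrow> blkdiag N Hh (\<lambda>k. a *\<^sub>R u k) = (\<lambda>k. a *\<^sub>R blkdiag N Hh u k)"
  by (rule ext) (simp add: blkdiag_def linear_scale block_symmetricD(1))

lemma block_symmetric_add:
  "block_symmetric N Hh \<Longrightarrow> blkdiag N Hh (\<lambda>k. u k + v k) = (\<lambda>k. blkdiag N Hh u k + blkdiag N Hh v k)"
  by (rule blkdiag_add) (rule block_symmetricD(1))

lemma fst_comp_add: "fst \<circ> (\<lambda>k. u k + v k) = (\<lambda>k. (fst \<circ> u) k + (fst \<circ> v) k)"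
  and snd_comp_add: "snd \<circ> (\<lambda>k. u k + v k) = (\<lambda>k. (snd \<circ> u) k + (snd \<circ> v) k)"
  and fst_comp_scaleR: "fst \<circ> (\<lambda>k. a *\<^sub>R u k) = (\<lambda>k. a *\<^sub>R (fst \<circ> u) k)"
  and snd_comp_scaleR: "snd \<circ> (\<lambda>k. a *\<^sub>R u k) = (\<lambda>k. a *\<^sub>R (snd \<circ> u) k)"
  by auto

lemma
  assumes P: "smooth_ndp P" and S: "block_symmetric (hor P) Hh"
  shows kkt_add: "kkt P w Hh (\<lambda>k. u k + v k) = (\<lambda>k. kkt P w Hh u k + kkt P w Hh v k)"
    and kkt_scaleR: "kkt P w Hh (\<lambda>k. a *\<^sub>R u k) = (\<lambda>k. a *\<^sub>R kkt P w Hh u k)"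
  unfolding kkt_def[abs_def] jacG_eq[OF P] jacGT_eq[OF P] fst_comp_add snd_comp_add fst_comp_scaleR snd_comp_scaleR
    gop_dynD_add[OF P] gopT_dynD_add[OF P] gop_dynD_scaleR[OF P] gopT_dynD_scaleR[OF P] block_symmetric_add[OF S] block_symmetric_scaleR[OF S]
  by (simp_all only: add_ac scaleR_add_right add_Pair scaleR_Pair)

lemma kkt_cong:
  assumes P: "smooth_ndp P" and "\<And>k. k \<le> hor P \<Longrightarrow> u k = v k"
  shows "kkt P w Hh u = kkt P w Hh v"
  using assms(2) by (auto simp: kkt_def[abs_def] jacG_eq[OF P] jacGT_eq[OF P] blkdiag_def gop_def gopT_def fun_eq_iff)

text \<open>On the whole horizon \<open>term_hess\<close> adds no multiple of \<open>\<mu>\<close>,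
  and the prescribed initial value is minus the constraint violation at stage \<open>0\<close>. The
  local program is then the quadratic program of the full Newton system, the initial condition
  becoming its stage \<open>0\<close> constraint.\<close>

lemma qp_lagr_full_window:
  fixes P :: "('x::euclidean_space, 'u::euclidean_space) ndp"
  assumes P: "smooth_ndp P" and S: "block_symmetric (hor P) Hh"
  shows "qp_lagr P \<mu> w Hh 0 (hor P) v =
    (\<Sum>k\<le>hor P. 1 / 2 * (fst (v k) \<bullet> Hh k (fst (v k))) + fst (gradL P w k) \<bullet> fst (v k))
    + (\<Sum>k\<le>hor P. snd (v k) \<bullet> (gop (hor P) (dynD P (fst \<circ> w)) (fst \<circ> v) k + snd (gradL P w k)))"
proof -
  note H = block_symmetricD(1)[OF S] and symm = block_symmetricD(2)[OF S] and last = block_symmetricD(3)[OF S]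
  let ?N = "hor P"
  have HN: "Hh ?N (p, q) = (fst (Hh ?N (p, 0)), 0)" for p q
  proof -
    have "Hh ?N (0, q) \<bullet> b = 0" for b
      using symm[of ?N "(0, q)" b] last[of b] by (simp add: inner_prod_def)
    then have "Hh ?N (0, q) = 0" by (metis inner_eq_zero_iff)
    then show ?thesis
      using linear_add[OF H[of ?N], of "(p, 0)" "(0, q)"] last[of "(p, 0)"] by (simp add: prod_eq_iff)
  qed
  have D: "jacA P k (fst (w k)) p + jacB P k (fst (w k)) q = dynD P (fst \<circ> w) k (p, q)" if "k < ?N" for k p q
    using linear_add[OF linear_dynD[OF P that, where z="fst \<circ> w"], of "(p, 0)" "(0, q)"]
    by (simp add: jacA_def jacB_def dynD_def)
  have 1: "(\<Sum>k<?N. 1 / 2 * (fst (v k) \<bullet> Hh k (fst (v k))) + fst (fst (gradL P w k)) \<bullet> fst (fst (v k))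
        + snd (fst (gradL P w k)) \<bullet> snd (fst (v k)))
      + 1 / 2 * (fst (fst (v ?N)) \<bullet> fst (Hh ?N (fst (fst (v ?N)), 0))) + fst (fst (gradL P w ?N)) \<bullet> fst (fst (v ?N))
    = (\<Sum>k\<le>hor P. 1 / 2 * (fst (v k) \<bullet> Hh k (fst (v k))) + fst (gradL P w k) \<bullet> fst (v k))"
    using HN[of "fst (fst (v ?N))" "snd (fst (v ?N))"]
    by (simp add: sum_lessThan_atMost_split snd_gradL_last[OF P]
        inner_prod_def[of "fst (v ?N)"] inner_prod_def[of "fst (gradL P w _)"] add_ac)
  have 2: "snd (v 0) \<bullet> (fst (fst (v 0)) - (xinit P - fst (fst (w 0))))
      + (\<Sum>k<?N. snd (v (Suc k)) \<bullet> (fst (fst (v (Suc k))) - jacA P k (fst (w k)) (fst (fst (v k)))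
          - jacB P k (fst (w k)) (snd (fst (v k))) + snd (gradL P w (Suc k))))
    = (\<Sum>k\<le>?N. snd (v k) \<bullet> (gop ?N (dynD P (fst \<circ> w)) (fst \<circ> v) k + snd (gradL P w k)))"
  proof -
    have e: "xinit P - fst (fst (w 0)) = - snd (gradL P w 0)" by (simp add: gradL_eq[OF P] constr_def)
    show ?thesis unfolding e
      by (simp add: sum.atMost_shift gop_def D diff_diff_eq algebra_simps)
  qed
  show ?thesis
    unfolding 1[symmetric] 2[symmetric] qp_lagr_def Let_def
    by (simp add: term_hess_def atLeast0LessThan)
qed

lemma sderiv_qp_lagr:
  fixes P :: "('x::euclidean_space, 'u::euclidean_space) ndp"
  assumes P: "smooth_ndp P" and S: "block_symmetric (hor P) Hh"
  shows "has_sderiv (qp_lagr P \<mu> w Hh 0 (hor P)) (binner {..hor P} (\<lambda>k. kkt P w Hh v k + gradL P w k)) v"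
proof -
  note H = block_symmetricD(1)[OF S] and symm = block_symmetricD(2)[OF S] and last = block_symmetricD(3)[OF S]
  let ?N = "hor P" and ?D = "dynD P (fst \<circ> w)" and ?g = "gradL P w"
  have z: "has_sderiv (\<lambda>v. fst (v k)) (\<lambda>d. fst (d k)) v" for k and v :: "('x, 'u) pd" by (intro sderiv_fst sderiv_coord)
  have Hz: "has_sderiv (\<lambda>v. Hh k (fst (v k))) (\<lambda>d. Hh k (fst (d k))) v" if "k \<in> {..?N}" for k
    by (rule sderiv_bounded_linear[OF _ z]) (use H that in \<open>simp add: linear_conv_bounded_linear\<close>)
  have gp: "has_sderiv (\<lambda>z. gop ?N ?D z k) (\<lambda>d. gop ?N ?D d k) (fst \<circ> v)" for k
  proof -
    have "linear (\<lambda>h. gop ?N ?D ((\<lambda>_. 0)(j := h)) k)" for j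
      by (rule sderiv_linear[OF sderiv_constr[OF P]])
    then have d: "((\<lambda>h. gop ?N ?D ((\<lambda>_. 0)(j := h)) k) has_derivative (\<lambda>h. gop ?N ?D ((\<lambda>_. 0)(j := h)) k)) (at x)" for j x
      by (simp add: linear_imp_has_derivative)
    \<comment> \<open>As a function of one block the operator is affine: the vector with that block
      cleared gives the constant, the single-block vector the linear part.\<close>
    have "gop ?N ?D ((fst \<circ> v)(j := x)) k = gop ?N ?D ((fst \<circ> v)(j := 0)) k + gop ?N ?D ((\<lambda>_. 0)(j := x)) k" for j x
    proof -
      have "(fst \<circ> v)(j := x) = (\<lambda>i. ((fst \<circ> v)(j := 0)) i + ((\<lambda>_. 0)(j := x)) i)" by auto
      then show ?thesis using gop_dynD_add[OF P] by metis
    qed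
    then have e: "(\<lambda>x. gop ?N ?D ((fst \<circ> v)(j := x)) k)
        = (\<lambda>x. gop ?N ?D ((fst \<circ> v)(j := 0)) k + gop ?N ?D ((\<lambda>_. 0)(j := x)) k)" for j
      by (rule ext)
    show ?thesis unfolding has_sderiv_def
    proof
      fix j
      show "((\<lambda>x. gop ?N ?D ((fst \<circ> v)(j := x)) k) has_derivative (\<lambda>h. gop ?N ?D ((\<lambda>_. 0)(j := h)) k)) (at ((fst \<circ> v) j))"
        using has_derivative_add[OF has_derivative_const d] by (subst e) simp
    qed
  qed
  have "has_sderiv (qp_lagr P \<mu> w Hh 0 ?N) (\<lambda>d.
      (\<Sum>k\<le>?N. 1 / 2 * (fst (v k) \<bullet> Hh k (fst (d k)) + fst (d k) \<bullet> Hh k (fst (v k))) + (fst (?g k) \<bullet> fst (d k) + 0 \<bullet> fst (v k)))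
      + (\<Sum>k\<le>?N. snd (v k) \<bullet> (gop ?N ?D (fst \<circ> d) k + 0) + snd (d k) \<bullet> (gop ?N ?D (fst \<circ> v) k + snd (?g k)))) v"
    unfolding qp_lagr_full_window[OF assms, abs_def]
    by (intro sderiv_add sderiv_sum sderiv_inner sderiv_cmult z Hz sderiv_const sderiv_snd sderiv_coord sderiv_comp_fst gp)
  moreover have "(\<Sum>k\<le>?N. 1 / 2 * (fst (v k) \<bullet> Hh k (fst (d k)) + fst (d k) \<bullet> Hh k (fst (v k))) + (fst (?g k) \<bullet> fst (d k) + 0 \<bullet> fst (v k)))
      + (\<Sum>k\<le>?N. snd (v k) \<bullet> (gop ?N ?D (fst \<circ> d) k + 0) + snd (d k) \<bullet> (gop ?N ?D (fst \<circ> v) k + snd (?g k)))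
    = binner {..?N} (\<lambda>k. kkt P w Hh v k + ?g k) d" for d :: "('x, 'u) pd"
  proof -
    have 1: "(\<Sum>k\<le>?N. 1 / 2 * (fst (v k) \<bullet> Hh k (fst (d k)) + fst (d k) \<bullet> Hh k (fst (v k))) + (fst (?g k) \<bullet> fst (d k) + 0 \<bullet> fst (v k)))
      = binner {..?N} (blkdiag ?N Hh (fst \<circ> v)) (fst \<circ> d) + binner {..?N} (fst \<circ> ?g) (fst \<circ> d)"
      unfolding binner_def sum.distrib[symmetric]
    proof (rule sum.cong[OF refl])
      fix k assume "k \<in> {..?N}"
      then have "fst (v k) \<bullet> Hh k (fst (d k)) = Hh k (fst (v k)) \<bullet> fst (d k)" by (simp add: symm)
      then show "1 / 2 * (fst (v k) \<bullet> Hh k (fst (d k)) + fst (d k) \<bullet> Hh k (fst (v k))) + (fst (?g k) \<bullet> fst (d k) + 0 \<bullet> fst (v k))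
          = blkdiag ?N Hh (fst \<circ> v) k \<bullet> (fst \<circ> d) k + (fst \<circ> ?g) k \<bullet> (fst \<circ> d) k"
        using \<open>k \<in> {..?N}\<close> inner_commute[of "fst (d k)" "Hh k (fst (v k))"] by (simp add: blkdiag_def)
    qed
    have 2: "(\<Sum>k\<le>?N. snd (v k) \<bullet> gop ?N ?D (fst \<circ> d) k) = binner {..?N} (gopT ?N ?D (snd \<circ> v)) (fst \<circ> d)"
      using gop_adjoint[where D="?D" and N="?N" and y="snd \<circ> v" and v="fst \<circ> d"] linear_dynD[OF P] by (simp add: binner_def)
    show ?thesis
      unfolding 1 unfolding sum.distrib add_0_right 2
      unfolding binner_def sum.distrib[symmetric]
      by (rule sum.cong[OF refl])
        (simp add: inner_prod_def[of _ "d _"] kkt_def jacG_eq[OF P] jacGT_eq[OF P]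
          inner_add_left inner_commute[of "snd (d _)"])
  qed
  ultimately show ?thesis by (simp only:)
qed

text \<open>A local solve on the full window is thus an inexact solve of the global Newton system,
  with its residual measured against the norm of \<open>gradL\<close> itself.\<close>

lemma
  fixes P :: "('x::euclidean_space, 'u::euclidean_space) ndp"
  assumes P: "smooth_ndp P" and S: "block_symmetric (hor P) Hh"
    and k: "k \<le> hor P"
  shows qp_grad_full_window: "qp_grad P \<mu> w Hh 0 (hor P) k = gradL P w k"
    and qp_kkt_full_window: "qp_kkt P \<mu> w Hh 0 (hor P) v k = kkt P w Hh v k"
proof -
  note H = block_symmetricD(1)[OF S] and symm = block_symmetricD(2)[OF S] and last = block_symmetricD(3)[OF S]
  let ?N = "hor P"
  have b: "bgrad (qp_lagr P \<mu> w Hh 0 ?N) v = (\<lambda>k. if k \<le> ?N then kkt P w Hh v k + gradL P w k else 0)" for v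
    by (rule bgrad_eqI[OF sderiv_qp_lagr[OF P S]])
  have k0: "kkt P w Hh (\<lambda>_. 0) k = 0"
    using kkt_scaleR[of P Hh w 0 "\<lambda>_. 0", OF P S] by simp
  then show "qp_grad P \<mu> w Hh 0 ?N k = gradL P w k"
    using k by (simp add: qp_grad_def b)
  have lin: "linear (\<lambda>h. kkt P w Hh ((\<lambda>_. 0)(j := h)) k)" for j
  proof (rule linearI)
    fix x y :: "('x \<times> 'u) \<times> 'x"
    have e: "((\<lambda>_. 0)(j := x + y)) = (\<lambda>i. ((\<lambda>_. 0)(j := x)) i + ((\<lambda>_. 0)(j := y)) i)" by (simp add: fun_eq_iff)
    show "kkt P w Hh ((\<lambda>_. 0)(j := x + y)) k = kkt P w Hh ((\<lambda>_. 0)(j := x)) k + kkt P w Hh ((\<lambda>_. 0)(j := y)) k"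
      by (simp only: e kkt_add[OF P S])
  next
    fix r and x :: "('x \<times> 'u) \<times> 'x"
    have e: "((\<lambda>_. 0)(j := r *\<^sub>R x)) = (\<lambda>i. r *\<^sub>R ((\<lambda>_. 0)(j := x)) i)" by (simp add: fun_eq_iff)
    show "kkt P w Hh ((\<lambda>_. 0)(j := r *\<^sub>R x)) k = r *\<^sub>R kkt P w Hh ((\<lambda>_. 0)(j := x)) k"
      by (simp only: e kkt_scaleR[OF P S])
  qed
  have "has_sderiv (\<lambda>v. bgrad (qp_lagr P \<mu> w Hh 0 ?N) v k) (\<lambda>d. kkt P w Hh d k) (\<lambda>_. 0)"
    unfolding has_sderiv_def b using k
    by (auto intro!: has_derivative_add[where g'="\<lambda>_. 0", simplified] linear_imp_has_derivative lin simp del: fun_upd_apply)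
  then have "qp_kkt P \<mu> w Hh 0 ?N v k = (\<Sum>j\<le>?N. kkt P w Hh ((\<lambda>_. 0)(j := v j)) k)"
    using k by (simp add: qp_kkt_def jac_def jblock_eqI del: fun_upd_apply)
  also have "\<dots> = kkt P w Hh v k"
    by (rule sum_single_blocks)
      (auto simp: kkt_add[OF P S] intro: fun_cong[OF kkt_cong[OF P]])
  finally show "qp_kkt P \<mu> w Hh 0 ?N v k = kkt P w Hh v k" .
qed

section \<open>Uniform bounds for KKT operators\<close>

text \<open>The constants depend on the horizon \<open>N\<close>; this is harmless because \<open>N\<close> is fixed.\<close>

lemma quadratic_bound:
  fixes x A B \<sigma> \<gamma> :: real
  assumes \<gamma>: "0 < \<gamma>" and nonneg: "0 \<le> x" "0 \<le> \<sigma>" "0 \<le> B"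
    and le: "\<gamma> / 4 * x\<^sup>2 \<le> A * \<sigma> * x + B * \<sigma>\<^sup>2"
  shows "x \<le> (1 + 8 / \<gamma> * (2 * A\<^sup>2 / \<gamma> + B)) * \<sigma>"
proof -
  define K where "K = 8 / \<gamma> * (2 * A\<^sup>2 / \<gamma> + B)"
  have K: "0 \<le> K" using \<gamma> nonneg by (simp add: K_def)
  \<comment> \<open>Completing the square trades half of the quadratic term for the mixed term,
    leaving \<open>\<gamma> / 8\<close> in front of the square of \<open>x\<close>.\<close>
  have "0 \<le> (\<gamma> * x - 4 * (A * \<sigma>))\<^sup>2 / (8 * \<gamma>)" using \<gamma> by simp
  also have "\<dots> = \<gamma> / 8 * x\<^sup>2 - A * \<sigma> * x + 2 * A\<^sup>2 / \<gamma> * \<sigma>\<^sup>2"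
    using \<gamma> by (simp add: field_simps power2_eq_square)
  finally have "\<gamma> / 8 * x\<^sup>2 \<le> (2 * A\<^sup>2 / \<gamma> + B) * \<sigma>\<^sup>2"
    using le by (simp add: distrib_right)
  from mult_left_mono[OF this, of "8 / \<gamma>"]
  have "8 / \<gamma> * (\<gamma> / 8 * x\<^sup>2) \<le> K * \<sigma>\<^sup>2" using \<gamma> by (simp only: K_def mult.assoc) simp
  then have "x\<^sup>2 \<le> K * \<sigma>\<^sup>2" using \<gamma> by simp
  also have "\<dots> \<le> ((1 + K) * \<sigma>)\<^sup>2"
  proof -
    \<comment> \<open>The crude \<open>1 + K\<close> in place of the root of \<open>K\<close> keeps
      the constant free of square roots.\<close>
    have "K \<le> (1 + K)\<^sup>2" using K by (simp add: power2_sum)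
    then show ?thesis unfolding power_mult_distrib by (rule mult_right_mono) simp
  qed
  finally have "x \<le> (1 + K) * \<sigma>" by (rule power2_le_imp_le) (use K nonneg in simp)
  then show ?thesis by (simp only: K_def)
qed

text \<open>The saddle-point system of one iterate, reduced to the data that enter the estimates.
  All constants derived here are functions of \<open>N\<close>, \<open>L\<close> and
  \<open>\<gamma>\<close> alone, which makes them uniform over the run.\<close>

locale kkt_system =
  fixes N :: nat and D :: "nat \<Rightarrow> 'x::euclidean_space \<times> 'u::euclidean_space \<Rightarrow> 'x"
    and Hh :: "nat \<Rightarrow> 'x \<times> 'u \<Rightarrow> 'x \<times> 'u" and L \<gamma> :: real
  assumes D_lin: "\<And>k. k < N \<Longrightarrow> linear (D k)" and D_bound: "\<And>k v. k < N \<Longrightarrow> norm (D k v) \<le> L * norm v"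
    and H_lin: "\<And>k. k \<le> N \<Longrightarrow> linear (Hh k)" and H_sym: "\<And>k a b. k \<le> N \<Longrightarrow> Hh k a \<bullet> b = a \<bullet> Hh k b"
    and H_bound: "\<And>k v. k \<le> N \<Longrightarrow> norm (Hh k v) \<le> L * norm v"
    and L: "1 \<le> L" and \<gamma>: "0 < \<gamma>"
    and coercive: "\<And>u. u \<in> primal_space 0 N \<Longrightarrow> gop N D u = (\<lambda>_. 0) \<Longrightarrow>
      \<gamma> * (bnorm {..N} u)\<^sup>2 \<le> binner {..N} u (blkdiag N Hh u)"

text \<open>The state of the free trajectory grows by at most the factor \<open>L + 1\<close> per
  stage; \<open>1 + real N\<close> counts the stages.\<close>

definition rinv_const :: "nat \<Rightarrow> real \<Rightarrow> real" where
  "rinv_const N L = (1 + real N) * (L + 1) ^ N"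

definition op_const :: "nat \<Rightarrow> real \<Rightarrow> real" where
  "op_const N L = (1 + real N) * (L + 1)"

text \<open>In \<open>garding\<close> the bracket is the cost per squared norm of the non-kernel
  part of the vector; the squared \<open>rinv_const\<close> bounds that part by the image under
  \<open>G\<close>.\<close>

definition garding_const :: "nat \<Rightarrow> real \<Rightarrow> real \<Rightarrow> real" where
  "garding_const N L \<gamma> = (rinv_const N L)\<^sup>2 * (\<gamma> / 2 + 2 * (op_const N L)\<^sup>2 / \<gamma> + op_const N L)"

text \<open>The states of the trajectory with zero controls and defects \<open>y\<close>.\<close>

primrec free_traj :: "(nat \<Rightarrow> 'x \<times> 'u::zero \<Rightarrow> 'x) \<Rightarrow> (nat \<Rightarrow> 'x) \<Rightarrow> nat \<Rightarrow> 'x::plus" where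
  "free_traj D y 0 = y 0"
| "free_traj D y (Suc k) = D k (free_traj D y k, 0) + y (Suc k)"

context kkt_system
begin

abbreviation "\<rho> \<equiv> rinv_const N L"
abbreviation "\<kappa> \<equiv> op_const N L"
abbreviation "C1 \<equiv> garding_const N L \<gamma>"
abbreviation "nrm \<equiv> bnorm {..N}"

lemma const_ge: "1 \<le> \<rho>" "1 \<le> \<kappa>" "0 \<le> C1"
proof -
  have "1 * 1 \<le> (real N + 1) * (L + 1) ^ N" using L by (intro mult_mono) auto
  then show "1 \<le> \<rho>" by (simp add: rinv_const_def add.commute)
  have "1 * 1 \<le> (real N + 1) * (L + 1)" using L by (intro mult_mono) auto
  then show "1 \<le> \<kappa>" by (simp add: op_const_def add.commute)
  then show "0 \<le> C1" using \<gamma> by (simp add: garding_const_def)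
qed

lemma free_traj_bound:
  assumes "k \<le> N"
  shows "norm (free_traj D y k) \<le> (L + 1) ^ k * nrm y"
  using assms
proof (induction k)
  case 0
  then show ?case by (simp add: norm_le_bnorm)
next
  case (Suc k)
  have "norm (free_traj D y (Suc k)) \<le> norm (D k (free_traj D y k, 0)) + norm (y (Suc k))"
    by (simp add: norm_triangle_ineq)
  also have "norm (D k (free_traj D y k, 0)) \<le> L * norm (free_traj D y k)"
    using D_bound[of k "(free_traj D y k, 0)"] Suc by (simp add: norm_Pair)
  also have "norm (free_traj D y k) \<le> (L + 1) ^ k * nrm y" using Suc by simp
  also have "norm (y (Suc k)) \<le> (L + 1) ^ k * nrm y"
    using norm_le_bnorm[of "{..N}" "Suc k" y] Suc.prems L
      mult_right_mono[of 1 "(L + 1) ^ k" "nrm y"] by simp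
  finally show ?case using L by (simp add: algebra_simps)
qed

lemma right_inverse:
  obtains v where "v \<in> primal_space 0 N" "\<And>k. k \<le> N \<Longrightarrow> gop N D v k = y k" "nrm v \<le> \<rho> * nrm y"
proof
  let ?v = "\<lambda>k. if k \<le> N then (free_traj D y k, 0) else (0, 0)"
  show "?v \<in> primal_space 0 N" by (auto simp: primal_space_def)
  show "gop N D ?v k = y k" if "k \<le> N" for k using that by (cases k) (auto simp: gop_def)
  have "norm (?v k) \<le> (L + 1) ^ N * nrm y" if "k \<in> {..N}" for k
  proof -
    have "(L + 1) ^ k * nrm y \<le> (L + 1) ^ N * nrm y"
      using that L by (intro mult_right_mono power_increasing) auto
    then show ?thesis using free_traj_bound[of k y] that by (simp add: norm_Pair)
  qed
  from bnorm_le_card[where K="{..N}" and v="?v", OF this] show "nrm ?v \<le> \<rho> * nrm y" by (simp add: rinv_const_def mult.assoc)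
qed

text \<open>Duality: pairing \<open>y\<close> with \<open>G v\<close> for a bounded preimage
  \<open>v\<close> of \<open>y\<close> shows that a bounded right inverse of \<open>G\<close> bounds
  the transpose from below.\<close>

lemma gopT_lower: "nrm y \<le> \<rho> * nrm (gopT N D y)"
proof -
  obtain v where v: "\<And>k. k \<le> N \<Longrightarrow> gop N D v k = y k" "nrm v \<le> \<rho> * nrm y"
    using right_inverse by blast
  have "(nrm y)\<^sup>2 = binner {..N} y (gop N D v)"
    unfolding bnorm_sq by (rule binner_cong) (auto simp: v)
  also have "\<dots> = binner {..N} (gopT N D y) v" by (rule gop_adjoint[OF D_lin])
  also have "\<dots> \<le> nrm (gopT N D y) * nrm v" using binner_le_bnorm[of "{..N}" "gopT N D y" v] by simp
  also have "\<dots> \<le> nrm (gopT N D y) * (\<rho> * nrm y)" by (intro mult_left_mono v) simp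
  finally have "nrm y * nrm y \<le> nrm y * (\<rho> * nrm (gopT N D y))" by (simp add: power2_eq_square mult_ac)
  then show ?thesis using const_ge(1)
    by (cases "nrm y = 0") (auto simp: mult_le_cancel_left less_le)
qed

lemma gop_upper: "nrm (gop N D v) \<le> \<kappa> * nrm v"
proof -
  have "norm (gop N D v k) \<le> (L + 1) * nrm v" if "k \<in> {..N}" for k
  proof -
    have "norm (gop N D v k) \<le> norm (fst (v k)) + norm (if k = 0 then 0 else D (k - 1) (v (k - 1)))"
      using that norm_triangle_ineq4[of "fst (v k)" "if k = 0 then 0 else D (k - 1) (v (k - 1))"] by (simp add: gop_def)
    also have "norm (fst (v k)) \<le> nrm v"
      using norm_fst_le[of "fst (v k)" "snd (v k)"] norm_le_bnorm[of "{..N}" k v] that by (simp add: order_trans)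
    also have "norm (if k = 0 then 0 else D (k - 1) (v (k - 1))) \<le> L * nrm v"
    proof (cases "k = 0")
      case False
      then have "norm (D (k - 1) (v (k - 1))) \<le> L * norm (v (k - 1))" using that by (intro D_bound) auto
      also have "\<dots> \<le> L * nrm v" using that L by (intro mult_left_mono norm_le_bnorm) auto
      finally show ?thesis using False by simp
    qed (use L in simp)
    finally show ?thesis by (simp add: algebra_simps)
  qed
  from bnorm_le_card[where K="{..N}" and v="gop N D v", OF this] show ?thesis by (simp add: op_const_def mult.assoc)
qed

lemma gopT_upper: "nrm (gopT N D y) \<le> \<kappa> * nrm y"
proof -
  let ?t = "gopT N D y"
  have "nrm ?t * nrm ?t = binner {..N} y (gop N D ?t)"
    using gop_adjoint[OF D_lin, where N=N and y=y and v="?t"] by (simp add: bnorm_sq flip: power2_eq_square)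
  also have "\<dots> \<le> nrm y * nrm (gop N D ?t)" using binner_le_bnorm[of "{..N}" y "gop N D ?t"] by simp
  also have "\<dots> \<le> nrm y * (\<kappa> * nrm ?t)" by (intro mult_left_mono gop_upper) simp
  finally have "nrm ?t * nrm ?t \<le> nrm ?t * (\<kappa> * nrm y)" by (simp add: mult_ac)
  then show ?thesis using const_ge
    by (cases "nrm ?t = 0") (auto simp: mult_le_cancel_left less_le)
qed

lemma H_upper: "nrm (blkdiag N Hh v) \<le> \<kappa> * nrm v"
proof -
  have "norm (blkdiag N Hh v k) \<le> (L + 1) * nrm v" if "k \<in> {..N}" for k
  proof -
    have "norm (blkdiag N Hh v k) \<le> L * norm (v k)" using that by (simp add: blkdiag_def H_bound)
    also have "\<dots> \<le> (L + 1) * nrm v" using that L by (intro mult_mono norm_le_bnorm) auto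
    finally show ?thesis .
  qed
  from bnorm_le_card[where K="{..N}" and v="blkdiag N Hh v", OF this] show ?thesis by (simp add: op_const_def mult.assoc)
qed

text \<open>Split \<open>a\<close> into a kernel part and a part controlled by \<open>G a\<close>.\<close>

lemma garding:
  assumes a: "a \<in> primal_space 0 N"
  shows "\<gamma> / 4 * (nrm a)\<^sup>2 - C1 * (nrm (gop N D a))\<^sup>2 \<le> binner {..N} a (blkdiag N Hh a)"
proof -
  obtain v where v: "v \<in> primal_space 0 N" "\<And>k. k \<le> N \<Longrightarrow> gop N D v k = gop N D a k"
    "nrm v \<le> \<rho> * nrm (gop N D a)" using right_inverse by blast
  define u where "u = (\<lambda>k. a k - v k)"
  have a_eq: "a = (\<lambda>k. u k + v k)" by (simp add: u_def)
  have "u \<in> primal_space 0 N" using a v(1) by (auto simp: u_def primal_space_def zero_prod_def)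
  moreover have "gop N D u = (\<lambda>_. 0)"
  proof
    fix k
    have "gop N D a k = gop N D u k + gop N D v k" unfolding a_eq by (simp only: gop_add[of N D, OF D_lin])
    then show "gop N D u k = 0"
      using v(2)[of k] by (cases "k \<le> N") (simp, simp add: gop_def)
  qed
  ultimately have co: "\<gamma> * (nrm u)\<^sup>2 \<le> binner {..N} u (blkdiag N Hh u)" by (rule coercive)
  have sym: "binner {..N} v (blkdiag N Hh u) = binner {..N} u (blkdiag N Hh v)"
    unfolding binner_def by (rule sum.cong[OF refl]) (metis H_sym atMost_iff blkdiag_def inner_commute)
  have blk: "blkdiag N Hh a = (\<lambda>k. blkdiag N Hh u k + blkdiag N Hh v k)"
    unfolding a_eq by (rule blkdiag_add[OF H_lin])
  have "binner {..N} a (blkdiag N Hh a) = binner {..N} u (blkdiag N Hh u)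
      + 2 * binner {..N} u (blkdiag N Hh v) + binner {..N} v (blkdiag N Hh v)"
    unfolding blk binner_add_right by (simp add: a_eq binner_add_left sym)
  moreover have "\<bar>binner {..N} z (blkdiag N Hh v)\<bar> \<le> \<kappa> * nrm z * nrm v" for z
  proof -
    have "\<bar>binner {..N} z (blkdiag N Hh v)\<bar> \<le> nrm z * nrm (blkdiag N Hh v)" by (rule binner_le_bnorm)
    also have "\<dots> \<le> nrm z * (\<kappa> * nrm v)" by (intro mult_left_mono H_upper) simp
    finally show ?thesis by (simp only: mult_ac)
  qed
  note this[of u] this[of v]
  ultimately have 1: "binner {..N} a (blkdiag N Hh a) \<ge> \<gamma> * (nrm u)\<^sup>2 - 2 * (\<kappa> * nrm u * nrm v) - \<kappa> * (nrm v)\<^sup>2"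
    using co unfolding power2_eq_square mult.assoc by linarith
  \<comment> \<open>The weight in Young's inequality keeps half of the kernel coercivity. The bound
    \<open>3\<close> on the squared norm of the sum costs another factor two, whence
    \<open>\<gamma> / 4\<close> in the result.\<close>
  have 2: "2 * (\<kappa> * nrm u * nrm v) \<le> \<gamma> / 2 * (nrm u)\<^sup>2 + 2 * \<kappa>\<^sup>2 / \<gamma> * (nrm v)\<^sup>2"
  proof -
    have "0 \<le> (\<gamma> * nrm u - 2 * \<kappa> * nrm v)\<^sup>2 / (2 * \<gamma>)" using \<gamma> by simp
    also have "\<dots> = \<gamma> / 2 * (nrm u)\<^sup>2 - 2 * (\<kappa> * nrm u * nrm v) + 2 * \<kappa>\<^sup>2 / \<gamma> * (nrm v)\<^sup>2"
      using \<gamma> by (simp add: field_simps power2_eq_square)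
    finally show ?thesis by simp
  qed
  have 3: "(nrm a)\<^sup>2 \<le> 2 * (nrm u)\<^sup>2 + 2 * (nrm v)\<^sup>2"
  proof -
    have "nrm a \<le> nrm u + nrm v" unfolding a_eq by (rule bnorm_triangle)
    then have "(nrm a)\<^sup>2 \<le> (nrm u + nrm v)\<^sup>2" by (intro power_mono) auto
    also have "\<dots> \<le> 2 * (nrm u)\<^sup>2 + 2 * (nrm v)\<^sup>2"
      using sum_squares_ge_zero[of "nrm u - nrm v" 0] by (simp add: power2_eq_square algebra_simps)
    finally show ?thesis .
  qed
  have 4: "(\<gamma> / 2 + 2 * \<kappa>\<^sup>2 / \<gamma> + \<kappa>) * (nrm v)\<^sup>2 \<le> C1 * (nrm (gop N D a))\<^sup>2"
  proof -
    have "(nrm v)\<^sup>2 \<le> (\<rho> * nrm (gop N D a))\<^sup>2" by (intro power_mono v) simp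
    then have "(\<gamma> / 2 + 2 * \<kappa>\<^sup>2 / \<gamma> + \<kappa>) * (nrm v)\<^sup>2 \<le> (\<gamma> / 2 + 2 * \<kappa>\<^sup>2 / \<gamma> + \<kappa>) * (\<rho> * nrm (gop N D a))\<^sup>2"
      using \<gamma> const_ge(2) by (intro mult_left_mono) auto
    then show ?thesis by (simp add: garding_const_def power_mult_distrib mult_ac)
  qed
  have "\<gamma> / 4 * (nrm a)\<^sup>2 \<le> \<gamma> / 2 * (nrm u)\<^sup>2 + \<gamma> / 2 * (nrm v)\<^sup>2"
    using mult_left_mono[OF 3, of "\<gamma> / 4"] \<gamma> by (simp add: distrib_left)
  with 1 2 4[unfolded distrib_right] show ?thesis by linarith
qed

definition Kop :: "(nat \<Rightarrow> ('x \<times> 'u) \<times> 'x) \<Rightarrow> nat \<Rightarrow> ('x \<times> 'u) \<times> 'x" where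
  "Kop d k = (blkdiag N Hh (fst \<circ> d) k + gopT N D (snd \<circ> d) k, gop N D (fst \<circ> d) k)"

lemma Kop_upper: "nrm (Kop d) \<le> 3 * \<kappa> * nrm d"
proof -
  let ?a = "fst \<circ> d" and ?b = "snd \<circ> d"
  have "nrm (Kop d) \<le> nrm (fst \<circ> Kop d) + nrm (snd \<circ> Kop d)" by (rule bnorm_Pair_le)
  also have "fst \<circ> Kop d = (\<lambda>k. blkdiag N Hh ?a k + gopT N D ?b k)" by (simp add: Kop_def fun_eq_iff)
  also have "nrm \<dots> \<le> nrm (blkdiag N Hh ?a) + nrm (gopT N D ?b)" by (rule bnorm_triangle)
  also have "snd \<circ> Kop d = gop N D ?a" by (simp add: Kop_def fun_eq_iff)
  also have "nrm (blkdiag N Hh ?a) + nrm (gopT N D ?b) + nrm (gop N D ?a) \<le> \<kappa> * nrm d + \<kappa> * nrm d + \<kappa> * nrm d"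
    using const_ge(2)
    by (intro add_mono order_trans[OF H_upper] order_trans[OF gopT_upper] order_trans[OF gop_upper]
        mult_left_mono bnorm_fst_le bnorm_snd_le) auto
  finally show ?thesis by simp
qed

text \<open>Testing the first block row with \<open>a\<close> eliminates \<open>b\<close> up to the product \<open>b \<bullet> G a\<close>.\<close>

lemma test_primal:
  "binner {..N} a (\<lambda>k. blkdiag N Hh a k + gopT N D b k) = binner {..N} a (blkdiag N Hh a) + binner {..N} b (gop N D a)"
  by (simp add: binner_add_right gop_adjoint[of N D, OF D_lin] binner_commute[of _ a "gopT N D b"])

text \<open>Once \<open>a\<close> is known, the first block row gives the transpose of
  \<open>G\<close> applied to \<open>b\<close>, and \<open>gopT_lower\<close> recovers
  \<open>b\<close> from it.\<close>

lemma dual_bound: "nrm b \<le> \<rho> * (nrm (\<lambda>k. blkdiag N Hh a k + gopT N D b k) + \<kappa> * nrm a)"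
proof -
  have "nrm (gopT N D b) = nrm (\<lambda>k. (blkdiag N Hh a k + gopT N D b k) - blkdiag N Hh a k)" by simp
  also have "\<dots> \<le> nrm (\<lambda>k. blkdiag N Hh a k + gopT N D b k) + nrm (blkdiag N Hh a)" by (rule bnorm_triangle_diff)
  also have "nrm (blkdiag N Hh a) \<le> \<kappa> * nrm a" by (rule H_upper)
  finally have "\<rho> * nrm (gopT N D b) \<le> \<rho> * (nrm (\<lambda>k. blkdiag N Hh a k + gopT N D b k) + \<kappa> * nrm a)"
    using const_ge(1) by (intro mult_left_mono) auto
  with gopT_lower[of b] show ?thesis by simp
qed

text \<open>The constant of \<open>quadratic_bound\<close> for
  \<open>A = 1 + \<rho> * \<kappa>\<close> and \<open>B = \<rho> + C1\<close>.\<close>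

abbreviation "K0 \<equiv> 1 + 8 / \<gamma> * (2 * (1 + \<rho> * \<kappa>)\<^sup>2 / \<gamma> + \<rho> + C1)"

text \<open>Energy estimate for a saddle-point system: the first row is tested with the primal part,
  \<open>garding\<close> turns the second row into coercivity, and \<open>dual_bound\<close>
  replaces the multiplier. What remains is a quadratic inequality for the primal norm against the
  sum of the two row norms.\<close>

lemma Kop_lower:
  assumes d: "fst \<circ> d \<in> primal_space 0 N"
  shows "nrm d \<le> (K0 + \<rho> * (1 + \<kappa> * K0)) * (2 * nrm (Kop d))"
proof -
  let ?a = "fst \<circ> d" and ?b = "snd \<circ> d"
  define sz where "sz = (\<lambda>k. blkdiag N Hh ?a k + gopT N D ?b k)"
  define sl where "sl = gop N D ?a"
  define \<sigma> where "\<sigma> = nrm sz + nrm sl"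
  define x where "x = nrm ?a"
  define y where "y = nrm ?b"
  have \<sigma>: "0 \<le> \<sigma>" "nrm sz \<le> \<sigma>" "nrm sl \<le> \<sigma>" by (simp_all add: \<sigma>_def)
  have xy: "0 \<le> x" "0 \<le> y" by (simp_all add: x_def y_def)
  have K: "fst \<circ> Kop d = sz" "snd \<circ> Kop d = sl" by (simp_all add: Kop_def fun_eq_iff sz_def sl_def)
  have K0: "1 \<le> K0" using \<gamma> const_ge by simp
  have "y \<le> \<rho> * (nrm sz + \<kappa> * x)" unfolding sz_def x_def y_def by (rule dual_bound)
  also have "\<dots> \<le> \<rho> * (\<sigma> + \<kappa> * x)" using const_ge(1) \<sigma> by (intro mult_left_mono) auto
  finally have yb: "y \<le> \<rho> * (\<sigma> + \<kappa> * x)" .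
  have "binner {..N} ?a (blkdiag N Hh ?a) = binner {..N} ?a sz - binner {..N} ?b sl"
    unfolding sz_def sl_def test_primal by simp
  also have "\<dots> \<le> x * nrm sz + y * nrm sl"
    unfolding x_def y_def using binner_le_bnorm[of "{..N}" ?a sz] binner_le_bnorm[of "{..N}" ?b sl] by linarith
  also have "\<dots> \<le> x * \<sigma> + \<rho> * (\<sigma> + \<kappa> * x) * \<sigma>"
    using \<sigma> xy by (intro add_mono mult_mono yb order_trans[OF xy(2) yb]) auto
  finally have "\<gamma> / 4 * x\<^sup>2 \<le> x * \<sigma> + \<rho> * (\<sigma> + \<kappa> * x) * \<sigma> + C1 * (nrm sl)\<^sup>2"
    using garding[OF d] unfolding x_def sl_def by linarith
  also have "C1 * (nrm sl)\<^sup>2 \<le> C1 * \<sigma>\<^sup>2" using const_ge(3) \<sigma> by (intro mult_left_mono power_mono) auto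
  finally have "\<gamma> / 4 * x\<^sup>2 \<le> (1 + \<rho> * \<kappa>) * \<sigma> * x + (\<rho> + C1) * \<sigma>\<^sup>2"
    by (simp add: algebra_simps power2_eq_square)
  then have xb: "x \<le> K0 * \<sigma>"
    using quadratic_bound[where A="1 + \<rho> * \<kappa>" and B="\<rho> + C1", OF \<gamma> xy(1) \<sigma>(1)] const_ge
    unfolding add.assoc[of _ \<rho> C1] by linarith
  have "\<rho> * (\<sigma> + \<kappa> * x) \<le> \<rho> * (\<sigma> + \<kappa> * (K0 * \<sigma>))"
    using const_ge xb by (intro mult_left_mono add_left_mono) auto
  also have "\<dots> = \<rho> * (1 + \<kappa> * K0) * \<sigma>" by (simp only: distrib_left distrib_right mult_1_right mult_1_left mult.assoc)
  finally have "y \<le> \<rho> * (1 + \<kappa> * K0) * \<sigma>" using yb by linarith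
  then have "nrm d \<le> (K0 + \<rho> * (1 + \<kappa> * K0)) * \<sigma>"
    using xb bnorm_Pair_le[of "{..N}" d] unfolding x_def y_def distrib_right[of K0] by linarith
  also have "\<dots> \<le> (K0 + \<rho> * (1 + \<kappa> * K0)) * (2 * nrm (Kop d))"
    using K bnorm_fst_le[of "{..N}" "Kop d"] bnorm_snd_le[of "{..N}" "Kop d"] K0 const_ge
    by (intro mult_left_mono) (simp_all add: \<sigma>_def)
  finally show ?thesis .
qed

end

section \<open>The smallest singular value of the constraint Jacobian\<close>

lemma compact_dual_sphere:
  "compact {y :: nat \<Rightarrow> 'a::euclidean_space. y \<in> dual_space 0 N \<and> binner {..N} y y = 1}"
  (is "compact ?S")
proof -
  \<comment> \<open>Stacked vectors live in an infinite product, so compactness comes from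
    Tychonoff's theorem: blocks up to \<open>N\<close> range over unit balls, all later ones over
    \<open>{0}\<close>.\<close>
  let ?K = "PiE UNIV (\<lambda>k. if k \<le> N then cball (0::'a) 1 else {0})"
  have "compactin (product_topology (\<lambda>_. euclidean) UNIV) ?K"
    unfolding compactin_PiE by simp
  then have "compact ?K" by (simp add: euclidean_product_topology)
  moreover have "closed {y :: nat \<Rightarrow> 'a. binner {..N} y y = 1}"
    unfolding binner_def by (intro closed_Collect_eq continuous_intros) auto
  ultimately have "compact (?K \<inter> {y. binner {..N} y y = 1})" by (rule compact_Int_closed)
  moreover have "?K \<inter> {y. binner {..N} y y = 1} = ?S"
  proof (intro equalityI subsetI)
    fix y assume "y \<in> ?K \<inter> {y. binner {..N} y y = 1}"
    then have y: "\<And>k. y k \<in> (if k \<le> N then cball 0 1 else {0})" "binner {..N} y y = 1"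
      by (simp_all only: PiE_UNIV_domain Pi_iff Int_iff mem_Collect_eq) blast
    have "y k = 0" if "k \<notin> {0..N}" for k using y(1)[of k] that by simp
    with y(2) show "y \<in> ?S" by (simp add: dual_space_def)
  next
    fix y assume y: "y \<in> ?S"
    have "bnorm {..N} y = 1" using y bnorm_sq[of "{..N}" y] bnorm_nonneg[of "{..N}" y] by (simp add: power2_eq_1_iff)
    then have "norm (y k) \<le> 1" if "k \<le> N" for k using norm_le_bnorm[of "{..N}" k y] that by simp
    then show "y \<in> ?K \<inter> {y. binner {..N} y y = 1}" using y by (auto simp: dual_space_def PiE_UNIV_domain Pi_iff)
  qed
  ultimately show ?thesis by simp
qed

text \<open>First-order optimality without derivatives: at a minimum of a quadratic along a line the
  linear coefficient vanishes.\<close>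

lemma nonneg_quadratic_linear_coeff:
  fixes B Q :: real
  assumes "\<And>t. 0 \<le> 2 * t * B + t\<^sup>2 * Q"
  shows "B = 0"
proof (rule ccontr)
  assume B: "B \<noteq> 0"
  have "0 \<le> 2 * 1 * B + Q" "0 \<le> - 2 * B + Q" using assms[of 1] assms[of "-1"] by simp_all
  then have Q: "0 \<le> Q" by simp
  \<comment> \<open>At \<open>t = - (B * r)\<close> the quadratic equals the square of
    \<open>B\<close> times \<open>r * (r * Q - 2)\<close>. This is negative because
    \<open>r * Q \<le> 1\<close>; the \<open>+ 1\<close> covers \<open>Q = 0\<close>.\<close>
  define r where "r = 1 / (Q + 1)"
  have r: "0 < r" "r * Q \<le> 1" using Q by (simp_all add: r_def)
  have "2 * (- (B * r)) * B + (- (B * r))\<^sup>2 * Q = B\<^sup>2 * (r * (r * Q - 2))"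
    by (simp add: power2_eq_square algebra_simps)
  also have "\<dots> < 0" using B r by (intro mult_pos_neg) auto
  finally show False using assms[of "- (B * r)"] by simp
qed

context kkt_system
begin

text \<open>A minimizer of the Rayleigh quotient of \<open>G G\<^sup>T\<close> is an eigenvector.\<close>

lemma singular_value_exists:
  obtains s y where "0 \<le> s" "y \<in> dual_space 0 N" "y \<noteq> (\<lambda>_. 0)"
    "gop N D (gopT N D y) = (\<lambda>k. s\<^sup>2 *\<^sub>R y k)"
proof -
  let ?S = "{y :: nat \<Rightarrow> 'x. y \<in> dual_space 0 N \<and> binner {..N} y y = 1}"
  let ?f = "\<lambda>y. binner {..N} (gopT N D y) (gopT N D y)"
  have c: "continuous_on ?S (\<lambda>y. y k)" for k
    by (rule continuous_on_subset[OF continuous_on_product_coordinates]) simp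
  have "continuous_on ?S (\<lambda>y. gopT N D y k)" for k
  proof (cases "k < N")
    case True
    note bl = adjoint_linear[OF D_lin[OF True], unfolded linear_conv_bounded_linear]
    have "continuous_on ?S (\<lambda>y. (y k, 0) - adjoint (D k) (y (Suc k)))"
      by (rule continuous_on_diff[OF continuous_on_Pair[OF c continuous_on_const] bounded_linear.continuous_on[OF bl c]])
    then show ?thesis using True by (simp add: gopT_def)
  next
    case False
    have "continuous_on ?S (\<lambda>y. (y k, 0::'u))"
      by (intro continuous_on_Pair continuous_on_const c)
    then show ?thesis using False by (cases "k = N") (simp_all add: gopT_def)
  qed
  then have cont: "continuous_on ?S ?f" unfolding binner_def by (intro continuous_on_sum continuous_on_inner)
  obtain e :: 'x where e: "e \<in> Basis" using nonempty_Basis by blast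
  have "(\<lambda>_. 0)(0 := e) \<in> ?S"
    using e binner_single[of N "(\<lambda>_. 0)(0 := e)" 0 e] by (auto simp: dual_space_def inner_Basis)
  then have ne: "?S \<noteq> {}" by (rule ex_in_conv[THEN iffD1, OF exI])
  have "\<exists>y\<in>?S. \<forall>z\<in>?S. ?f y \<le> ?f z" by (rule continuous_attains_inf[OF compact_dual_sphere ne cont])
  then obtain y where y: "y \<in> ?S" and ymin: "\<forall>z\<in>?S. ?f y \<le> ?f z" by (rule bexE)
  define m where "m = ?f y"
  have m0: "0 \<le> m" by (simp add: m_def flip: bnorm_sq)
  have f_scale: "?f (\<lambda>k. c *\<^sub>R z k) = c\<^sup>2 * ?f z" for c z
    by (simp add: gopT_scaleR[of N D, OF D_lin] binner_simps power2_eq_square)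
  \<comment> \<open>Both sides are homogeneous of degree two, so minimality on the unit sphere
    extends to all dual vectors.\<close>
  have q: "m * binner {..N} z z \<le> ?f z" if z: "z \<in> dual_space 0 N" for z
  proof (cases "bnorm {..N} z = 0")
    case True
    then show ?thesis by (simp flip: bnorm_sq)
  next
    case False
    let ?c = "1 / bnorm {..N} z"
    have zz: "binner {..N} z z = bnorm {..N} z * bnorm {..N} z" by (simp add: bnorm_sq flip: power2_eq_square)
    have "(\<lambda>k. ?c *\<^sub>R z k) \<in> ?S"
      using z False by (simp add: dual_space_def binner_scaleR_left binner_scaleR_right zz)
    from bspec[OF ymin this] have "m \<le> ?c\<^sup>2 * ?f z" unfolding f_scale m_def .
    moreover have "0 < bnorm {..N} z * bnorm {..N} z" using False by (simp add: zero_less_mult_iff less_le)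
    ultimately show ?thesis unfolding zz by (simp add: pos_le_divide_eq power2_eq_square)
  qed
  \<comment> \<open>The defect in the eigenvalue equation. Perturbing the minimizer in the direction
    \<open>h\<close> itself makes the linear coefficient the squared norm of \<open>h\<close>, which
    is therefore zero.\<close>
  define h where "h = (\<lambda>k. gop N D (gopT N D y) k - m *\<^sub>R y k)"
  have hd: "h \<in> dual_space 0 N" using y by (simp add: h_def dual_space_def gop_def)
  have yd: "y \<in> dual_space 0 N" and yy: "binner {..N} y y = 1" using y by simp_all
  have cross: "binner {..N} (gopT N D y) (gopT N D h) = binner {..N} h h + m * binner {..N} y h"
  proof -
    have "binner {..N} h h = binner {..N} h (\<lambda>k. gop N D (gopT N D y) k - m *\<^sub>R y k)"
      by (rule arg_cong[OF h_def])
    then show ?thesis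
      using gop_adjoint[where N=N and D=D and y=h and v="gopT N D y", OF D_lin]
        binner_commute[of _ h y] binner_commute[of _ "gopT N D h" "gopT N D y"]
      by (simp add: binner_diff_right binner_scaleR_right)
  qed
  have "0 \<le> 2 * t * binner {..N} h h + t\<^sup>2 * (?f h - m * binner {..N} h h)" for t
  proof -
    have "(\<lambda>k. y k + t *\<^sub>R h k) \<in> dual_space 0 N" using hd yd by (simp add: dual_space_def)
    moreover have "gopT N D (\<lambda>k. y k + t *\<^sub>R h k) = (\<lambda>k. gopT N D y k + t *\<^sub>R gopT N D h k)"
      using gopT_add[of N D y "\<lambda>k. t *\<^sub>R h k"] gopT_scaleR[of N D t h] D_lin by simp
    ultimately show ?thesis
      using q[of "\<lambda>k. y k + t *\<^sub>R h k"]
      by (simp only: binner_simps simp_thms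
        binner_commute[of _ "gopT N D h" "gopT N D y"] binner_commute[of _ h y] cross yy m_def[symmetric])
        (simp add: algebra_simps power2_eq_square)
  qed
  then have "binner {..N} h h = 0" by (rule nonneg_quadratic_linear_coeff)
  then have "bnorm {..N} h = 0" by (simp flip: bnorm_sq)
  then have "h k = 0" for k using hd by (cases "k \<le> N") (auto simp: bnorm_eq_0_iff dual_space_def)
  then have "gop N D (gopT N D y) = (\<lambda>k. (sqrt m)\<^sup>2 *\<^sub>R y k)" using m0 by (auto simp: h_def)
  moreover have "y \<noteq> (\<lambda>_. 0)" using yy by (auto simp: binner_def)
  ultimately show ?thesis using that[of "sqrt m" y] m0 yd by simp
qed

text \<open>On an eigenvector the transpose of \<open>G\<close> stretches by exactly
  \<open>s\<close>, so \<open>gopT_lower\<close> applies directly.\<close>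

lemma singular_value_lower:
  assumes s: "0 \<le> s" and y: "y \<in> dual_space 0 N" "y \<noteq> (\<lambda>_. 0)"
    and eig: "gop N D (gopT N D y) = (\<lambda>k. s\<^sup>2 *\<^sub>R y k)"
  shows "1 / \<rho> \<le> s"
proof -
  have "nrm y \<noteq> 0"
  proof
    assume "nrm y = 0"
    then have "y k = 0" for k using y(1) by (cases "k \<le> N") (auto simp: bnorm_eq_0_iff dual_space_def)
    with y(2) show False by auto
  qed
  then have pos: "0 < nrm y" by (simp add: less_le)
  have "(nrm (gopT N D y))\<^sup>2 = binner {..N} y (gop N D (gopT N D y))"
    unfolding bnorm_sq using gop_adjoint[of N D, OF D_lin] by simp
  also have "\<dots> = (s * nrm y)\<^sup>2" by (simp add: eig binner_simps power_mult_distrib bnorm_sq)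
  finally have "nrm (gopT N D y) = s * nrm y" using s by (simp add: power2_eq_iff_nonneg)
  with gopT_lower[of y] have "nrm y \<le> (\<rho> * s) * nrm y" by (simp add: mult.assoc)
  then have "1 \<le> \<rho> * s" using pos by simp
  then show ?thesis using const_ge(1) by (simp add: divide_le_eq mult.commute)
qed

end

section \<open>Sufficient conditions for descent\<close>

lemma young: "0 < e \<Longrightarrow> a * b \<le> e * a\<^sup>2 + b\<^sup>2 / (4 * e)" for a b e :: real
proof -
  assume e: "0 < e"
  have "0 \<le> (2 * e * a - b)\<^sup>2 / (4 * e)" using e by simp
  also have "\<dots> = e * a\<^sup>2 + b\<^sup>2 / (4 * e) - a * b" using e by (simp add: power2_eq_square field_simps)
  finally show ?thesis by simp
qed

text \<open>Here \<open>x\<close> and \<open>b\<close> are the norms of the primal and dual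
  direction, \<open>z\<close>, \<open>l\<close>, \<open>n\<close> those of the primal, dual and full
  gradient, \<open>t\<close> the relative residual, \<open>q\<close> the curvature term and
  \<open>m\<close> the merit slope. The lower bound on \<open>q\<close> offers
  \<open>\<gamma> / 4\<close> of squared \<open>x\<close>, spent in four portions of
  \<open>\<gamma> / 16\<close>. Squares of \<open>l\<close> are paid by \<open>\<eta>1\<close>,
  squares of \<open>z\<close> cost \<open>\<eta> / 8\<close>, and everything containing the residual
  costs \<open>\<eta> / 8\<close> of squared \<open>n\<close>.\<close>

lemma descent_inequality:
  fixes x b z l n t \<gamma> \<kappa> \<rho> C \<eta>1 \<eta> s q m :: real
  assumes nonneg: "0 \<le> x" "0 \<le> b" "0 \<le> z" "0 \<le> l" "0 \<le> n" "0 \<le> t" "0 \<le> C" "0 \<le> \<rho>" "0 \<le> \<kappa>"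
    and pos: "0 < \<gamma>" "0 < \<eta>" "0 < \<eta>1"
    and n: "n\<^sup>2 = z\<^sup>2 + l\<^sup>2"
    and q: "\<gamma> / 4 * x\<^sup>2 - C * (l + t * n)\<^sup>2 \<le> q"
    and b: "b \<le> \<rho> * (z + t * n + \<kappa> * x)"
    and m: "m \<le> - q + 2 * (b * l) + b * (t * n) + t * n * x - \<eta>1 * l\<^sup>2 + \<eta>1 * (l * (t * n))
       - \<eta> * z\<^sup>2 + \<eta> * (z * (t * n)) + \<eta> * (z * (2 * \<kappa> * x))"
    and t: "t \<le> 1" "t * (1 + \<eta>1 + \<eta>) * (8 * (2 * C + 4 * \<rho> + 4 * \<rho>\<^sup>2 * \<kappa>\<^sup>2 / \<gamma> + 4 / \<gamma> + 2)) \<le> \<eta>"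
    and \<eta>: "256 * \<kappa>\<^sup>2 * \<eta> \<le> \<gamma>"
    and \<eta>1: "2 * C + 16 * \<rho>\<^sup>2 / \<eta> + 16 * \<rho>\<^sup>2 * \<kappa>\<^sup>2 / \<gamma> + \<eta> \<le> \<eta>1"
  shows "m \<le> - \<eta> * n\<^sup>2 / 2"
proof -
  \<comment> \<open>Common bound for all products with a residual factor; since
    \<open>t \<le> 1\<close>, it covers the squared residual as well.\<close>
  define u where "u = t * n\<^sup>2"
  have tn: "0 \<le> t * n" "t * n \<le> n" "0 \<le> u" using nonneg t(1) by (auto simp: u_def mult_left_le_one_le)
  have zn: "z \<le> n" "l \<le> n" using n nonneg by (auto intro!: power2_le_imp_le[of _ n])
  have tt: "(t * n)\<^sup>2 \<le> u" "z * (t * n) \<le> u" "l * (t * n) \<le> u"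
    using mult_right_mono[OF tn(2) tn(1)] mult_right_mono[OF zn(1) tn(1)] mult_right_mono[OF zn(2) tn(1)]
    by (simp_all add: u_def power2_eq_square mult_ac)
  have c: "C * (l + t * n)\<^sup>2 \<le> 2 * C * l\<^sup>2 + 2 * C * u"
  proof -
    have "(l + t * n)\<^sup>2 \<le> 2 * l\<^sup>2 + 2 * (t * n)\<^sup>2"
      using zero_le_power2[of "l - t * n"] unfolding power2_sum power2_diff by linarith
    also have "\<dots> \<le> 2 * l\<^sup>2 + 2 * u" using tt(1) by simp
    finally show ?thesis using mult_left_mono[of _ _ C] nonneg(7) by (fastforce simp: algebra_simps)
  qed
  have b1: "2 * (b * l) \<le> \<eta> / 16 * z\<^sup>2 + 16 * \<rho>\<^sup>2 / \<eta> * l\<^sup>2 + 2 * \<rho> * u + \<gamma> / 16 * x\<^sup>2 + 16 * \<rho>\<^sup>2 * \<kappa>\<^sup>2 / \<gamma> * l\<^sup>2"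
  proof -
    have "2 * (b * l) \<le> 2 * (\<rho> * (z + t * n + \<kappa> * x) * l)" using b nonneg by (simp add: mult_right_mono)
    also have "\<dots> = z * (2 * \<rho> * l) + 2 * \<rho> * (l * (t * n)) + x * (2 * \<rho> * \<kappa> * l)" by (simp add: algebra_simps)
    also have "z * (2 * \<rho> * l) \<le> \<eta> / 16 * z\<^sup>2 + (2 * \<rho> * l)\<^sup>2 / (4 * (\<eta> / 16))" using pos by (intro young) simp
    also have "(2 * \<rho> * l)\<^sup>2 / (4 * (\<eta> / 16)) = 16 * \<rho>\<^sup>2 / \<eta> * l\<^sup>2" by (simp add: power_mult_distrib)
    also have "x * (2 * \<rho> * \<kappa> * l) \<le> \<gamma> / 16 * x\<^sup>2 + (2 * \<rho> * \<kappa> * l)\<^sup>2 / (4 * (\<gamma> / 16))" using pos by (intro young) simp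
    also have "(2 * \<rho> * \<kappa> * l)\<^sup>2 / (4 * (\<gamma> / 16)) = 16 * \<rho>\<^sup>2 * \<kappa>\<^sup>2 / \<gamma> * l\<^sup>2" by (simp add: power_mult_distrib)
    also have "2 * \<rho> * (l * (t * n)) \<le> 2 * \<rho> * u" using tt nonneg by (intro mult_left_mono) auto
    finally show ?thesis by simp
  qed
  have b2: "b * (t * n) \<le> 2 * \<rho> * u + \<gamma> / 16 * x\<^sup>2 + 4 * \<rho>\<^sup>2 * \<kappa>\<^sup>2 / \<gamma> * u"
  proof -
    have "b * (t * n) \<le> \<rho> * (z + t * n + \<kappa> * x) * (t * n)" using b tn by (simp add: mult_right_mono)
    also have "\<dots> = \<rho> * (z * (t * n)) + \<rho> * (t * n)\<^sup>2 + x * (\<rho> * \<kappa> * (t * n))" by (simp add: algebra_simps power2_eq_square)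
    also have "x * (\<rho> * \<kappa> * (t * n)) \<le> \<gamma> / 16 * x\<^sup>2 + (\<rho> * \<kappa> * (t * n))\<^sup>2 / (4 * (\<gamma> / 16))" using pos by (intro young) simp
    also have "(\<rho> * \<kappa> * (t * n))\<^sup>2 / (4 * (\<gamma> / 16)) = 4 * \<rho>\<^sup>2 * \<kappa>\<^sup>2 / \<gamma> * (t * n)\<^sup>2" by (simp add: power_mult_distrib)
    also have "\<dots> \<le> 4 * \<rho>\<^sup>2 * \<kappa>\<^sup>2 / \<gamma> * u" using tt pos by (intro mult_left_mono) auto
    also have "\<rho> * (z * (t * n)) \<le> \<rho> * u" using tt nonneg by (intro mult_left_mono) auto
    also have "\<rho> * (t * n)\<^sup>2 \<le> \<rho> * u" using tt nonneg by (intro mult_left_mono) auto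
    finally show ?thesis by simp
  qed
  have b3: "t * n * x \<le> \<gamma> / 16 * x\<^sup>2 + 4 / \<gamma> * u"
  proof -
    have "x * (t * n) \<le> \<gamma> / 16 * x\<^sup>2 + (t * n)\<^sup>2 / (4 * (\<gamma> / 16))" using pos by (intro young) simp
    also have "(t * n)\<^sup>2 / (4 * (\<gamma> / 16)) = 4 / \<gamma> * (t * n)\<^sup>2" by simp
    also have "\<dots> \<le> 4 / \<gamma> * u" using tt pos by (intro mult_left_mono) auto
    finally show ?thesis by (simp add: mult_ac)
  qed
  have b4: "\<eta>1 * (l * (t * n)) + \<eta> * (z * (t * n)) \<le> \<eta>1 * u + \<eta> * u"
    using tt pos by (intro add_mono mult_left_mono) auto
  have b5: "\<eta> * (z * (2 * \<kappa> * x)) \<le> \<eta> / 16 * z\<^sup>2 + \<gamma> / 16 * x\<^sup>2"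
  proof -
    have "\<eta> * (z * (2 * \<kappa> * x)) \<le> \<eta> * (1 / 16 * z\<^sup>2 + (2 * \<kappa> * x)\<^sup>2 / (4 * (1 / 16)))"
      using pos by (intro mult_left_mono young) auto
    also have "\<dots> = \<eta> / 16 * z\<^sup>2 + 256 * \<kappa>\<^sup>2 * \<eta> / 16 * x\<^sup>2" by (simp add: power_mult_distrib algebra_simps)
    also have "256 * \<kappa>\<^sup>2 * \<eta> / 16 * x\<^sup>2 \<le> \<gamma> / 16 * x\<^sup>2" using \<eta> by (intro mult_right_mono divide_right_mono) auto
    finally show ?thesis by simp
  qed
  \<comment> \<open>Total coefficient of \<open>u\<close> in \<open>c\<close>, \<open>b1\<close>,
    \<open>b2\<close> and \<open>b3\<close>. The \<open>+ 2\<close> in the assumption on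
    \<open>t\<close> makes room for the coefficients \<open>\<eta>1\<close> and
    \<open>\<eta>\<close> from \<open>b4\<close>.\<close>
  define W where "W = 2 * C + 4 * \<rho> + 4 * \<rho>\<^sup>2 * \<kappa>\<^sup>2 / \<gamma> + 4 / \<gamma>"
  have W: "0 \<le> W" using nonneg pos by (simp add: W_def)
  have uW: "W * u + \<eta>1 * u + \<eta> * u \<le> \<eta> / 8 * n\<^sup>2"
  proof -
    have "W + \<eta>1 + \<eta> \<le> (1 + \<eta>1 + \<eta>) * (W + 2)" using W pos by (simp add: algebra_simps)
    then have "(W + \<eta>1 + \<eta>) * u \<le> (1 + \<eta>1 + \<eta>) * (W + 2) * u" using tn(3) by (rule mult_right_mono)
    also have "\<dots> = (t * (1 + \<eta>1 + \<eta>) * (8 * (W + 2))) * (n\<^sup>2 / 8)" by (simp add: u_def mult_ac)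
    also have "\<dots> \<le> \<eta> * (n\<^sup>2 / 8)" using t(2) unfolding W_def by (rule mult_right_mono) simp
    finally show ?thesis by (simp add: distrib_right)
  qed
  have l1: "2 * C * l\<^sup>2 + 16 * \<rho>\<^sup>2 / \<eta> * l\<^sup>2 + 16 * \<rho>\<^sup>2 * \<kappa>\<^sup>2 / \<gamma> * l\<^sup>2 + \<eta> * l\<^sup>2 \<le> \<eta>1 * l\<^sup>2"
    using mult_right_mono[OF \<eta>1, of "l\<^sup>2"] by (simp only: distrib_right zero_le_power2)
  have Wu: "W * u = 2 * C * u + 4 * \<rho> * u + 4 * \<rho>\<^sup>2 * \<kappa>\<^sup>2 / \<gamma> * u + 4 / \<gamma> * u"
    by (simp only: W_def distrib_right)
  have "m \<le> - \<eta> * z\<^sup>2 + \<eta> / 8 * z\<^sup>2 - \<eta> * l\<^sup>2 + \<eta> / 8 * n\<^sup>2"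
    using m q c b1 b2 b3 b4 b5 uW l1 Wu by linarith
  also have "\<dots> \<le> - \<eta> * n\<^sup>2 / 2"
  proof -
    have "0 \<le> \<eta> * z\<^sup>2" "0 \<le> \<eta> * l\<^sup>2" using pos by auto
    moreover have "\<eta> * n\<^sup>2 = \<eta> * z\<^sup>2 + \<eta> * l\<^sup>2" by (simp add: n distrib_left)
    ultimately show ?thesis by linarith
  qed
  finally show ?thesis .
qed

section \<open>Bounds at a single iterate\<close>

text \<open>The constant of \<open>Kop_lower\<close> with \<open>K0\<close> written out, so that it
  is available outside the locale.\<close>

definition inv_const :: "nat \<Rightarrow> real \<Rightarrow> real \<Rightarrow> real" where
  "inv_const N L \<gamma> = (let \<rho> = rinv_const N L; \<kappa> = op_const N L;
     K = 1 + 8 / \<gamma> * (2 * (1 + \<rho> * \<kappa>)\<^sup>2 / \<gamma> + \<rho> + garding_const N L \<gamma>)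
   in 2 * (K + \<rho> * (1 + \<kappa> * K)))"

text \<open>The formula of \<open>Psi\<close> at the worst case: Hessian norm
  \<open>op_const\<close> and smallest singular value \<open>1 / rinv_const\<close>.\<close>

definition psi_const :: "nat \<Rightarrow> real \<Rightarrow> real \<Rightarrow> real" where
  "psi_const N L \<gamma> = 20 * (op_const N L)\<^sup>2 / (min \<gamma> 1 * (1 / rinv_const N L)\<^sup>2)"

context kkt_system
begin

abbreviation "\<iota> \<equiv> inv_const N L \<gamma>"

lemma Kop_inverse_bound: "fst \<circ> d \<in> primal_space 0 N \<Longrightarrow> nrm d \<le> \<iota> * nrm (Kop d)"
  using Kop_lower[of d] unfolding inv_const_def Let_def by (simp only: mult.assoc mult.left_commute[of _ 2])

lemma inv_const_ge: "1 \<le> \<iota>"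
proof -
  have K: "1 \<le> K0" using \<gamma> const_ge by simp
  have "0 \<le> \<kappa> * K0" by (rule mult_nonneg_nonneg) (use const_ge K in linarith)+
  then have "0 \<le> \<rho> * (1 + \<kappa> * K0)" using const_ge(1) by (intro mult_nonneg_nonneg[of \<rho>]) linarith+
  moreover have "1 \<le> 2 * (k + x)" if "1 \<le> k" "0 \<le> x" for k x :: real using that by simp
  ultimately show ?thesis using K unfolding inv_const_def Let_def by blast
qed

end

text \<open>The supremum includes the zero vector, whose ratio is \<open>0\<close> by the convention
  for division by zero; this gives nonnegativity. The a priori bound makes the set of ratios
  bounded, so that the supremum is meaningful.\<close>

lemma spec_norm_le:
  assumes "(\<lambda>_. 0) \<in> V" "\<And>v. v \<in> V \<Longrightarrow> bnorm {..N} (T v) \<le> C * bnorm {..N} v" "0 \<le> C"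
  shows "spec_norm N V T \<le> C" "0 \<le> spec_norm N V T"
    "v \<in> V \<Longrightarrow> bnorm {..N} (T v) / bnorm {..N} v \<le> spec_norm N V T"
proof -
  have ratio: "bnorm {..N} (T v) / bnorm {..N} v \<le> C" if "v \<in> V" for v
  proof (cases "bnorm {..N} v = 0")
    case False
    then have "0 < bnorm {..N} v" by (simp add: less_le)
    then show ?thesis using assms(2)[OF that] by (simp add: pos_divide_le_eq)
  qed (use assms(3) in simp)
  then show "spec_norm N V T \<le> C" unfolding spec_norm_def using assms(1) by (intro cSUP_least) auto
  have bdd: "bdd_above ((\<lambda>v. bnorm {..N} (T v) / bnorm {..N} v) ` V)" using ratio by (auto intro!: bdd_aboveI2)
  show "0 \<le> spec_norm N V T" unfolding spec_norm_def by (rule cSUP_upper2[OF bdd assms(1)]) simp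
  show "bnorm {..N} (T v) / bnorm {..N} v \<le> spec_norm N V T" if "v \<in> V"
    unfolding spec_norm_def by (rule cSUP_upper[OF that bdd])
qed

text \<open>Expanding a kernel vector in the orthonormal basis turns the matrix inequality into
  coercivity on the kernel, by Parseval's identity.\<close>

lemma red_hess_boundD:
  assumes T: "T = blkdiag (hor P) Hh" "\<And>k. k \<le> hor P \<Longrightarrow> linear (Hh k)"
    and bd: "red_hess_bound P w \<gamma> T" and u: "u \<in> kerG P w"
  shows "\<gamma> * (bnorm {..hor P} u)\<^sup>2 \<le> binner {..hor P} u (T u)"
proof -
  let ?N = "hor P"
  obtain d Z where ob: "orthonormal_basis ?N (kerG P w) d Z"
    and le: "\<And>c. (\<Sum>i<d. \<Sum>j<d. c i * binner {..?N} (Z i) (T (Z j)) * c j) \<ge> \<gamma> * (\<Sum>i<d. (c i)\<^sup>2)"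
    using bd unfolding red_hess_bound_def by blast
  obtain c where c: "u = (\<lambda>k. \<Sum>i<d. c i *\<^sub>R Z i k)"
    using ob u unfolding orthonormal_basis_def by blast
  have bl: "binner {..?N} u y = (\<Sum>i<d. c i * binner {..?N} (Z i) y)" for y
    unfolding c binner_def inner_sum_left by (subst sum.swap) (simp add: sum_distrib_left)
  have br: "binner {..?N} y u = (\<Sum>i<d. c i * binner {..?N} y (Z i))" for y
    unfolding binner_commute[of _ y] bl ..
  have Tu: "binner {..?N} y (T u) = (\<Sum>j<d. c j * binner {..?N} y (T (Z j)))" for y
  proof -
    have "T u k = (\<Sum>j<d. c j *\<^sub>R T (Z j) k)" for k
      unfolding T(1) c by (simp add: blkdiag_def linear_sum[OF T(2)] linear_scale[OF T(2)])
    then show ?thesis unfolding binner_def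
      by (simp add: inner_sum_right) (subst sum.swap, simp add: sum_distrib_left)
  qed
  have "binner {..?N} u u = (\<Sum>i<d. c i * (\<Sum>j<d. c j * binner {..?N} (Z i) (Z j)))"
    unfolding bl[of u] unfolding br ..
  also have "\<dots> = (\<Sum>i<d. \<Sum>j<d. if i = j then (c i)\<^sup>2 else 0)"
    unfolding sum_distrib_left using ob
    by (intro sum.cong refl) (auto simp: orthonormal_basis_def power2_eq_square)
  also have "\<dots> = (\<Sum>i<d. (c i)\<^sup>2)" by simp
  finally have "(bnorm {..?N} u)\<^sup>2 = (\<Sum>i<d. (c i)\<^sup>2)" by (simp only: bnorm_sq)
  moreover have "binner {..?N} u (T u) = (\<Sum>i<d. \<Sum>j<d. c i * binner {..?N} (Z i) (T (Z j)) * c j)"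
    unfolding bl[of "T u"] unfolding Tu sum_distrib_left by (simp add: mult_ac)
  ultimately show ?thesis using le[of c] by simp
qed

locale iterate =
  fixes P :: "('x::euclidean_space, 'u::euclidean_space) ndp" and w :: "('x, 'u) pd"
    and Hh :: "nat \<Rightarrow> 'x \<times> 'u \<Rightarrow> 'x \<times> 'u" and U \<gamma> :: real
  assumes smooth: "smooth_ndp P" and symmetric: "block_symmetric (hor P) Hh"
    and A_bound: "\<And>k. k < hor P \<Longrightarrow> onorm (jacA P k (fst (w k))) \<le> U"
    and B_bound: "\<And>k. k < hor P \<Longrightarrow> onorm (jacB P k (fst (w k))) \<le> U"
    and Hh_bound: "\<And>k. k \<le> hor P \<Longrightarrow> onorm (Hh k) \<le> U"
    and hess_bound: "\<And>k. k \<le> hor P \<Longrightarrow> onorm (hessL_blk P w k) \<le> U"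
    and U: "2 \<le> U" and gamma: "0 < \<gamma>"
    and red_hess: "red_hess_bound P w \<gamma> (blkdiag (hor P) Hh)"

lemma norm_le_onorm:
  fixes f :: "'a::euclidean_space \<Rightarrow> 'b::euclidean_space"
  assumes "linear f" "onorm f \<le> U"
  shows "norm (f x) \<le> U * norm x"
  using onorm[of f x] assms mult_right_mono[OF assms(2), of "norm x"] by (simp add: linear_conv_bounded_linear)

text \<open>The bound \<open>2 * U\<close> arises because the stage Jacobian acts on a pair through
  two blocks, each of norm at most \<open>U\<close>.\<close>

sublocale iterate \<subseteq> kkt_system "hor P" "dynD P (fst \<circ> w)" Hh "2 * U" \<gamma>
proof (rule kkt_system.intro)
  show "linear (dynD P (fst \<circ> w) k)" if "k < hor P" for k using smooth that by (rule linear_dynD)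
  show "norm (dynD P (fst \<circ> w) k v) \<le> 2 * U * norm v" if k: "k < hor P" for k v
  proof -
    have lin: "linear (dynD P (fst \<circ> w) k)" by (rule linear_dynD[OF smooth k])
    obtain p q where v: "v = (p, q)" by force
    have A: "linear (jacA P k (fst (w k)))"
      by (rule linearI) (use linear_add[OF lin, of "(_, 0)" "(_, 0)"] linear_scale[OF lin, of _ "(_, 0)"]
          in \<open>simp_all add: jacA_def dynD_def\<close>)
    have B: "linear (jacB P k (fst (w k)))"
      by (rule linearI) (use linear_add[OF lin, of "(0, _)" "(0, _)"] linear_scale[OF lin, of _ "(0, _)"]
          in \<open>simp_all add: jacB_def dynD_def\<close>)
    have "dynD P (fst \<circ> w) k v = jacA P k (fst (w k)) p + jacB P k (fst (w k)) q"
      using linear_add[OF lin, of "(p, 0)" "(0, q)"] by (simp add: jacA_def jacB_def dynD_def v)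
    also have "norm \<dots> \<le> U * norm p + U * norm q"
      by (intro order_trans[OF norm_triangle_ineq] add_mono norm_le_onorm A B A_bound B_bound k)
    also have "\<dots> \<le> U * norm v + U * norm v"
      using U norm_fst_le[of p q] norm_snd_le[of q p] by (intro add_mono mult_left_mono) (auto simp: v)
    finally show ?thesis by simp
  qed
  show "linear (Hh k)" "Hh k a \<bullet> b = a \<bullet> Hh k b" if "k \<le> hor P" for k a b
    using block_symmetricD[OF symmetric] that by auto
  show "norm (Hh k v) \<le> 2 * U * norm v" if "k \<le> hor P" for k v
    using order_trans[OF norm_le_onorm[OF block_symmetricD(1)[OF symmetric that] Hh_bound[OF that]]
        mult_right_mono[of U "2 * U" "norm v"]] U by simp
  show "1 \<le> 2 * U" "0 < \<gamma>" using U gamma by auto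
  show "\<gamma> * (bnorm {..hor P} u)\<^sup>2 \<le> binner {..hor P} u (blkdiag (hor P) Hh u)"
    if "u \<in> primal_space 0 (hor P)" "gop (hor P) (dynD P (fst \<circ> w)) u = (\<lambda>_. 0)" for u
    using that block_symmetricD(1)[OF symmetric]
    by (intro red_hess_boundD[OF refl _ red_hess]) (auto simp: kerG_def jacG_eq[OF smooth])
qed

context iterate
begin

abbreviation "g \<equiv> gradL P w"

abbreviation "psi_bound \<equiv> psi_const (hor P) (2 * U) \<gamma>"

lemma kkt_eq: "kkt P w Hh = Kop"
  by (intro ext) (simp add: kkt_def Kop_def jacG_eq[OF smooth] jacGT_eq[OF smooth])

lemma zero_spaces: "(\<lambda>_. 0) \<in> primal_space 0 (hor P)" "(\<lambda>_. 0) \<in> pd_space 0 (hor P)"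
  by (auto simp: primal_space_def pd_space_def dual_space_def zero_prod_def)

text \<open>The upper bound keeps the accuracy test attainable; the lower bound, a consequence of
  invertibility, keeps its right-hand side controlled, since the norm is a divisor there.\<close>

lemma normKKT_bounds: "normKKT P w Hh \<le> 3 * \<kappa>" "1 / \<iota> \<le> normKKT P w Hh"
proof -
  have up: "bnorm {..hor P} (kkt P w Hh v) \<le> 3 * \<kappa> * bnorm {..hor P} v" for v
    unfolding kkt_eq by (rule Kop_upper)
  have k0: "0 \<le> 3 * \<kappa>" using const_ge by simp
  show "normKKT P w Hh \<le> 3 * \<kappa>"
    unfolding normKKT_def by (rule spec_norm_le(1)[OF zero_spaces(2) up k0])
  obtain e :: 'x where e: "e \<in> Basis" using nonempty_Basis by blast
  \<comment> \<open>Any nonzero vector of the space serves to bound the norm from below; this one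
    has a single unit multiplier at stage \<open>0\<close>.\<close>
  define v :: "('x, 'u) pd" where "v = (\<lambda>_. 0)(0 := ((0, 0), e))"
  have v: "v \<in> pd_space 0 (hor P)" "fst \<circ> v \<in> primal_space 0 (hor P)"
    by (auto simp: v_def pd_space_def primal_space_def dual_space_def zero_prod_def)
  have "norm (v 0) \<le> nrm v" by (rule norm_le_bnorm) auto
  then have pos: "0 < nrm v" using e by (simp add: v_def norm_Pair norm_Basis)
  have "nrm v \<le> \<iota> * nrm (Kop v)" by (rule Kop_inverse_bound[OF v(2)])
  then have "1 / \<iota> \<le> nrm (Kop v) / nrm v" using pos inv_const_ge by (simp add: field_simps)
  also have "\<dots> \<le> normKKT P w Hh"
    unfolding normKKT_def kkt_eq[symmetric] by (rule spec_norm_le(3)[OF zero_spaces(2) up k0 v(1)])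
  finally show "1 / \<iota> \<le> normKKT P w Hh" .
qed

lemma normH_bounds: "0 \<le> normH P Hh" "normH P Hh \<le> \<kappa>"
  unfolding normH_def using spec_norm_le[OF zero_spaces(1) H_upper] const_ge by auto

lemma normG_bounds: "normG P w \<le> \<kappa>"
  unfolding normG_def jacG_eq[OF smooth] using spec_norm_le(1)[OF zero_spaces(1) gop_upper] const_ge by auto

text \<open>Besides the bound for each singular value, existence of one is essential: the infimum of
  the empty set would carry no information.\<close>

lemma sigma_minG_bound: "1 / \<rho> \<le> sigma_minG P w"
proof -
  have eq: "sing_valsG P w = {s. s \<ge> 0 \<and> (\<exists>y\<in>dual_space 0 (hor P). y \<noteq> (\<lambda>_. 0) \<and>
      gop (hor P) (dynD P (fst \<circ> w)) (gopT (hor P) (dynD P (fst \<circ> w)) y) = (\<lambda>k. s\<^sup>2 *\<^sub>R y k))}"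
    by (simp add: sing_valsG_def jacG_eq[OF smooth] jacGT_eq[OF smooth])
  have "sing_valsG P w \<noteq> {}" unfolding eq by (rule singular_value_exists) blast
  moreover have "1 / \<rho> \<le> s" if "s \<in> sing_valsG P w" for s
    using that unfolding eq by (auto intro: singular_value_lower)
  ultimately show ?thesis unfolding sigma_minG_def by (rule cInf_greatest)
qed

lemma Psi_bounds: "20 \<le> Psi P \<gamma> w Hh" "Psi P \<gamma> w Hh \<le> psi_bound"
proof -
  have r: "0 < 1 / \<rho>" "1 / \<rho> \<le> 1" using const_ge by auto
  have s: "(1 / \<rho>)\<^sup>2 \<le> (sigma_minG P w)\<^sup>2" using sigma_minG_bound r by (intro power_mono) auto
  have r2: "0 < (1 / \<rho>)\<^sup>2" "(1 / \<rho>)\<^sup>2 \<le> 1" using r by (auto simp: power_le_one)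
  have den: "min \<gamma> 1 * (1 / \<rho>)\<^sup>2 \<le> min \<gamma> 1 * min ((sigma_minG P w)\<^sup>2) 1"
    using s r2 gamma by (intro mult_left_mono) auto
  have dpos: "0 < min \<gamma> 1 * (1 / \<rho>)\<^sup>2" using r2 gamma by simp
  have m: "max ((normH P Hh)\<^sup>2) 1 \<le> \<kappa>\<^sup>2"
    using normH_bounds const_ge(2) power_mono[OF normH_bounds(2,1), of 2] by simp
  show "Psi P \<gamma> w Hh \<le> psi_bound" unfolding Psi_def psi_const_def
    using m den dpos by (intro frac_le) auto
  have "min \<gamma> 1 * min ((sigma_minG P w)\<^sup>2) 1 \<le> 1 * 1" using gamma by (intro mult_mono) auto
  then show "20 \<le> Psi P \<gamma> w Hh" unfolding Psi_def using den dpos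
    by (subst pos_le_divide_eq) (auto intro: order_trans[of _ 20])
qed

lemma Upsilon_bounds: "1 \<le> Upsilon P w Hh" "Upsilon P w Hh \<le> \<kappa>"
  using normG_bounds normH_bounds const_ge by (auto simp: Upsilon_def)

text \<open>The first bound yields the final tolerance below one. The second is uniform over
  iterates for fixed penalties and ends the interventions of the safeguard.\<close>

lemma eps_max_bounds:
  assumes "0 < \<eta>1" "0 < \<eta>2" "0 < beta c" "beta c < 1 / 2"
  shows "eps_max P c \<gamma> w Hh \<eta>1 \<eta>2 < 1"
    "(1 / 2 - beta c) * \<eta>2 / ((1 + \<eta>1 + \<eta>2) * (psi_bound * \<kappa>)\<^sup>2) \<le> eps_max P c \<gamma> w Hh \<eta>1 \<eta>2"
    "0 < eps_max P c \<gamma> w Hh \<eta>1 \<eta>2"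
proof -
  let ?q = "Psi P \<gamma> w Hh * Upsilon P w Hh"
  have "20 * 1 \<le> ?q" using Psi_bounds Upsilon_bounds by (intro mult_mono) auto
  then have q: "1 \<le> ?q\<^sup>2" "0 < ?q" by (auto simp: one_le_power)
  have "?q \<le> psi_bound * \<kappa>" using Psi_bounds Upsilon_bounds by (intro mult_mono) auto
  then have q2: "?q\<^sup>2 \<le> (psi_bound * \<kappa>)\<^sup>2" using q by (intro power_mono) auto
  have "(1 / 2 - beta c) * \<eta>2 < 1 * \<eta>2" using assms by (intro mult_strict_right_mono) auto
  also have "\<dots> \<le> (1 + \<eta>1 + \<eta>2) * 1" using assms by simp
  also have "\<dots> \<le> (1 + \<eta>1 + \<eta>2) * ?q\<^sup>2" using assms q by (intro mult_left_mono) auto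
  finally have "(1 / 2 - beta c) * \<eta>2 < (1 + \<eta>1 + \<eta>2) * ?q\<^sup>2" .
  moreover have pos: "0 < (1 + \<eta>1 + \<eta>2) * ?q\<^sup>2" using assms q by (intro mult_pos_pos) auto
  ultimately show "eps_max P c \<gamma> w Hh \<eta>1 \<eta>2 < 1" unfolding eps_max_def by (simp only: divide_less_eq_1 if_True) simp
  show "0 < eps_max P c \<gamma> w Hh \<eta>1 \<eta>2" unfolding eps_max_def using pos assms by (intro divide_pos_pos) auto
  show "(1 / 2 - beta c) * \<eta>2 / ((1 + \<eta>1 + \<eta>2) * (psi_bound * \<kappa>)\<^sup>2) \<le> eps_max P c \<gamma> w Hh \<eta>1 \<eta>2"
    unfolding eps_max_def using pos assms q2 by (intro divide_left_mono mult_left_mono mult_nonneg_nonneg mult_pos_pos)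
      (auto intro: less_le_trans[OF _ q2] q)
qed

lemma accurate_resid:
  assumes "accurate P \<gamma> w Hh \<epsilon> d" "0 \<le> \<epsilon>"
  shows "nrm (resid P w Hh d) \<le> (\<epsilon> * \<iota>) * nrm g"
proof -
  have "0 \<le> normKKT P w Hh" by (rule order_trans[OF _ normKKT_bounds(2)]) (use inv_const_ge in simp)
  then have "1 / \<iota> * 1 \<le> normKKT P w Hh * Psi P \<gamma> w Hh"
    using normKKT_bounds Psi_bounds inv_const_ge by (intro mult_mono) auto
  then have "\<epsilon> * nrm g / (normKKT P w Hh * Psi P \<gamma> w Hh) \<le> \<epsilon> * nrm g / (1 / \<iota>)"
    using assms(2) inv_const_ge less_le_trans[of 0 "1 / \<iota>" "normKKT P w Hh * Psi P \<gamma> w Hh"]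
    by (intro divide_left_mono mult_pos_pos[of _ "1 / \<iota>"]) auto
  with assms(1) show ?thesis unfolding accurate_def by (simp add: mult_ac)
qed

lemma bhess_upper: "nrm (bhess P w v) \<le> \<kappa> * nrm v"
proof -
  have "norm (bhess P w v k) \<le> (2 * U + 1) * nrm v" if "k \<in> {..hor P}" for k
  proof -
    have "norm (bhess P w v k) \<le> U * norm (v k)"
      using that linear_hessL_blk[OF smooth] hess_bound by (auto simp: bhess_def blkdiag_def intro!: norm_le_onorm)
    also have "\<dots> \<le> (2 * U + 1) * nrm v" using that U by (intro mult_mono norm_le_bnorm) auto
    finally show ?thesis .
  qed
  from bnorm_le_card[where K="{..hor P}" and v="bhess P w v", OF this] show ?thesis
    by (simp add: op_const_def mult.assoc)
qed

lemma accurate_imp_descent: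
  assumes acc: "accurate P \<gamma> w Hh \<epsilon> d" and d: "d \<in> pd_space 0 (hor P)"
    and pos: "0 \<le> \<epsilon>" "0 < \<eta>1" "0 < \<eta>2"
    and t: "\<epsilon> * \<iota> \<le> 1"
      "\<epsilon> * \<iota> * (1 + \<eta>1 + \<eta>2) * (8 * (2 * C1 + 4 * \<rho> + 4 * \<rho>\<^sup>2 * \<kappa>\<^sup>2 / \<gamma> + 4 / \<gamma> + 2)) \<le> \<eta>2"
    and \<eta>2: "256 * \<kappa>\<^sup>2 * \<eta>2 \<le> \<gamma>"
    and \<eta>1: "2 * C1 + 16 * \<rho>\<^sup>2 / \<eta>2 + 16 * \<rho>\<^sup>2 * \<kappa>\<^sup>2 / \<gamma> + \<eta>2 \<le> \<eta>1"
  shows "descent P \<eta>1 \<eta>2 w d"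
proof -
  let ?N = "hor P" and ?D = "dynD P (fst \<circ> w)"
  define a where "a = fst \<circ> d"
  define b where "b = snd \<circ> d"
  define r where "r = resid P w Hh d"
  define rz where "rz = fst \<circ> r"
  define rl where "rl = snd \<circ> r"
  define gz where "gz = fst \<circ> g"
  define gl where "gl = snd \<circ> g"
  define tn where "tn = \<epsilon> * \<iota> * nrm g"
  let ?Ha = "blkdiag ?N Hh a" and ?Gb = "gopT ?N ?D b" and ?Ga = "gop ?N ?D a"
  have r_le: "nrm r \<le> tn" unfolding r_def tn_def by (rule accurate_resid[OF acc pos(1)])
  have rz_le: "nrm rz \<le> tn" unfolding rz_def by (rule order_trans[OF bnorm_fst_le r_le])
  have rl_le: "nrm rl \<le> tn" unfolding rl_def by (rule order_trans[OF bnorm_snd_le r_le])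
  have row1: "(\<lambda>k. ?Ha k + ?Gb k) = (\<lambda>k. rz k - gz k)"
    by (auto simp: rz_def gz_def r_def resid_def kkt_eq Kop_def a_def b_def)
  have row2: "?Ga = (\<lambda>k. rl k - gl k)"
    by (auto simp: rl_def gl_def r_def resid_def kkt_eq Kop_def a_def)
  have a: "a \<in> primal_space 0 ?N" using d by (simp add: a_def pd_space_def)
  define q where "q = binner {..?N} a ?Ha"
  \<comment> \<open>Solved for the product of \<open>gz\<close> and \<open>a\<close>, this puts
    \<open>- q\<close> into the slope and a second copy of the product of \<open>b\<close> and
    \<open>gl\<close>, hence the factor \<open>2\<close> below.\<close>
  have test: "binner {..?N} a rz - binner {..?N} a gz = q + binner {..?N} b rl - binner {..?N} b gl"
    using test_primal[of a b] unfolding row1 row2 q_def by (simp add: binner_simps)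
  have slope: "merit_slope P \<eta>1 \<eta>2 w d = binner {..?N} gz a + binner {..?N} gl b
      + \<eta>1 * binner {..?N} gl ?Ga + \<eta>2 * binner {..?N} gz (\<lambda>k. bhess P w a k + ?Gb k)"
    unfolding merit_slope_eq[OF smooth] jacG_eq[OF smooth] jacGT_eq[OF smooth] binner_Pair[of _ g d]
    by (simp add: gz_def gl_def a_def b_def)
  \<comment> \<open>Eliminating the transposed Jacobian leaves the true minus the modified Hessian.
    This difference is only bounded, not small, so its product with \<open>\<eta>2\<close> has to be
    absorbed by the curvature.\<close>
  have Gb: "?Gb = (\<lambda>k. rz k - gz k - ?Ha k)" using row1 by (metis (no_types) add_diff_cancel_left')
  have "merit_slope P \<eta>1 \<eta>2 w d = - q + 2 * binner {..?N} b gl - binner {..?N} b rl + binner {..?N} a rz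
      - \<eta>1 * (nrm gl)\<^sup>2 + \<eta>1 * binner {..?N} gl rl - \<eta>2 * (nrm gz)\<^sup>2 + \<eta>2 * binner {..?N} gz rz
      + \<eta>2 * (binner {..?N} gz (bhess P w a) - binner {..?N} gz ?Ha)"
    unfolding slope Gb row2 bnorm_sq using test
    by (simp add: binner_simps binner_commute[of _ gz a] binner_commute[of _ gl b] algebra_simps)
  moreover have cs: "binner {..?N} u v \<le> x * y" "- binner {..?N} u v \<le> x * y"
    if "nrm u \<le> x" "nrm v \<le> y" for x y and u v :: "nat \<Rightarrow> 'e::real_inner"
    using binner_le_bnorm[of "{..?N}" u v] mult_mono[OF that order_trans[OF bnorm_nonneg that(1)] bnorm_nonneg] by linarith+
  have "binner {..?N} b gl \<le> nrm b * nrm gl" by (rule cs) auto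
  moreover have "- binner {..?N} b rl \<le> nrm b * tn" by (rule cs[OF order_refl rl_le])
  moreover have "binner {..?N} a rz \<le> tn * nrm a" using cs(1)[OF order_refl rz_le, of a] by (simp add: mult.commute)
  moreover have "\<eta>1 * binner {..?N} gl rl \<le> \<eta>1 * (nrm gl * tn)" using pos by (intro mult_left_mono cs[OF order_refl rl_le]) auto
  moreover have "\<eta>2 * binner {..?N} gz rz \<le> \<eta>2 * (nrm gz * tn)" using pos by (intro mult_left_mono cs[OF order_refl rz_le]) auto
  moreover have "\<eta>2 * (binner {..?N} gz (bhess P w a) - binner {..?N} gz ?Ha) \<le> \<eta>2 * (nrm gz * (2 * \<kappa> * nrm a))"
    using cs(1)[OF order_refl bhess_upper[of a], of gz] cs(2)[OF order_refl H_upper[of a], of gz] pos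
    by (intro mult_left_mono) (auto simp: algebra_simps)
  ultimately have m: "merit_slope P \<eta>1 \<eta>2 w d \<le> - q + 2 * (nrm b * nrm gl) + nrm b * tn + tn * nrm a - \<eta>1 * (nrm gl)\<^sup>2
      + \<eta>1 * (nrm gl * tn) - \<eta>2 * (nrm gz)\<^sup>2 + \<eta>2 * (nrm gz * tn) + \<eta>2 * (nrm gz * (2 * \<kappa> * nrm a))"
    by linarith
  have "nrm ?Ga \<le> nrm gl + tn"
    unfolding row2 using bnorm_triangle_diff[of "{..?N}" rl gl] rl_le by linarith
  then have "C1 * (nrm ?Ga)\<^sup>2 \<le> C1 * (nrm gl + tn)\<^sup>2" using const_ge by (intro mult_left_mono power_mono) auto
  then have q: "\<gamma> / 4 * (nrm a)\<^sup>2 - C1 * (nrm gl + tn)\<^sup>2 \<le> q" using garding[OF a] unfolding q_def by linarith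
  have "nrm (\<lambda>k. ?Ha k + ?Gb k) \<le> nrm gz + tn"
    unfolding row1 using bnorm_triangle_diff[of "{..?N}" rz gz] rz_le by linarith
  then have "\<rho> * (nrm (\<lambda>k. ?Ha k + ?Gb k) + \<kappa> * nrm a) \<le> \<rho> * (nrm gz + tn + \<kappa> * nrm a)"
    using const_ge by (intro mult_left_mono) auto
  with dual_bound[of b a] have b: "nrm b \<le> \<rho> * (nrm gz + tn + \<kappa> * nrm a)" by linarith
  have n: "(nrm g)\<^sup>2 = (nrm gz)\<^sup>2 + (nrm gl)\<^sup>2" unfolding gz_def gl_def by (rule bnorm_Pair_sq)
  have "merit_slope P \<eta>1 \<eta>2 w d \<le> - \<eta>2 * (nrm g)\<^sup>2 / 2"
    using const_ge pos inv_const_ge gamma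
    by (intro descent_inequality[OF _ _ _ _ _ _ _ _ _ gamma pos(3,2) n q[unfolded tn_def] b[unfolded tn_def] m[unfolded tn_def] t \<eta>2 \<eta>1])
      auto
  then show ?thesis by (simp add: descent_def)
qed

end

lemma core_cover:
  assumes "valid_decomposition N (nsub c) (knot c)" "k \<le> N"
  obtains i where "i < nsub c" "k \<in> core N c i"
proof -
  have M: "1 \<le> nsub c" and k0: "knot c 0 = 0" using assms(1) by (auto simp: valid_decomposition_def)
  show ?thesis
  proof (cases "knot c (nsub c - 1) \<le> k")
    case True
    then show ?thesis using that[of "nsub c - 1"] M assms(2) by (simp add: core_def)
  next
    case False
    \<comment> \<open>The core is indexed by the predecessor of the first knot beyond
      \<open>k\<close>; the predecessor exists because knot \<open>0\<close> is \<open>0\<close>.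
      The last core is closed at \<open>N\<close> and was treated separately.\<close>
    define j where "j = (LEAST j. k < knot c j)"
    have ex: "k < knot c (nsub c - 1)" using False by simp
    have j: "k < knot c j" unfolding j_def using ex by (rule LeastI)
    have "j \<le> nsub c - 1" unfolding j_def using ex by (rule Least_le)
    moreover obtain i where i: "j = Suc i" using j k0 by (cases j) auto
    moreover have "knot c i \<le> k" using not_less_Least[of i "\<lambda>j. k < knot c j"] i unfolding j_def by simp
    ultimately show ?thesis using that[of i] j by (auto simp: core_def)
  qed
qed

context iterate
begin

text \<open>Once every window is the whole horizon, all local solutions approximate the same vector, so
  gluing them costs only a constant factor.\<close>

lemma composed_accurate:
  assumes dec: "valid_decomposition (hor P) (nsub c) (knot c)"
    and full: "\<And>i. i < nsub c \<Longrightarrow> hor P \<le> b i" and tol: "\<And>i. i < nsub c \<Longrightarrow> lt i \<le> e"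
    and comp: "composed_direction P c w Hh lt b d" and e: "0 \<le> e"
    and small: "(6 * \<kappa> * ((1 + real (hor P)) * \<iota>) + 1) * e * (3 * \<kappa> * psi_bound) \<le> \<epsilon>"
  shows "accurate P \<gamma> w Hh \<epsilon> d"
proof -
  let ?N = "hor P"
  obtain v where v: "\<And>i. i < nsub c \<Longrightarrow>
      local_solution P (mu c) w Hh (win_lo c (b i) i) (win_hi ?N c (b i) i) (lt i) (v i)"
    and dv: "\<And>i k. i < nsub c \<Longrightarrow> k \<in> core ?N c i \<Longrightarrow> d k = v i k"
    using comp unfolding composed_direction_def by blast
  have M: "0 < nsub c" and kN: "knot c (nsub c) = ?N" and step: "\<And>i. i < nsub c \<Longrightarrow> knot c i < knot c (Suc i)"
    using dec by (auto simp: valid_decomposition_def)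
  have knot_le: "knot c i \<le> ?N" if "i \<le> nsub c" for i
    using that
  proof (induction i rule: inc_induct)
    case base
    then show ?case using kN by simp
  next
    case (step i)
    then show ?case using \<open>\<And>i. i < nsub c \<Longrightarrow> knot c i < knot c (Suc i)\<close>[of i] by simp
  qed
  have sol: "v i \<in> pd_space 0 ?N" "nrm (\<lambda>k. Kop (v i) k + g k) \<le> e * nrm g" if i: "i < nsub c" for i
  proof -
    have w: "win_lo c (b i) i = 0" "win_hi ?N c (b i) i = ?N"
      using knot_le[of i] full[OF i] i by (auto simp: win_lo_def win_hi_def)
    have l: "local_solution P (mu c) w Hh 0 ?N (lt i) (v i)" using v[OF i] unfolding w .
    then show "v i \<in> pd_space 0 ?N" by (simp add: local_solution_def)
    have "nrm (\<lambda>k. Kop (v i) k + g k)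
        = bnorm {0..?N} (\<lambda>k. qp_kkt P (mu c) w Hh 0 ?N (v i) k + qp_grad P (mu c) w Hh 0 ?N k)"
      unfolding atLeast0AtMost
      by (rule bnorm_cong) (simp add: qp_grad_full_window[OF smooth symmetric] qp_kkt_full_window[OF smooth symmetric] kkt_eq)
    also have "\<dots> \<le> lt i * bnorm {0..?N} (qp_grad P (mu c) w Hh 0 ?N)"
      using l by (simp add: local_solution_def)
    also have "bnorm {0..?N} (qp_grad P (mu c) w Hh 0 ?N) = nrm g"
      unfolding atLeast0AtMost by (rule bnorm_cong) (simp add: qp_grad_full_window[OF smooth symmetric])
    also have "lt i * nrm g \<le> e * nrm g" using tol[OF i] by (intro mult_right_mono) auto
    finally show "nrm (\<lambda>k. Kop (v i) k + g k) \<le> e * nrm g" .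
  qed
  have Kdiff: "Kop (\<lambda>k. x k - y k) = (\<lambda>k. Kop x k - Kop y k)" for x y
    using kkt_add[OF smooth symmetric, of w x "\<lambda>k. (-1) *\<^sub>R y k"] kkt_scaleR[OF smooth symmetric, of w "-1" y]
    unfolding kkt_eq by simp
  \<comment> \<open>Local solution \<open>0\<close> serves as reference: two inexact solutions of
    the same system differ by at most the inverse bound times the sum of their residuals.\<close>
  have close: "nrm (\<lambda>k. v i k - v 0 k) \<le> \<iota> * (2 * (e * nrm g))" if i: "i < nsub c" for i
  proof -
    have "fst \<circ> (\<lambda>k. v i k - v 0 k) \<in> primal_space 0 ?N"
      using sol(1)[OF i] sol(1)[OF M] by (auto simp: pd_space_def primal_space_def zero_prod_def)
    then have "nrm (\<lambda>k. v i k - v 0 k) \<le> \<iota> * nrm (Kop (\<lambda>k. v i k - v 0 k))" by (rule Kop_inverse_bound)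
    also have "Kop (\<lambda>k. v i k - v 0 k) = (\<lambda>k. (Kop (v i) k + g k) - (Kop (v 0) k + g k))"
      unfolding Kdiff by simp
    also have "nrm \<dots> \<le> nrm (\<lambda>k. Kop (v i) k + g k) + nrm (\<lambda>k. Kop (v 0) k + g k)" by (rule bnorm_triangle_diff)
    also have "\<dots> \<le> 2 * (e * nrm g)" using sol(2)[OF i] sol(2)[OF M] by simp
    finally show ?thesis using inv_const_ge by (simp add: mult_left_mono)
  qed
  have "norm (d k - v 0 k) \<le> \<iota> * (2 * (e * nrm g))" if "k \<in> {..?N}" for k
  proof -
    have "k \<le> ?N" using that by simp
    then obtain i where i: "i < nsub c" "k \<in> core ?N c i" by (rule core_cover[OF dec])
    have "norm (v i k - v 0 k) \<le> nrm (\<lambda>k. v i k - v 0 k)"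
      using norm_le_bnorm[of "{..?N}" k "\<lambda>k. v i k - v 0 k"] that by simp
    with close[OF i(1)] show ?thesis unfolding dv[OF i] by linarith
  qed
  \<comment> \<open>Each block of \<open>d\<close> comes from some local solution, so only blockwise
    distances are known; summing them costs the factor \<open>1 + real ?N\<close>.\<close>
  from bnorm_le_card[where K="{..?N}" and v="\<lambda>k. d k - v 0 k", OF this]
  have dist: "nrm (\<lambda>k. d k - v 0 k) \<le> (1 + real ?N) * (\<iota> * (2 * (e * nrm g)))" by simp
  have "resid P w Hh d = (\<lambda>k. Kop (\<lambda>k. d k - v 0 k) k + (Kop (v 0) k + g k))"
    unfolding Kdiff by (auto simp: resid_def kkt_eq)
  then have "nrm (resid P w Hh d) \<le> nrm (Kop (\<lambda>k. d k - v 0 k)) + nrm (\<lambda>k. Kop (v 0) k + g k)"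
    using bnorm_triangle[of "{..?N}" "Kop (\<lambda>k. d k - v 0 k)" "\<lambda>k. Kop (v 0) k + g k"] by simp
  also have "\<dots> \<le> 3 * \<kappa> * ((1 + real ?N) * (\<iota> * (2 * (e * nrm g)))) + e * nrm g"
    using const_ge by (intro add_mono sol(2)[OF M] order_trans[OF Kop_upper] mult_left_mono dist) auto
  also have "\<dots> = (6 * \<kappa> * ((1 + real ?N) * \<iota>) + 1) * e * nrm g" by (simp add: algebra_simps)
  also have "\<dots> \<le> \<epsilon> * nrm g / (normKKT P w Hh * Psi P \<gamma> w Hh)"
  proof -
    have pos: "0 < normKKT P w Hh" "0 < Psi P \<gamma> w Hh"
      using normKKT_bounds(2) Psi_bounds(1) inv_const_ge less_le_trans[of 0 "1 / \<iota>" "normKKT P w Hh"] by auto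
    let ?F = "(6 * \<kappa> * ((1 + real ?N) * \<iota>) + 1) * e"
    have F: "0 \<le> ?F" using const_ge inv_const_ge e by (intro mult_nonneg_nonneg add_nonneg_nonneg) auto
    have "?F * (normKKT P w Hh * Psi P \<gamma> w Hh) \<le> ?F * (3 * \<kappa> * psi_bound)"
      using pos normKKT_bounds(1) Psi_bounds(2) const_ge F by (intro mult_left_mono mult_mono) auto
    also have "\<dots> \<le> \<epsilon>" by (rule small)
    finally have "?F * (normKKT P w Hh * Psi P \<gamma> w Hh) * nrm g \<le> \<epsilon> * nrm g" by (rule mult_right_mono) simp
    then show ?thesis using pos by (simp add: pos_le_divide_eq mult_ac)
  qed
  finally show ?thesis by (simp add: accurate_def)
qed

end

section \<open>Parameter updates\<close>

text \<open>Every genuine change multiplies by at most \<open>r\<close>, so finitely many changes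
  bring the sequence below \<open>K\<close>, where no further change is possible. It is applied in
  turn to \<open>eta2\<close>, to \<open>eps\<close> and to \<open>local_size\<close>.\<close>

lemma geometric_decrease_stops:
  fixes x :: "nat \<Rightarrow> real"
  assumes pos: "\<And>t. T0 \<le> t \<Longrightarrow> 0 < x t" and r: "0 < r" "r < 1" and K: "0 < K"
    and step: "\<And>t. T0 \<le> t \<Longrightarrow> x (Suc t) = x t \<or> (K < x t \<and> x (Suc t) \<le> r * x t)"
  shows "\<exists>T\<ge>T0. \<forall>t\<ge>T. x t = x T"
proof -
  have dec: "x (Suc t) \<le> x t" if "T0 \<le> t" for t
  proof -
    have "r * x t \<le> 1 * x t" using pos[OF that] r by (intro mult_right_mono) auto
    then show ?thesis using step[OF that] by auto
  qed
  have mono: "x t \<le> x s" if "T0 \<le> s" "s \<le> t" for s t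
    using that(2) by (induction t rule: dec_induct) (use dec that(1) in \<open>auto intro: order_trans\<close>)
  have stop: "x t = x s" if "T0 \<le> s" "s \<le> t" "x s \<le> K" for s t
    using that(2)
  proof (induction t rule: dec_induct)
    case (step n)
    then show ?case using assms(5)[of n] that by auto
  qed simp
  \<comment> \<open>The induction counts changes: unless the sequence is already constant, the next
    change gains one more power of \<open>r\<close>.\<close>
  have small: "\<exists>T\<ge>T0. (\<forall>t\<ge>T. x t = x T) \<or> x T \<le> r ^ n * x T0" for n
  proof (induction n)
    case 0
    show ?case by (intro exI[of _ T0]) simp
  next
    case (Suc n)
    then obtain T where T: "T0 \<le> T" "(\<forall>t\<ge>T. x t = x T) \<or> x T \<le> r ^ n * x T0" by blast
    show ?case
    proof (cases "\<forall>t\<ge>T. x t = x T")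
      case False
      then have xT: "x T \<le> r ^ n * x T0" using T(2) by blast
      have "\<exists>t\<ge>T. x (Suc t) \<noteq> x t"
      proof (rule ccontr)
        assume "\<not> ?thesis"
        then have c: "x (Suc t) = x t" if "T \<le> t" for t using that by blast
        have "x t = x T" if "T \<le> t" for t
          using that by (induction t rule: dec_induct) (use c in auto)
        with False show False by blast
      qed
      then obtain t where t: "T \<le> t" "x (Suc t) \<noteq> x t" by blast
      then have "x (Suc t) \<le> r * x t" using step[of t] T(1) by auto
      also have "\<dots> \<le> r * (r ^ n * x T0)"
        using mono[OF T(1) t(1)] xT r by (intro mult_left_mono) auto
      finally show ?thesis using t(1) T(1) by (intro exI[of _ "Suc t"]) (simp add: mult.assoc)
    qed (use T(1) in blast)
  qed
  have "0 < x T0" by (rule pos) simp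
  then obtain n where "r ^ n < K / x T0" using real_arch_pow_inv[of "K / x T0" r] K r by auto
  then have "r ^ n * x T0 \<le> K" using \<open>0 < x T0\<close> by (simp add: pos_less_divide_eq less_imp_le)
  moreover obtain T where T: "T0 \<le> T" "(\<forall>t\<ge>T. x t = x T) \<or> x T \<le> r ^ n * x T0"
    using small[of n] by blast
  ultimately have "(\<forall>t\<ge>T. x t = x T) \<or> x T \<le> K" using order_trans by blast
  then have "\<forall>t\<ge>T. x t = x T" using stop[OF T(1)] by blast
  with T(1) show ?thesis by blast
qed

section \<open>Invariants and potentials of the loops\<close>

definition global_inv :: "real \<Rightarrow> real \<Rightarrow> nat \<Rightarrow> aotd_params \<Rightarrow> bool" where
  "global_inv a E M p \<longleftrightarrow> 0 < eta1 p \<and> 0 < eta2 p \<and> eta1 p * (eta2 p)\<^sup>2 = a \<and> 0 < eps p \<and>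
     eps p \<le> E * eta2 p ^ 4 \<and> (\<forall>i<M. 0 < leps p i)"

definition same_globals :: "aotd_params \<Rightarrow> aotd_params \<Rightarrow> bool" where
  "same_globals p p' \<longleftrightarrow> eta1 p' = eta1 p \<and> eta2 p' = eta2 p \<and> eps p' = eps p"

text \<open>A potential treating tolerances and overlaps alike: one more unit of overlap multiplies
  \<open>r ^ ovl p i\<close> by \<open>r\<close>, just as an update shrinks a tolerance by at least
  \<open>r\<close>. A small value forces both small tolerances and long overlaps.\<close>

definition local_size :: "real \<Rightarrow> nat \<Rightarrow> aotd_params \<Rightarrow> real" where
  "local_size r M p = (\<Sum>i<M. leps p i + r ^ ovl p i)"

text \<open>The first alternative is equality of the whole parameter record, not only of its
  potential; this finally turns a constant potential into constant parameters. The threshold depends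
  on \<open>eps\<close>, as the accuracy test does.\<close>

definition local_step :: "real \<Rightarrow> nat \<Rightarrow> (real \<Rightarrow> real) \<Rightarrow> aotd_params \<Rightarrow> aotd_params \<Rightarrow> bool" where
  "local_step r M thr p p' \<longleftrightarrow> p' = p \<or>
     (thr (eps p) < local_size r M p \<and> local_size r M p' \<le> r * local_size r M p)"

text \<open>The facts about one iterate that the control flow relies on. The factor \<open>r\<close>
  is the contraction guaranteed even for a subproblem with zero residual, when only the summand with
  the root of the number of subproblems remains.\<close>

locale loops =
  fixes P :: "('x::euclidean_space, 'u::euclidean_space) ndp" and c :: aotd_inputs and \<gamma> :: real
    and w :: "('x, 'u) pd" and Hh :: "nat \<Rightarrow> 'x \<times> 'u \<Rightarrow> 'x \<times> 'u"
    and a E \<theta> r :: real and thr :: "real \<Rightarrow> real"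
  assumes nu: "1 < nu c" and r: "r = exp (- rho_eps c / sqrt (real (nsub c)))" "0 < r" "r < 1"
    and rho: "0 < rho_eps c"
    and eps_max_pos: "\<And>\<eta>1 \<eta>2. 0 < \<eta>1 \<Longrightarrow> 0 < \<eta>2 \<Longrightarrow> 0 < eps_max P c \<gamma> w Hh \<eta>1 \<eta>2"
    and small_descent: "\<And>p d. global_inv a E (nsub c) p \<Longrightarrow> eta2 p \<le> \<theta> \<Longrightarrow> d \<in> pd_space 0 (hor P) \<Longrightarrow>
      accurate P \<gamma> w Hh (eps p) d \<Longrightarrow> descent P (eta1 p) (eta2 p) w d"
    and small_accurate: "\<And>p d. global_inv a E (nsub c) p \<Longrightarrow> local_size r (nsub c) p \<le> thr (eps p) \<Longrightarrow>
      composed_direction P c w Hh (leps p) (ovl p) d \<Longrightarrow> accurate P \<gamma> w Hh (eps p) d"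
begin

abbreviation "M \<equiv> nsub c"
abbreviation "X \<equiv> local_size r M"
abbreviation "ginv \<equiv> global_inv a E M"

lemma size_nonneg: "ginv p \<Longrightarrow> 0 \<le> X p"
  using r unfolding local_size_def by (intro sum_nonneg add_nonneg_nonneg) (auto simp: global_inv_def intro: less_imp_le)

lemma local_step_trans:
  assumes "ginv p1" "same_globals p1 p2" "local_step r M thr p1 p2" "local_step r M thr p2 p3"
  shows "local_step r M thr p1 p3"
proof -
  have "r * (r * X p1) \<le> 1 * (r * X p1)" using r size_nonneg[OF assms(1)] by (intro mult_right_mono) auto
  moreover have "r * X p2 \<le> r * (r * X p1)" if "X p2 \<le> r * X p1" using that r by (intro mult_left_mono) auto
  ultimately show ?thesis using assms(2-4) by (auto simp: local_step_def same_globals_def)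
qed

lemma resid_ratio_nonneg: "0 \<le> resid_ratio P c w Hh d i"
  by (simp add: resid_ratio_def)

text \<open>By contraposition of \<open>small_accurate\<close>, a rejected composition certifies
  that the potential is still above its threshold.\<close>

lemma local_update:
  assumes p: "ginv p" and comp: "composed_direction P c w Hh (leps p) (ovl p) d"
    and na: "\<not> accurate P \<gamma> w Hh (eps p) d"
  defines "p1 \<equiv> p\<lparr>leps := shrink_leps P c w Hh d (leps p), ovl := enlarge_ovl P c w Hh d (ovl p)\<rparr>"
  shows "ginv p1" "same_globals p p1" "local_step r M thr p p1"
proof -
  show "ginv p1" using p by (auto simp: p1_def global_inv_def shrink_leps_def)
  show "same_globals p p1" by (simp add: p1_def same_globals_def)
  have "leps p1 i + r ^ ovl p1 i \<le> r * (leps p i + r ^ ovl p i)" if i: "i < M" for i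
  proof -
    have "exp (- rho_eps c * (resid_ratio P c w Hh d i + 1 / sqrt (real M))) \<le> r"
      using rho resid_ratio_nonneg[of d i] unfolding r(1) by (simp add: distrib_left)
    then have 1: "leps p1 i \<le> leps p i * r"
      using p i unfolding p1_def by (auto simp: shrink_leps_def global_inv_def intro!: mult_left_mono)
    have "Suc (ovl p i) \<le> ovl p1 i" by (simp add: p1_def enlarge_ovl_def)
    then have "r ^ ovl p1 i \<le> r ^ Suc (ovl p i)" using r by (intro power_decreasing) auto
    with 1 show ?thesis by (simp add: algebra_simps)
  qed
  then have "X p1 \<le> r * X p" unfolding local_size_def sum_distrib_left by (intro sum_mono) auto
  moreover have "thr (eps p) < X p" using small_accurate[OF p _ comp] na by force
  ultimately show "local_step r M thr p p1" by (simp add: local_step_def)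
qed

lemma acc_loop_effect:
  assumes "acc_loop P c \<gamma> w Hh d p d' p'" "d \<in> pd_space 0 (hor P)" "ginv p"
  shows "d' \<in> pd_space 0 (hor P) \<and> ginv p' \<and> same_globals p p' \<and> local_step r M thr p p' \<and>
    accurate P \<gamma> w Hh (eps p') d'"
  using assms
proof (induction rule: acc_loop.induct)
  case (acc_exit p d)
  then show ?case by (simp add: same_globals_def local_step_def)
next
  case (acc_iter p d d1 p1 d' p')
  have d1: "d1 \<in> pd_space 0 (hor P)" using acc_iter.hyps(2) by (simp add: composed_direction_def)
  have p1: "ginv p1" "same_globals p p1" "local_step r M thr p p1"
    using local_update[OF acc_iter.prems(2) acc_iter.hyps(2)] acc_iter.prems(2)
    unfolding acc_iter.hyps(3) by (auto simp: same_globals_def local_step_def)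
  from acc_iter.IH[OF d1 p1(1)] show ?case
    using local_step_trans[OF acc_iter.prems(2) p1(2,3)] p1(2) by (auto simp: same_globals_def)
qed

text \<open>Established by the safeguard and re-established by every penalty update, hence true at
  acceptance, where it bounds the tolerance by one.\<close>

definition eps_inv :: "aotd_params \<Rightarrow> bool" where
  "eps_inv p \<longleftrightarrow> eps p \<le> eps_max P c \<gamma> w Hh (eta1 p) (eta2 p)"

lemma penalty_update_inv:
  assumes "ginv p"
  shows "ginv (penalty_update P c \<gamma> w Hh p)" "eps_inv (penalty_update P c \<gamma> w Hh p)"
    "eta2 (penalty_update P c \<gamma> w Hh p) = eta2 p / nu c"
proof -
  let ?p = "penalty_update P c \<gamma> w Hh p"
  have n: "0 < nu c" using nu by simp
  have e: "eta1 ?p = (nu c)\<^sup>2 * eta1 p" "eta2 ?p = eta2 p / nu c" "leps ?p = leps p"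
    "eps ?p = min (eps_max P c \<gamma> w Hh ((nu c)\<^sup>2 * eta1 p) (eta2 p / nu c)) (eps p / nu c ^ 4)"
    by (simp_all add: penalty_update_def Let_def)
  have "eps p / nu c ^ 4 \<le> E * eta2 p ^ 4 / nu c ^ 4"
    using assms n by (intro divide_right_mono) (auto simp: global_inv_def)
  then have "eps ?p \<le> E * eta2 ?p ^ 4" unfolding e by (simp add: power_divide)
  then show "ginv ?p"
    using assms n eps_max_pos[of "(nu c)\<^sup>2 * eta1 p" "eta2 p / nu c"]
    unfolding global_inv_def e by (simp add: power_divide)
  show "eps_inv ?p" "eta2 ?p = eta2 p / nu c" by (simp_all add: eps_inv_def e)
qed

text \<open>Any number of passes is summarized by a dichotomy: either no penalty update occurred,
  and the local changes compose to one \<open>local_step\<close>, or \<open>eta2\<close> exceeded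
  \<open>\<theta>\<close> on entry and lost at least one factor \<open>nu c\<close>. In the second
  case nothing is recorded about local parameters; it occurs in finitely many iterations
  only.\<close>

lemma dir_loop_effect:
  assumes "dir_loop P c \<gamma> w Hh d p d' p'" "d \<in> pd_space 0 (hor P)" "ginv p" "eps_inv p"
  shows "ginv p' \<and> eps_inv p' \<and> descent P (eta1 p') (eta2 p') w d' \<and>
    (same_globals p p' \<and> local_step r M thr p p' \<or> \<theta> < eta2 p \<and> eta2 p' \<le> 1 / nu c * eta2 p)"
  using assms
proof (induction rule: dir_loop.induct)
  case (dir_exit p d)
  then show ?case by (simp add: same_globals_def local_step_def)
next
  case (dir_iter p d d1 p1 p2 d' p')
  have 1: "d1 \<in> pd_space 0 (hor P)" "ginv p1" "same_globals p p1" "local_step r M thr p p1"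
    "accurate P \<gamma> w Hh (eps p1) d1"
    using acc_loop_effect[OF dir_iter.hyps(2) dir_iter.prems(1,2)] by auto
  have 2: "eps_inv p1" using dir_iter.prems(3) 1(3) by (simp add: eps_inv_def same_globals_def)
  show ?case
  proof (cases "descent P (eta1 p1) (eta2 p1) w d1")
    case True
    then have p2: "p2 = p1" using dir_iter.hyps(3) by simp
    from dir_iter.IH[unfolded p2, OF 1(1,2) 2] show ?thesis
      using local_step_trans[OF dir_iter.prems(2) 1(3,4)] 1(3) by (auto simp: same_globals_def)
  next
    case False
    then have p2: "p2 = penalty_update P c \<gamma> w Hh p1" using dir_iter.hyps(3) by simp
    have th: "\<theta> < eta2 p1" using False small_descent[OF 1(2) _ 1(1,5)] by force
    have e2: "eta2 p2 = eta2 p1 / nu c" "eta2 p1 = eta2 p" "0 < eta2 p2"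
      using penalty_update_inv[OF 1(2)] 1(3) unfolding p2 by (auto simp: same_globals_def global_inv_def)
    \<comment> \<open>Further updates in the remaining passes only lower \<open>eta2\<close> more,
      so the single guaranteed factor survives the induction.\<close>
    have "1 / nu c * eta2 p2 \<le> 1 * eta2 p2" using nu e2(3) by (intro mult_right_mono) auto
    with dir_iter.IH[unfolded p2, OF 1(1) penalty_update_inv(1,2)[OF 1(2)]] th e2
    show ?thesis by (auto simp: same_globals_def p2)
  qed
qed

lemma eps_safeguard_effect:
  assumes "ginv p"
  shows "ginv (eps_safeguard P c \<gamma> w Hh p)" "eps_inv (eps_safeguard P c \<gamma> w Hh p)"
    "eta1 (eps_safeguard P c \<gamma> w Hh p) = eta1 p" "eta2 (eps_safeguard P c \<gamma> w Hh p) = eta2 p"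
    "eps_safeguard P c \<gamma> w Hh p = p \<or> eps_max P c \<gamma> w Hh (eta1 p) (eta2 p) < eps p \<and>
       eps (eps_safeguard P c \<gamma> w Hh p) \<le> 1 / nu c * eps p"
proof -
  let ?m = "eps_max P c \<gamma> w Hh (eta1 p) (eta2 p)"
  have m: "0 < ?m" using assms eps_max_pos by (simp add: global_inv_def)
  have "?m / nu c \<le> ?m" using m nu by (simp add: divide_le_eq)
  then show "ginv (eps_safeguard P c \<gamma> w Hh p)" "eps_inv (eps_safeguard P c \<gamma> w Hh p)"
    using assms m nu by (auto simp: eps_safeguard_def global_inv_def eps_inv_def)
  show "eta1 (eps_safeguard P c \<gamma> w Hh p) = eta1 p" "eta2 (eps_safeguard P c \<gamma> w Hh p) = eta2 p"
    by (simp_all add: eps_safeguard_def)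
  show "eps_safeguard P c \<gamma> w Hh p = p \<or> ?m < eps p \<and> eps (eps_safeguard P c \<gamma> w Hh p) \<le> 1 / nu c * eps p"
    using nu by (auto simp: eps_safeguard_def divide_right_mono)
qed

end

text \<open>With \<open>\<eta>1\<close> equal to \<open>a\<close> over squared \<open>\<eta>\<close>
  and \<open>\<epsilon>\<close> of fourth order in \<open>\<eta>\<close>, every requirement reduces
  to a constant multiple of \<open>\<eta>\<close> being small: the product of
  \<open>\<epsilon>\<close> and \<open>\<eta>1\<close> is of second order, to be compared with
  \<open>\<eta>\<close>, and \<open>c3 / \<eta>\<close> is one order below
  \<open>\<eta>1\<close>.\<close>

lemma small_penalty_threshold:
  fixes a E \<iota> W c1 c2 c3 B :: real
  assumes "0 < a" "0 < E" "0 < \<iota>" "0 < W" "0 < c1" "0 \<le> c2" "0 \<le> c3" "0 < B"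
  shows "\<exists>\<theta>>0. \<forall>\<eta>1 \<eta> \<epsilon>. 0 < \<eta> \<longrightarrow> \<eta> \<le> \<theta> \<longrightarrow> \<eta>1 * \<eta>\<^sup>2 = a \<longrightarrow> 0 \<le> \<epsilon> \<longrightarrow> \<epsilon> \<le> E * \<eta> ^ 4 \<longrightarrow>
       \<epsilon> * \<iota> \<le> 1 \<and> \<epsilon> * \<iota> * (1 + \<eta>1 + \<eta>) * W \<le> \<eta> \<and> B * \<eta> \<le> c1 \<and> c2 + c3 / \<eta> + \<eta> \<le> \<eta>1"
proof -
  \<comment> \<open>The entry \<open>1\<close> allows higher powers of \<open>\<eta>\<close> to be
    replaced by lower ones; each other entry serves one of the four requirements.\<close>
  define \<theta> where "\<theta> = Min {1, 1 / (E * \<iota>), 1 / (E * \<iota> * W * (2 + a)), c1 / B, a / (c2 + c3 + 1)}"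
  have pos: "0 < \<theta>" unfolding \<theta>_def using assms by (subst Min_gr_iff) (auto intro!: divide_pos_pos mult_pos_pos)
  have "\<epsilon> * \<iota> \<le> 1 \<and> \<epsilon> * \<iota> * (1 + \<eta>1 + \<eta>) * W \<le> \<eta> \<and> B * \<eta> \<le> c1 \<and> c2 + c3 / \<eta> + \<eta> \<le> \<eta>1"
    if h: "0 < \<eta>" "\<eta> \<le> \<theta>" "\<eta>1 * \<eta>\<^sup>2 = a" "0 \<le> \<epsilon>" "\<epsilon> \<le> E * \<eta> ^ 4" for \<eta>1 \<eta> \<epsilon>
  proof -
    have le: "\<eta> \<le> 1" "\<eta> \<le> 1 / (E * \<iota>)" "\<eta> \<le> 1 / (E * \<iota> * W * (2 + a))" "\<eta> \<le> c1 / B" "\<eta> \<le> a / (c2 + c3 + 1)"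
      using h(2) unfolding \<theta>_def by (auto simp: Min_ge_iff)
    have p: "\<eta> ^ 2 \<le> \<eta>" "\<eta> ^ 3 \<le> \<eta>" "\<eta> ^ 4 \<le> \<eta>" "\<eta> ^ 4 \<le> \<eta> ^ 2" "\<eta> ^ 5 \<le> \<eta> ^ 2"
      using h(1) le(1) power_decreasing[of 1 2 \<eta>] power_decreasing[of 1 3 \<eta>] power_decreasing[of 1 4 \<eta>]
        power_decreasing[of 2 4 \<eta>] power_decreasing[of 2 5 \<eta>] by simp_all
    have \<eta>1: "\<eta>1 = a / \<eta>\<^sup>2" using h(1,3) by (simp add: field_simps)
    have \<eta>1_pos: "0 < \<eta>1" unfolding \<eta>1 using assms h by simp
    have "\<epsilon> * \<iota> \<le> E * \<eta> * \<iota>"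
      using h p(3) assms by (intro mult_right_mono order_trans[OF h(5)] mult_left_mono) auto
    also have "\<dots> \<le> 1" using le(2) assms by (simp add: pos_le_divide_eq mult_ac)
    finally have 1: "\<epsilon> * \<iota> \<le> 1" .
    have "\<epsilon> * \<iota> * (1 + \<eta>1 + \<eta>) * W \<le> E * \<eta> ^ 4 * \<iota> * (1 + \<eta>1 + \<eta>) * W"
      using h assms \<eta>1_pos by (intro mult_right_mono) auto
    also have "\<dots> = E * \<iota> * W * (\<eta> ^ 4 + a * \<eta>\<^sup>2 + \<eta> ^ 5)"
      unfolding h(3)[symmetric] by (simp add: algebra_simps eval_nat_numeral)
    also have "\<dots> \<le> E * \<iota> * W * (\<eta>\<^sup>2 + a * \<eta>\<^sup>2 + \<eta>\<^sup>2)" using assms p by (intro mult_left_mono add_mono) auto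
    also have "\<dots> = (E * \<iota> * W * (2 + a)) * \<eta> * \<eta>" by (simp add: algebra_simps power2_eq_square)
    also have "\<dots> \<le> 1 * \<eta>" using le(3) assms h(1) by (intro mult_right_mono) (auto simp: pos_le_divide_eq mult_ac)
    finally have 2: "\<epsilon> * \<iota> * (1 + \<eta>1 + \<eta>) * W \<le> \<eta>" by simp
    have 3: "B * \<eta> \<le> c1" using le(4) assms by (simp add: pos_le_divide_eq mult_ac)
    have "(c2 + c3 / \<eta> + \<eta>) * \<eta>\<^sup>2 = c2 * \<eta>\<^sup>2 + c3 * \<eta> + \<eta> ^ 3"
      using h(1) by (simp add: field_simps eval_nat_numeral)
    also have "\<dots> \<le> c2 * \<eta> + c3 * \<eta> + \<eta>" using p assms by (intro add_mono mult_left_mono) auto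
    also have "\<dots> = (c2 + c3 + 1) * \<eta>" by (simp add: algebra_simps)
    also have "\<dots> \<le> a" using le(5) assms by (simp add: pos_le_divide_eq mult_ac)
    finally have "c2 + c3 / \<eta> + \<eta> \<le> a / \<eta>\<^sup>2" using h(1) by (simp add: pos_le_divide_eq)
    then have 4: "c2 + c3 / \<eta> + \<eta> \<le> \<eta>1" unfolding \<eta>1 .
    from 1 2 3 4 show ?thesis by blast
  qed
  with pos show ?thesis by blast
qed

lemma compact_smooth_imp_smooth_ndp: "compact_smooth P w d U \<Z> \<Z>N \<Lambda> \<Longrightarrow> smooth_ndp P"
  by (auto simp: compact_smooth_def smooth_ndp_def C_diff_3_imp_twice_diff)

lemma iterate_of_assumptions:
  assumes run: "hess_modification P \<gamma> (w \<tau>) (Hh \<tau>)"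
    and red: "0 < \<gamma>" "red_hess_bound P (w \<tau>) \<gamma> (blkdiag (hor P) (Hh \<tau>))"
    and bd: "uniform_boundedness P Hh w U" and cs: "compact_smooth P w d U \<Z> \<Z>N \<Lambda>"
  shows "iterate P (w \<tau>) (Hh \<tau>) U \<gamma>"
proof
  show "smooth_ndp P" by (rule compact_smooth_imp_smooth_ndp[OF cs])
  show "block_symmetric (hor P) (Hh \<tau>)" using run by (auto simp: hess_modification_def block_symmetric_def)
  have bd': "2 \<le> U" "k < hor P \<Longrightarrow> onorm (Hh \<tau> k) \<le> U \<and> onorm (jacA P k (fst (w \<tau> k))) \<le> U \<and> onorm (jacB P k (fst (w \<tau> k))) \<le> U"
    "onorm (Hh \<tau> (hor P)) \<le> U" for k
    using bd by (auto simp: uniform_boundedness_def)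
  show "2 \<le> U" by (rule bd')
  show "onorm (jacA P k (fst (w \<tau> k))) \<le> U" "onorm (jacB P k (fst (w \<tau> k))) \<le> U" if "k < hor P" for k
    using bd'(2)[OF that] by auto
  show "onorm (Hh \<tau> k) \<le> U" if "k \<le> hor P" for k
    using bd'(2)[of k] bd'(3) that by (cases "k = hor P") auto
  \<comment> \<open>The compactness assumption concerns segments along the steps; step length
    \<open>0\<close> places the iterate itself in the sets where the true Hessian is
    bounded.\<close>
  have m: "move (w \<tau>) 0 (d \<tau>) = w \<tau>" by (simp add: move_def)
  have in_sets: "(\<forall>k<hor P. fst (w \<tau> k) \<in> \<Z> k) \<and> fst (fst (w \<tau> (hor P))) \<in> \<Z>N \<and> (\<forall>k\<le>hor P. snd (w \<tau> k) \<in> \<Lambda> k)"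
    using cs unfolding compact_smooth_def by (metis (no_types, lifting) m atLeastAtMost_iff order_refl zero_le_one)
  show "onorm (hessL_blk P (w \<tau>) k) \<le> U" if "k \<le> hor P" for k
  proof (cases "k = hor P")
    case True
    then show ?thesis using cs in_sets by (simp add: compact_smooth_def)
  next
    case False
    then have "k < hor P" using that by simp
    then show ?thesis using cs in_sets unfolding compact_smooth_def by (meson Suc_leI)
  qed
  show "0 < \<gamma>" "red_hess_bound P (w \<tau>) \<gamma> (blkdiag (hor P) (Hh \<tau>))" by (rule red)+
qed

theorem lemma4:
  fixes P :: "(real ^ 'nx, real ^ 'nu) ndp"
    and c :: aotd_inputs and p0 :: aotd_params
    and Hh :: "nat \<Rightarrow> nat \<Rightarrow> (real ^ 'nx) \<times> (real ^ 'nu) \<Rightarrow> (real ^ 'nx) \<times> (real ^ 'nu)"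
    and w d :: "nat \<Rightarrow> (real ^ 'nx, real ^ 'nu) pd"
    and p :: "nat \<Rightarrow> aotd_params"
    and \<gamma>RH \<gamma>C U :: real and tC :: nat
    and \<Z> :: "nat \<Rightarrow> ((real ^ 'nx) \<times> (real ^ 'nu)) set" and \<Z>N :: "(real ^ 'nx) set"
    and \<Lambda> :: "nat \<Rightarrow> (real ^ 'nx) set"
  assumes horizon: "hor P \<ge> 1"
    and inputs: "valid_inputs (hor P) c p0"
    and run: "aotd_run P c \<gamma>RH p0 Hh w d p"
    and red_hess: "\<gamma>RH > 0" "\<And>\<tau>. red_hess_bound P (w \<tau>) \<gamma>RH (blkdiag (hor P) (Hh \<tau>))"
    and controllability: "uniform_controllability P w \<gamma>C tC"
    and boundedness: "uniform_boundedness P Hh w U"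
    and compactness: "compact_smooth P w d U \<Z> \<Z>N \<Lambda>"
    and mu: "mu c \<ge> 32 * U ^ (4 * tC + 1) / \<gamma>C"
  shows "\<exists>\<tau>bar. \<forall>\<tau>\<ge>\<tau>bar. \<forall>i<nsub c.
           eta1 (p \<tau>) = eta1 (p \<tau>bar) \<and> eta2 (p \<tau>) = eta2 (p \<tau>bar) \<and> eps (p \<tau>) = eps (p \<tau>bar) \<and>
           leps (p \<tau>) i = leps (p \<tau>bar) i \<and> ovl (p \<tau>) i = ovl (p \<tau>bar) i \<and>
           descent P (eta1 (p \<tau>)) (eta2 (p \<tau>)) (w \<tau>) (d \<tau>) \<and>
           0 < eps (p \<tau>bar) \<and> eps (p \<tau>bar) < 1 \<and> 0 < leps (p \<tau>bar) i"
proof -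

  \<comment> \<open>Constants common to all iterates\<close>
  let ?N = "hor P" and ?M = "nsub c"
  have dec: "valid_decomposition ?N ?M (knot c)" and beta: "0 < beta c" "beta c < 1 / 2"
    and rho: "0 < rho_eps c" and nu: "1 < nu c"
    and init: "0 < eta1 p0" "0 < eta2 p0" "0 < eps p0" "\<And>i. i < ?M \<Longrightarrow> 0 < leps p0 i"
    using inputs by (auto simp: valid_inputs_def)
  have M: "0 < ?M" using dec by (simp add: valid_decomposition_def)
  have it: "iterate P (w \<tau>) (Hh \<tau>) U \<gamma>RH" for \<tau>
    by (rule iterate_of_assumptions[OF _ red_hess boundedness compactness])
      (use run in \<open>simp add: aotd_run_def\<close>)
  interpret I: iterate P "w 0" "Hh 0" U \<gamma>RH by (rule it)
  define \<rho> where "\<rho> = rinv_const ?N (2 * U)"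
  define \<kappa> where "\<kappa> = op_const ?N (2 * U)"
  define \<iota> where "\<iota> = inv_const ?N (2 * U) \<gamma>RH"
  define C1 where "C1 = garding_const ?N (2 * U) \<gamma>RH"
  define \<psi> where "\<psi> = psi_const ?N (2 * U) \<gamma>RH"
  have c: "1 \<le> \<rho>" "1 \<le> \<kappa>" "0 \<le> C1" "1 \<le> \<iota>" "20 \<le> \<psi>"
    using I.const_ge I.inv_const_ge I.Psi_bounds by (auto simp: \<rho>_def \<kappa>_def C1_def \<iota>_def \<psi>_def)
  define a where "a = eta1 p0 * (eta2 p0)\<^sup>2"
  define E where "E = eps p0 / eta2 p0 ^ 4"
  have a: "0 < a" "0 < E" using init by (auto simp: a_def E_def)
  define r where "r = exp (- rho_eps c / sqrt (real ?M))"
  have r: "0 < r" "r < 1" using rho M by (auto simp: r_def)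
  have W: "0 < 8 * (2 * C1 + 4 * \<rho> + 4 * \<rho>\<^sup>2 * \<kappa>\<^sup>2 / \<gamma>RH + 4 / \<gamma>RH + 2)"
    and W': "0 \<le> 2 * C1 + 16 * \<rho>\<^sup>2 * \<kappa>\<^sup>2 / \<gamma>RH" "0 \<le> 16 * \<rho>\<^sup>2" "0 < 256 * \<kappa>\<^sup>2"
    using c red_hess(1) by (simp_all add: add_nonneg_pos)
  obtain \<theta> where \<theta>: "0 < \<theta>"
    "\<forall>\<eta>1 \<eta> \<epsilon>. 0 < \<eta> \<longrightarrow> \<eta> \<le> \<theta> \<longrightarrow> \<eta>1 * \<eta>\<^sup>2 = a \<longrightarrow> 0 \<le> \<epsilon> \<longrightarrow> \<epsilon> \<le> E * \<eta> ^ 4 \<longrightarrow>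
       \<epsilon> * \<iota> \<le> 1 \<and> \<epsilon> * \<iota> * (1 + \<eta>1 + \<eta>) * (8 * (2 * C1 + 4 * \<rho> + 4 * \<rho>\<^sup>2 * \<kappa>\<^sup>2 / \<gamma>RH + 4 / \<gamma>RH + 2)) \<le> \<eta>
       \<and> (256 * \<kappa>\<^sup>2) * \<eta> \<le> \<gamma>RH \<and> (2 * C1 + 16 * \<rho>\<^sup>2 * \<kappa>\<^sup>2 / \<gamma>RH) + (16 * \<rho>\<^sup>2) / \<eta> + \<eta> \<le> \<eta>1"
    using small_penalty_threshold[OF a less_le_trans[OF zero_less_one c(4)] W red_hess(1) W'] by (elim exE conjE)
  \<comment> \<open>The factor in \<open>composed_accurate\<close>: local tolerances up to
    \<open>eps / F\<close> give a composition meeting tolerance \<open>eps\<close>.\<close>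
  define F where "F = (6 * \<kappa> * ((1 + real ?N) * \<iota>) + 1) * (3 * \<kappa> * \<psi>)"
  have F: "0 < F" unfolding F_def using c by (intro mult_pos_pos add_nonneg_pos mult_nonneg_nonneg) auto
  \<comment> \<open>The first entry bounds every local tolerance; the second bounds
    \<open>r ^ ovl\<close> by \<open>r ^ ?N\<close> and so forces all overlaps to reach the horizon
    length.\<close>
  define thr where "thr \<epsilon> = min (\<epsilon> / F) (r ^ ?N)" for \<epsilon>
  have lp: "loops P c \<gamma>RH (w \<tau>) (Hh \<tau>) a E \<theta> r thr" for \<tau>
  proof -
    interpret J: iterate P "w \<tau>" "Hh \<tau>" U \<gamma>RH by (rule it)
    show ?thesis
    proof
      show "1 < nu c" "r = exp (- rho_eps c / sqrt (real ?M))" "0 < r" "r < 1" "0 < rho_eps c"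
        using nu r rho by (auto simp: r_def)
      show "0 < eps_max P c \<gamma>RH (w \<tau>) (Hh \<tau>) \<eta>1 \<eta>2" if "0 < \<eta>1" "0 < \<eta>2" for \<eta>1 \<eta>2
        by (rule J.eps_max_bounds(3)[OF that beta])
    next
      fix q and v :: "(real ^ 'nx, real ^ 'nu) pd"
      assume q: "global_inv a E ?M q" "eta2 q \<le> \<theta>" and v: "v \<in> pd_space 0 ?N"
        and acc: "accurate P \<gamma>RH (w \<tau>) (Hh \<tau>) (eps q) v"
      have *: "0 < eta1 q" "0 < eta2 q" "eta1 q * (eta2 q)\<^sup>2 = a" "0 \<le> eps q" "eps q \<le> E * eta2 q ^ 4"
        using q(1) by (auto simp: global_inv_def)
      show "descent P (eta1 q) (eta2 q) (w \<tau>) v"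
        using \<theta>(2)[rule_format, OF *(2) q(2) *(3-5)] unfolding \<rho>_def \<kappa>_def C1_def \<iota>_def
        by (intro J.accurate_imp_descent[OF acc v *(4,1,2)]) (auto simp: algebra_simps)
    next
      fix q and v :: "(real ^ 'nx, real ^ 'nu) pd"
      assume q: "global_inv a E ?M q" and X: "local_size r ?M q \<le> thr (eps q)"
        and comp: "composed_direction P c (w \<tau>) (Hh \<tau>) (leps q) (ovl q) v"
      have *: "0 < eps q" "\<And>i. i < ?M \<Longrightarrow> 0 < leps q i" using q by (auto simp: global_inv_def)
      have summand: "leps q i + r ^ ovl q i \<le> thr (eps q)" if "i < ?M" for i
      proof -
        have "leps q i + r ^ ovl q i \<le> local_size r ?M q"
          unfolding local_size_def using that *(2) r
          by (intro member_le_sum[of i _ "\<lambda>i. leps q i + r ^ ovl q i"]) (auto intro!: add_nonneg_nonneg intro: less_imp_le)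
        with X show ?thesis by simp
      qed
      show "accurate P \<gamma>RH (w \<tau>) (Hh \<tau>) (eps q) v"
      proof (rule J.composed_accurate[OF dec _ _ comp])
        show "?N \<le> ovl q i" if i: "i < ?M" for i
        proof -
          have "r ^ ovl q i \<le> r ^ ?N" using summand[OF i] *(2)[OF i] by (simp add: thr_def)
          then show ?thesis using r by (simp add: power_decreasing_iff)
        qed
        show "leps q i \<le> eps q / F" if i: "i < ?M" for i
        proof -
          have "0 \<le> r ^ ovl q i" using r by simp
          then show ?thesis using summand[OF i] by (simp add: thr_def)
        qed
        show "0 \<le> eps q / F" using F *(1) by simp
        have "(6 * \<kappa> * ((1 + real ?N) * \<iota>) + 1) * (eps q / F) * (3 * \<kappa> * \<psi>) = F * (eps q / F)"
          unfolding F_def by (simp only: mult_ac)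
        also have "\<dots> = eps q" using F by simp
        finally show "(6 * op_const ?N (2 * U) * ((1 + real ?N) * inv_const ?N (2 * U) \<gamma>RH) + 1) * (eps q / F)
            * (3 * op_const ?N (2 * U) * psi_const ?N (2 * U) \<gamma>RH) \<le> eps q"
          unfolding \<kappa>_def \<iota>_def \<psi>_def by simp
      qed
    qed
  qed

  \<comment> \<open>Effect of a single iteration on the parameters\<close>
  let ?prev = "\<lambda>\<tau>. case \<tau> of 0 \<Rightarrow> p0 | Suc \<sigma> \<Rightarrow> p \<sigma>"
  let ?sg = "\<lambda>\<tau>. eps_safeguard P c \<gamma>RH (w \<tau>) (Hh \<tau>) (?prev \<tau>)"
  let ?inv = "global_inv a E ?M"
  have dl: "dir_loop P c \<gamma>RH (w \<tau>) (Hh \<tau>) (\<lambda>_. 0) (?sg \<tau>) (d \<tau>) (p \<tau>)" for \<tau>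
    using run unfolding aotd_run_def aotd_step_def by blast
  have zero: "(\<lambda>_. 0) \<in> pd_space 0 ?N" by (rule I.zero_spaces)
  have one: "?inv (p \<tau>)" "eps (p \<tau>) \<le> eps_max P c \<gamma>RH (w \<tau>) (Hh \<tau>) (eta1 (p \<tau>)) (eta2 (p \<tau>))"
      "descent P (eta1 (p \<tau>)) (eta2 (p \<tau>)) (w \<tau>) (d \<tau>)"
      "same_globals (?sg \<tau>) (p \<tau>) \<and> local_step r ?M thr (?sg \<tau>) (p \<tau>) \<or>
        \<theta> < eta2 (?prev \<tau>) \<and> eta2 (p \<tau>) \<le> 1 / nu c * eta2 (?prev \<tau>)"
    if "?inv (?prev \<tau>)" for \<tau>
  proof -
    interpret L: loops P c \<gamma>RH "w \<tau>" "Hh \<tau>" a E \<theta> r thr by (rule lp)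
    note sg = L.eps_safeguard_effect[OF that]
    show "?inv (p \<tau>)" "eps (p \<tau>) \<le> eps_max P c \<gamma>RH (w \<tau>) (Hh \<tau>) (eta1 (p \<tau>)) (eta2 (p \<tau>))"
      "descent P (eta1 (p \<tau>)) (eta2 (p \<tau>)) (w \<tau>) (d \<tau>)"
      "same_globals (?sg \<tau>) (p \<tau>) \<and> local_step r ?M thr (?sg \<tau>) (p \<tau>) \<or>
        \<theta> < eta2 (?prev \<tau>) \<and> eta2 (p \<tau>) \<le> 1 / nu c * eta2 (?prev \<tau>)"
      using L.dir_loop_effect[OF dl zero sg(1,2)] unfolding L.eps_inv_def sg(4) by blast+
  qed
  have inv0: "?inv p0" using init by (auto simp: global_inv_def a_def E_def)
  have inv: "?inv (?prev \<tau>)" for \<tau>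
  proof (induction \<tau>)
    case (Suc \<tau>)
    from one(1)[OF this] show ?case by simp
  qed (simp add: inv0)
  note one = one[OF inv]
  have pos: "0 < eta1 (p \<tau>)" "0 < eta2 (p \<tau>)" "0 < eps (p \<tau>)" "i < ?M \<Longrightarrow> 0 < leps (p \<tau>) i"
    "eta1 (p \<tau>) * (eta2 (p \<tau>))\<^sup>2 = a" for \<tau> i
    using one(1)[of \<tau>] by (auto simp: global_inv_def)
  have step: "same_globals (?sg (Suc \<tau>)) (p (Suc \<tau>)) \<and> local_step r ?M thr (?sg (Suc \<tau>)) (p (Suc \<tau>)) \<or>
      \<theta> < eta2 (p \<tau>) \<and> eta2 (p (Suc \<tau>)) \<le> 1 / nu c * eta2 (p \<tau>)" for \<tau>
    using one(4)[of "Suc \<tau>"] by simp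
  have sg: "eta1 (?sg (Suc \<tau>)) = eta1 (p \<tau>)" "eta2 (?sg (Suc \<tau>)) = eta2 (p \<tau>)"
    "?sg (Suc \<tau>) = p \<tau> \<or> eps_max P c \<gamma>RH (w (Suc \<tau>)) (Hh (Suc \<tau>)) (eta1 (p \<tau>)) (eta2 (p \<tau>)) < eps (p \<tau>) \<and>
       eps (?sg (Suc \<tau>)) \<le> 1 / nu c * eps (p \<tau>)" for \<tau>
    using loops.eps_safeguard_effect(3-5)[OF lp one(1)] by simp_all

  \<comment> \<open>Successive freezing of penalties, global tolerance and local parameters\<close>
  have nu': "0 < 1 / nu c" "1 / nu c < 1" using nu by auto
  have "\<exists>T\<ge>0. \<forall>\<tau>\<ge>T. eta2 (p \<tau>) = eta2 (p T)"
  proof (rule geometric_decrease_stops[of 0 "\<lambda>\<tau>. eta2 (p \<tau>)" "1 / nu c" \<theta>])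
    show "eta2 (p (Suc \<tau>)) = eta2 (p \<tau>) \<or> \<theta> < eta2 (p \<tau>) \<and> eta2 (p (Suc \<tau>)) \<le> 1 / nu c * eta2 (p \<tau>)" for \<tau>
      using step[of \<tau>] sg(2)[of \<tau>] by (auto simp: same_globals_def)
  qed (rule pos(2) nu' \<theta>(1))+
  then obtain T1 where T1: "\<And>\<tau>. T1 \<le> \<tau> \<Longrightarrow> eta2 (p \<tau>) = eta2 (p T1)" by blast
  \<comment> \<open>With \<open>eta2\<close> frozen, the alternative that loses a factor
    \<open>nu c\<close> is impossible, so no penalty update happens any more.\<close>
  have step1: "same_globals (?sg (Suc \<tau>)) (p (Suc \<tau>)) \<and> local_step r ?M thr (?sg (Suc \<tau>)) (p (Suc \<tau>))" if "T1 \<le> \<tau>" for \<tau>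
  proof -
    have "eta2 (p (Suc \<tau>)) = eta2 (p \<tau>)" using T1[of "Suc \<tau>"] T1[of \<tau>] that by simp
    moreover have "1 / nu c * eta2 (p \<tau>) < 1 * eta2 (p \<tau>)" using nu' pos(2) by (intro mult_strict_right_mono) auto
    ultimately show ?thesis using step[of \<tau>] by auto
  qed
  have eta1: "eta1 (p \<tau>) = eta1 (p T1)" if "T1 \<le> \<tau>" for \<tau>
    using that by (induction \<tau> rule: dec_induct) (use step1 sg(1) in \<open>auto simp: same_globals_def\<close>)
  define lo where "lo = (1 / 2 - beta c) * eta2 (p T1) / ((1 + eta1 (p T1) + eta2 (p T1)) * (\<psi> * \<kappa>)\<^sup>2)"
  have lo_pos: "0 < lo" unfolding lo_def using pos(1,2)[of T1] beta c by (intro divide_pos_pos mult_pos_pos) auto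
  have "\<exists>T\<ge>T1. \<forall>\<tau>\<ge>T. eps (p \<tau>) = eps (p T)"
  proof (rule geometric_decrease_stops[of T1 "\<lambda>\<tau>. eps (p \<tau>)" "1 / nu c" lo])
    fix \<tau> assume \<tau>: "T1 \<le> \<tau>"
    interpret J: iterate P "w (Suc \<tau>)" "Hh (Suc \<tau>)" U \<gamma>RH by (rule it)
    have le: "lo \<le> eps_max P c \<gamma>RH (w (Suc \<tau>)) (Hh (Suc \<tau>)) (eta1 (p \<tau>)) (eta2 (p \<tau>))"
      using J.eps_max_bounds(2)[OF pos(1,2) beta, of T1 T1] unfolding T1[OF \<tau>] eta1[OF \<tau>] lo_def \<psi>_def \<kappa>_def .
    have e: "eps (p (Suc \<tau>)) = eps (?sg (Suc \<tau>))" using step1[OF \<tau>] by (simp only: same_globals_def)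
    show "eps (p (Suc \<tau>)) = eps (p \<tau>) \<or> lo < eps (p \<tau>) \<and> eps (p (Suc \<tau>)) \<le> 1 / nu c * eps (p \<tau>)"
      using sg(3)[of \<tau>]
    proof (elim disjE conjE)
      assume "?sg (Suc \<tau>) = p \<tau>"
      then show ?thesis unfolding e by (intro disjI1 arg_cong[where f=eps])
    next
      assume "eps_max P c \<gamma>RH (w (Suc \<tau>)) (Hh (Suc \<tau>)) (eta1 (p \<tau>)) (eta2 (p \<tau>)) < eps (p \<tau>)"
        and "eps (?sg (Suc \<tau>)) \<le> 1 / nu c * eps (p \<tau>)"
      then show ?thesis unfolding e by (intro disjI2 conjI le_less_trans[OF le])
    qed
  qed (rule pos(3) nu' lo_pos)+
  then obtain T2 where T2: "T1 \<le> T2" "\<And>\<tau>. T2 \<le> \<tau> \<Longrightarrow> eps (p \<tau>) = eps (p T2)" by blast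
  \<comment> \<open>A safeguard intervention would strictly lower \<open>eps\<close>; as
    \<open>eps\<close> is frozen, the loops start from the carried parameters themselves.\<close>
  have step2: "local_step r ?M thr (p \<tau>) (p (Suc \<tau>))" if "T2 \<le> \<tau>" for \<tau>
  proof -
    have "eps (p (Suc \<tau>)) = eps (p \<tau>)" using T2(2)[of "Suc \<tau>"] T2(2)[of \<tau>] that by simp
    moreover have "1 / nu c * eps (p \<tau>) < 1 * eps (p \<tau>)" using nu' pos(3) by (intro mult_strict_right_mono) auto
    moreover have "T1 \<le> \<tau>" using that T2(1) by simp
    moreover have "eps (p (Suc \<tau>)) = eps (?sg (Suc \<tau>))"
      using step1[OF \<open>T1 \<le> \<tau>\<close>] by (simp only: same_globals_def)
    ultimately have "\<not> eps (?sg (Suc \<tau>)) \<le> 1 / nu c * eps (p \<tau>)" by linarith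
    with sg(3)[of \<tau>] have "?sg (Suc \<tau>) = p \<tau>" by blast
    with step1[OF \<open>T1 \<le> \<tau>\<close>] show ?thesis by (simp only:)
  qed
  have Xpos: "0 < local_size r ?M (p \<tau>)" for \<tau>
    unfolding local_size_def using M pos(4) r by (intro sum_pos) (auto intro!: add_pos_pos)
  have thr_pos: "0 < thr (eps (p T2))" using pos(3) F r by (simp add: thr_def)
  have "\<exists>T\<ge>T2. \<forall>\<tau>\<ge>T. local_size r ?M (p \<tau>) = local_size r ?M (p T)"
  proof (rule geometric_decrease_stops[of T2 "\<lambda>\<tau>. local_size r ?M (p \<tau>)" r "thr (eps (p T2))"])
    fix \<tau> assume "T2 \<le> \<tau>"
    then show "local_size r ?M (p (Suc \<tau>)) = local_size r ?M (p \<tau>) \<or>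
        thr (eps (p T2)) < local_size r ?M (p \<tau>) \<and> local_size r ?M (p (Suc \<tau>)) \<le> r * local_size r ?M (p \<tau>)"
      using step2[of \<tau>] T2(2)[of \<tau>] by (auto simp: local_step_def)
  qed (rule Xpos r thr_pos)+
  then obtain T3 where T3: "T2 \<le> T3" "\<And>\<tau>. T3 \<le> \<tau> \<Longrightarrow> local_size r ?M (p \<tau>) = local_size r ?M (p T3)" by blast
  \<comment> \<open>A positive potential that does not change excludes the contracting alternative
    of \<open>local_step\<close>, so the whole record is equal to its predecessor.\<close>
  have const: "p \<tau> = p T3" if "T3 \<le> \<tau>" for \<tau>
    using that
  proof (induction \<tau> rule: dec_induct)
    case (step \<tau>)
    have "local_size r ?M (p (Suc \<tau>)) = local_size r ?M (p \<tau>)" using T3(2)[of "Suc \<tau>"] T3(2)[of \<tau>] step by simp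
    moreover have "r * local_size r ?M (p \<tau>) < 1 * local_size r ?M (p \<tau>)" using r Xpos by (intro mult_strict_right_mono) auto
    ultimately show ?case using step2[of \<tau>] T3(1) step by (auto simp: local_step_def)
  qed simp
  have eps1: "eps (p T3) < 1"
  proof -
    interpret J: iterate P "w T3" "Hh T3" U \<gamma>RH by (rule it)
    show ?thesis using one(2)[of T3] J.eps_max_bounds(1)[OF pos(1,2) beta, of T3 T3] by linarith
  qed
  show ?thesis
  proof (intro exI[of _ T3] allI impI)
    fix \<tau> i assume \<tau>: "T3 \<le> \<tau>" and i: "i < ?M"
    show "eta1 (p \<tau>) = eta1 (p T3) \<and> eta2 (p \<tau>) = eta2 (p T3) \<and> eps (p \<tau>) = eps (p T3) \<and>
        leps (p \<tau>) i = leps (p T3) i \<and> ovl (p \<tau>) i = ovl (p T3) i \<and>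
        descent P (eta1 (p \<tau>)) (eta2 (p \<tau>)) (w \<tau>) (d \<tau>) \<and>
        0 < eps (p T3) \<and> eps (p T3) < 1 \<and> 0 < leps (p T3) i"
      using one(3)[of \<tau>] pos(3)[of T3] pos(4)[OF i, of T3] eps1 unfolding const[OF \<tau>] by blast
  qed
qed

end
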